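(* Let $k\ge1$ be an integer and let $\phi$ be a real-valued function defined in a neighborhood of the origin in $\mathbb{R}^d$, with $\phi(\mathbf 0)=0$ and $\nabla\phi(\mathbf 0)=\mathbf 0$, which is either analytic nondegenerate or $k$-nondegenerate. There is a neighborhood $U$ of the origin such that the following holds for every $C^k$ function $\psi:\mathbb{R}^d\to\mathbb{R}$ compactly supported in $U$. Let $\beta\in\mathbb{N}^d$ satisfy $\lfloor\beta+\mathbf 1\rfloor<k-1$, and let $d_\beta$ be the greatest codimension over all faces of $\mathcal N(\phi)$ containing $(\beta+\mathbf 1)/\lfloor\beta+\mathbf 1\rfloor$. Then there is a constant independent of $\lambda$ such that for all $\lambda>2$, $$\left|\int_{\mathbb{R}^d}e^{i\lambda\phi(x)}x^\beta\psi(x)\,dx\right|\ \lesssim\ \lambda^{-\lfloor\beta+\mathbf 1\rfloor}\log^{d_\beta-1}(\lambda).$$ If in addition $\phi$ and $\psi$ are smooth ($C^\infty$), then the inequality holds for all $\beta\in\mathbb{N}^d$.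
   Context: Notation: $\mathbb{N}=\{0,1,2,\dots\}$, $\mathbb{R}_{\ge}=[0,\infty)$, $\mathbf 1=(1,\dots,1)\in\mathbb{R}^d$. $\|\cdot\|$ is the $\ell^\infty$ norm on $\mathbb{R}^d$. For vectors, $xy=(x_1y_1,\dots,x_dy_d)$, so $\|x\nabla\phi(x)\|=\max_j|x_j\partial_j\phi(x)|$. $A\lesssim B$ means $A\le CB$ for a positive constant $C$. Newton polyhedron: for $\phi$ analytic near the origin with $\phi(x)=\sum_\alpha c_\alpha x^\alpha$, $\operatorname{supp}(\phi)=\{\alpha\in\mathbb{N}^d:c_\alpha\ne0\}$, and $\mathcal N(\phi)$ is the convex hull of $\bigcup_{\alpha\in\operatorname{supp}(\phi)}(\alpha+\mathbb{R}_{\ge}^d)$. For a compact face $F$ of $\mathcal N(\phi)$, $\phi_F(x)=\sum_{\alpha\in F}c_\alpha x^\alpha$. $\phi$ is analytic nondegenerate if it is analytic near the origin and for every compact face $F$ of $\mathcal N(\phi)$ and every $x\in\mathbb{R}^d$ with $x_1\cdots x_d\neq0$ one has $\|x\nabla\phi_F(x)\|\ne0$. A polynomial $P$ is convenient if $\mathcal N(P)$ intersects each coordinate axis. If $\phi$ is $C^k$ near the origin, let $P_k$ be its Taylor polynomial at the origin of order at most $k$. $\phi$ is $k$-nondegenerate if $P_k$ is convenient and analytic nondegenerate; in that case $\mathcal N(\phi):=\mathcal N(P_k)$. The function $\lfloor\cdot\rfloor$: a facet of $\mathcal N(\phi)$ is a codimension 1 face not contained in a coordinate hyperplane. Each facet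 lies in a unique hyperplane $\{\xi:\xi\cdot w=1\}$ with $w\in\mathbb{R}_{\ge}^d$; let $W$ be the finite set of these normals $w$. For $\alpha\in\mathbb{N}^d$, $\lfloor\alpha\rfloor:=\min_{w\in W}\alpha\cdot w$ (this is not the integer part). Thus $\lfloor\beta+\mathbf 1\rfloor$ is the positive constant $c$ such that $(\beta+\mathbf 1)/c\in\partial\mathcal N(\phi)$. *)

theory Defs
  imports "HOL-Analysis.Analysis"
begin

subsection \<open>Multi-indices, partial derivatives and the classes \<open>C\<^sup>k\<close>\<close>

definition mpow :: "real ^ 'n::finite \<Rightarrow> nat ^ 'n \<Rightarrow> real" where
  "mpow x \<alpha> = (\<Prod>i\<in>UNIV. (x $ i) ^ (\<alpha> $ i))"

definition rvec :: "nat ^ 'n::finite \<Rightarrow> real ^ 'n" where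
  "rvec \<alpha> = (\<chi> i. real (\<alpha> $ i))"

definition partial_deriv :: "'n::finite \<Rightarrow> (real ^ 'n \<Rightarrow> real) \<Rightarrow> real ^ 'n \<Rightarrow> real" where
  "partial_deriv i f x = frechet_derivative f (at x) (axis i 1)"

definition gradient :: "(real ^ 'n::finite \<Rightarrow> real) \<Rightarrow> real ^ 'n \<Rightarrow> real ^ 'n" where
  "gradient f x = (\<chi> i. partial_deriv i f x)"

text \<open>Only used for open sets \<open>S\<close>.\<close>

primrec Ck_on :: "nat \<Rightarrow> (real ^ 'n::finite \<Rightarrow> real) \<Rightarrow> (real ^ 'n) set \<Rightarrow> bool" where
  "Ck_on 0 f S \<longleftrightarrow> continuous_on S f"
| "Ck_on (Suc k) f S \<longleftrightarrow>
     (\<forall>x\<in>S. f differentiable (at x)) \<and> (\<forall>i. Ck_on k (partial_deriv i f) S)"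

definition Ck_near_0 :: "nat \<Rightarrow> (real ^ 'n::finite \<Rightarrow> real) \<Rightarrow> bool" where
  "Ck_near_0 k f \<longleftrightarrow> (\<exists>V. open V \<and> 0 \<in> V \<and> Ck_on k f V)"

definition smooth_near_0 :: "(real ^ 'n::finite \<Rightarrow> real) \<Rightarrow> bool" where
  "smooth_near_0 f \<longleftrightarrow> (\<exists>V. open V \<and> 0 \<in> V \<and> (\<forall>m. Ck_on m f V))"

text \<open>
  The index type carries no order, so \<open>\<partial>\<^sup>\<alpha>\<close> differentiates along some list of
  coordinates that contains each \<open>i\<close> exactly \<open>\<alpha>\<^sub>i\<close> times; where \<open>f\<close> is of class
  \<open>C\<^sup>|\<^sup>\<alpha>\<^sup>|\<close> the choice is immaterial, as mixed partial derivatives commute.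
\<close>

definition multi_deriv :: "nat ^ 'n::finite \<Rightarrow> (real ^ 'n \<Rightarrow> real) \<Rightarrow> real ^ 'n \<Rightarrow> real" where
  "multi_deriv \<alpha> f = foldr partial_deriv (SOME is. \<forall>i. count_list is i = \<alpha> $ i) f"

definition taylor_polynomial :: "nat \<Rightarrow> (real ^ 'n::finite \<Rightarrow> real) \<Rightarrow> real ^ 'n \<Rightarrow> real" where
  "taylor_polynomial k f x =
     (\<Sum>\<alpha> | (\<Sum>i\<in>UNIV. \<alpha> $ i) \<le> k.
        multi_deriv \<alpha> f 0 / (\<Prod>i\<in>UNIV. fact (\<alpha> $ i)) * mpow x \<alpha>)"


subsection \<open>Newton polyhedra and nondegeneracy\<close>

definition has_power_series :: "(real ^ 'n::finite \<Rightarrow> real) \<Rightarrow> (nat ^ 'n \<Rightarrow> real) \<Rightarrow> bool" where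
  "has_power_series \<phi> c \<longleftrightarrow>
     (\<forall>\<^sub>F x in nhds 0. ((\<lambda>\<alpha>. c \<alpha> * mpow x \<alpha>) has_sum \<phi> x) UNIV)"

definition analytic_at_0 :: "(real ^ 'n::finite \<Rightarrow> real) \<Rightarrow> bool" where
  "analytic_at_0 \<phi> \<longleftrightarrow> (\<exists>c. has_power_series \<phi> c)"

text \<open>For analytic \<open>\<phi>\<close> the coefficients are unique, so nothing is really chosen here.\<close>

definition ps_coeff :: "(real ^ 'n::finite \<Rightarrow> real) \<Rightarrow> nat ^ 'n \<Rightarrow> real" where
  "ps_coeff \<phi> = (SOME c. has_power_series \<phi> c)"

definition ps_supp :: "(real ^ 'n::finite \<Rightarrow> real) \<Rightarrow> (nat ^ 'n) set" where
  "ps_supp \<phi> = {\<alpha>. ps_coeff \<phi> \<alpha> \<noteq> 0}"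

definition newton_polyhedron :: "(real ^ 'n::finite \<Rightarrow> real) \<Rightarrow> (real ^ 'n) set" where
  "newton_polyhedron \<phi> =
     convex hull (\<Union>\<alpha>\<in>ps_supp \<phi>. {rvec \<alpha> + v | v. \<forall>i. 0 \<le> v $ i})"

text \<open>Meant for bounded \<open>F\<close>, for which the sum is finite.\<close>

definition face_part :: "(real ^ 'n::finite \<Rightarrow> real) \<Rightarrow> (real ^ 'n) set \<Rightarrow> real ^ 'n \<Rightarrow> real" where
  "face_part \<phi> F x = (\<Sum>\<alpha> | rvec \<alpha> \<in> F. ps_coeff \<phi> \<alpha> * mpow x \<alpha>)"

text \<open>
  The product of vectors is componentwise and \<^const>\<open>infnorm\<close> is the \<open>\<ell>\<^sup>\<infinity>\<close> norm.  The
  empty set is a \<^const>\<open>face_of\<close> every set and has to be excluded.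
\<close>

definition analytic_nondegenerate :: "(real ^ 'n::finite \<Rightarrow> real) \<Rightarrow> bool" where
  "analytic_nondegenerate \<phi> \<longleftrightarrow>
     analytic_at_0 \<phi> \<and>
     (\<forall>F. F face_of newton_polyhedron \<phi> \<and> F \<noteq> {} \<and> compact F \<longrightarrow>
        (\<forall>x. (\<Prod>i\<in>UNIV. x $ i) \<noteq> 0 \<longrightarrow> infnorm (x * gradient (face_part \<phi> F) x) \<noteq> 0))"

definition convenient :: "(real ^ 'n::finite \<Rightarrow> real) \<Rightarrow> bool" where
  "convenient P \<longleftrightarrow> (\<forall>j. \<exists>t. axis j t \<in> newton_polyhedron P)"

definition k_nondegenerate :: "nat \<Rightarrow> (real ^ 'n::finite \<Rightarrow> real) \<Rightarrow> bool" where
  "k_nondegenerate k \<phi> \<longleftrightarrow>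
     Ck_near_0 k \<phi> \<and> convenient (taylor_polynomial k \<phi>) \<and>
     analytic_nondegenerate (taylor_polynomial k \<phi>)"


subsection \<open>Exponents attached to a Newton polyhedron\<close>

definition facet_normals :: "(real ^ 'n::finite) set \<Rightarrow> (real ^ 'n) set" where
  "facet_normals N =
     {w. (\<forall>i. 0 \<le> w $ i) \<and>
         (\<exists>F. F facet_of N \<and> \<not> (\<exists>j. F \<subseteq> {\<xi>. \<xi> $ j = 0}) \<and> F \<subseteq> {\<xi>. \<xi> \<bullet> w = 1})}"

text \<open>
  The set of normals of the Newton polyhedron of \<open>\<phi>\<close> is finite and, if \<open>\<phi>(0) = 0\<close>, it is
  empty only when \<open>\<phi>\<close> has the zero power series and the minimum is undefined; we then use
  the value \<open>0\<close>.
\<close>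

definition newton_floor :: "(real ^ 'n::finite) set \<Rightarrow> nat ^ 'n \<Rightarrow> real" where
  "newton_floor N \<alpha> =
     (if facet_normals N = {} then 0 else Min ((\<lambda>w. rvec \<alpha> \<bullet> w) ` facet_normals N))"

definition max_codim :: "(real ^ 'n::finite) set \<Rightarrow> real ^ 'n \<Rightarrow> nat" where
  "max_codim N p =
     Max ((\<lambda>F. nat (int CARD('n) - aff_dim F)) ` {F. F face_of N \<and> p \<in> F})"

text \<open>Here \<open>1\<close> is the all-ones multi-index.\<close>

definition newton_log_index :: "(real ^ 'n::finite) set \<Rightarrow> nat ^ 'n \<Rightarrow> nat" where
  "newton_log_index N \<beta> = max_codim N (rvec (\<beta> + 1) /\<^sub>R newton_floor N (\<beta> + 1))"


subsection \<open>The oscillatory integral\<close>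

definition osc_integral ::
    "(real ^ 'n::finite \<Rightarrow> real) \<Rightarrow> (real ^ 'n \<Rightarrow> real) \<Rightarrow> nat ^ 'n \<Rightarrow> real \<Rightarrow> complex" where
  "osc_integral \<phi> \<psi> \<beta> l =
     (LINT x|lborel. exp (\<i> * complex_of_real (l * \<phi> x)) * complex_of_real (mpow x \<beta> * \<psi> x))"

definition osc_estimate ::
    "(real ^ 'n::finite) set \<Rightarrow> (real ^ 'n \<Rightarrow> real) \<Rightarrow> (real ^ 'n \<Rightarrow> real) \<Rightarrow> nat ^ 'n \<Rightarrow> bool" where
  "osc_estimate N \<phi> \<psi> \<beta> \<longleftrightarrow>
     (\<exists>C>0. \<forall>l>2. cmod (osc_integral \<phi> \<psi> \<beta> l)
        \<le> C * l powr (- newton_floor N (\<beta> + 1)) * ln l ^ (newton_log_index N \<beta> - 1))"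

end

theory Submission
  imports Defs
begin

text \<open>
  Let \<open>V\<close> be the finite set of minimal exponents of the series of \<open>\<phi>\<close> (respectively of its Taylor
  polynomial) and \<open>w(x) = \<Sum>\<^bsub>v\<in>V\<^esub> \<bar>x\<^sup>v\<bar>\<close>.  The Euler fields \<open>x\<^sub>i\<partial>\<^sub>i\<close> preserve monomials up to constants, so
  all their iterates on \<open>\<phi>\<close> are \<open>O(w)\<close>, and nondegeneracy gives the converse bound
  \<open>w \<lesssim> \<Sum>\<^sub>i \<bar>x\<^sub>i\<partial>\<^sub>i\<phi>\<bar>\<close>: a sequence violating it would, in logarithmic coordinates, escape to infinity in the
  normal cone of some compact face \<open>F\<close> and produce a zero of \<open>x\<nabla>\<phi>\<^sub>F\<close> off the coordinate hyperplanes.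
  In the \<open>C\<^sup>k\<close> case the Taylor remainder is harmless because convenience gives \<open>\<parallel>x\<parallel>\<^sup>k \<lesssim> w\<close>.

  Integrating by parts \<open>M\<close> times along \<open>\<Sum>\<^sub>i (x\<^sub>i\<partial>\<^sub>i\<phi>) x\<^sub>i\<partial>\<^sub>i\<close> bounds the oscillatory integral by
  \<open>\<integral> \<bar>x\<^sup>\<beta>\<bar> (1 + \<lambda>w)\<^bsup>-M\<^esup> dx\<close>.  On the dyadic box \<open>\<bar>x\<^sub>i\<bar> \<sim> 2\<^bsup>-j\<^sub>i\<^esup>\<close> the weight is about \<open>2\<^bsup>-m(j)\<^esup>\<close> with
  \<open>m(j) = min\<^bsub>v\<in>V\<^esub> v \<bullet> j\<close>.  Put \<open>c = \<lfloor>\<beta> + 1\<rfloor>\<close> and \<open>p = (\<beta> + 1)/c\<close>, a point in the relative interior of a face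
  of codimension \<open>d\<^sub>\<beta>\<close>.  Then \<open>m(j) \<le> p \<bullet> j - \<bar>u \<bullet> j\<bar>\<close> for small \<open>u\<close> along that face, so for \<open>M > c\<close> the sum over
  \<open>j\<close> decays exponentially in \<open>\<bar>p \<bullet> j - log\<^sub>2 \<lambda>\<bar>\<close> and in the directions of the face.  In the remaining
  \<open>d\<^sub>\<beta> - 1\<close> directions \<open>j\<close> ranges over \<open>O(log \<lambda>)\<close> values.
\<close>

text \<open>An ordinary derivative of \<open>x^v\<close> loses a power of \<open>x\<close>, so
  bounds by one weight would break down near the coordinate hyperplanes; an Euler field loses none.
  The integration by parts is therefore done once, on a whole ball, and dyadic boxes enter only
  afterwards, in the estimate of a positive integral. This dictates the notion \<open>symb\<close>:
  bounds by a fixed weight that survive a given number of Euler derivatives.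

  \<open>M\<close> integrations by parts take \<open>M\<close> derivatives of the amplitude but
  \<open>M + 1\<close> of the phase, since the field itself contains a derivative of \<phi>, and the
  sum over the boxes has the right size only for \<open>M > c\<close>. With \<open>k\<close>
  derivatives available, \<open>M = k - 1\<close>: this is the origin of the condition
  \<open>c < k - 1\<close>. For smooth data \<open>M\<close> is free, but the neighbourhood must not
  depend on it; the radius is fixed by the lower bound for the gradient and by the domain of the
  expansion, and only the constants depend on \<open>M\<close>.

  If the power series vanishes identically, \<open>V\<close> is empty and the exponent is the
  default 0; this case is treated apart.\<close>

section \<open>Exponents, weights and elementary bounds\<close>

lemma rvec_nth [simp]: "rvec \<alpha> $ i = real (\<alpha> $ i)"
  by (simp add: rvec_def)

lemma rvec_add: "rvec (\<alpha> + \<beta>) = rvec \<alpha> + rvec \<beta>"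
  by (simp add: rvec_def vec_eq_iff)

text \<open>On nonnegative covectors this is the support function of the Newton polyhedron, cf.
  \<open>newton_hull_inner_ge\<close>.\<close>

definition min_weight :: "(nat ^ 'n::finite) set \<Rightarrow> real ^ 'n \<Rightarrow> real" where
  "min_weight V t = Min ((\<lambda>v. rvec v \<bullet> t) ` V)"

definition monomial_weight :: "(nat ^ 'n::finite) set \<Rightarrow> real ^ 'n \<Rightarrow> real" where
  "monomial_weight V x = (\<Sum>v\<in>V. \<bar>mpow x v\<bar>)"

text \<open>A vector of \<open>span B\<close> orthogonal to \<open>B\<close> is orthogonal to
  itself, so the sum is positive on the unit sphere of the span; compactness and homogeneity do the
  rest.\<close>

lemma span_norm_lower_bound:
  fixes B :: "'a::euclidean_space set"
  assumes "finite B"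
  obtains \<delta> where "\<delta> > 0" "\<And>x. x \<in> span B \<Longrightarrow> \<delta> * norm x \<le> (\<Sum>b\<in>B. \<bar>b \<bullet> x\<bar>)"
proof -
  let ?S = "span B \<inter> sphere 0 1"
  let ?f = "\<lambda>x. \<Sum>b\<in>B. \<bar>b \<bullet> x\<bar>"
  have cS: "compact ?S" by (intro closed_Int_compact closed_span compact_sphere)
  have key: "\<exists>\<delta>>0. \<forall>x\<in>?S. \<delta> \<le> ?f x"
  proof (cases "?S = {}")
    case False
    have "continuous_on ?S ?f" by (intro continuous_intros)
    from continuous_attains_inf[OF cS False this]
    obtain x where x: "x \<in> ?S" "\<forall>y\<in>?S. ?f x \<le> ?f y" by blast
    have "?f x \<noteq> 0"
    proof
      assume "?f x = 0"
      then have "\<forall>b\<in>B. \<bar>b \<bullet> x\<bar> = 0" using assms by (subst (asm) sum_nonneg_eq_0_iff) auto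
      then have "orthogonal x y" if "y \<in> span B" for y
        using orthogonal_to_span[OF that, of x] by (auto simp: orthogonal_def inner_commute)
      then have "orthogonal x x" using x by blast
      then show False using x by (simp add: orthogonal_self)
    qed
    moreover have "0 \<le> ?f x" by (intro sum_nonneg) auto
    ultimately have "?f x > 0" by (metis order_le_less)
    then show ?thesis using x(2) by blast
  qed (auto intro: exI[of _ 1])
  then obtain \<delta> where \<delta>: "\<delta> > 0" "\<And>x. x \<in> ?S \<Longrightarrow> \<delta> \<le> ?f x" by blast
  have "\<delta> * norm x \<le> ?f x" if x: "x \<in> span B" for x
  proof (cases "x = 0")
    case False
    have "x /\<^sub>R norm x \<in> ?S" using x False by (auto intro: span_scale)
    from \<delta>(2)[OF this] have "\<delta> \<le> (\<Sum>b\<in>B. \<bar>b \<bullet> x\<bar> / norm x)"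
      by (simp add: divide_inverse abs_mult mult.commute)
    then show ?thesis using False by (simp add: pos_le_divide_eq flip: sum_divide_distrib)
  qed simp
  then show thesis using that \<delta>(1) by blast
qed

lemma finite_vec_bounded:
  "finite {j :: nat ^ 'n::finite. \<forall>i. j $ i \<in> F i}" and card_vec_bounded:
  "card {j :: nat ^ 'n::finite. \<forall>i. j $ i \<in> F i} \<le> (\<Prod>i\<in>UNIV. card (F i))"
  if "\<And>i. finite (F i)"
proof -
  have sub: "{j :: nat ^ 'n. \<forall>i. j $ i \<in> F i} \<subseteq> vec_lambda ` (PiE UNIV F)"
  proof
    fix j :: "nat ^ 'n" assume "j \<in> {j. \<forall>i. j $ i \<in> F i}"
    then show "j \<in> vec_lambda ` (PiE UNIV F)"
      by (intro image_eqI[of _ _ "vec_nth j"]) auto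
  qed
  have fin: "finite (PiE UNIV F)" using that by (intro finite_PiE) auto
  show "finite {j :: nat ^ 'n. \<forall>i. j $ i \<in> F i}"
    using finite_subset[OF sub] fin by blast
  have "card {j :: nat ^ 'n. \<forall>i. j $ i \<in> F i} \<le> card (vec_lambda ` (PiE UNIV F) :: (nat ^ 'n) set)"
    using sub fin by (intro card_mono) auto
  also have "\<dots> \<le> card (PiE UNIV F)" by (rule card_image_le[OF fin])
  also have "\<dots> = (\<Prod>i\<in>UNIV. card (F i))" by (simp add: card_PiE)
  finally show "card {j :: nat ^ 'n. \<forall>i. j $ i \<in> F i} \<le> (\<Prod>i\<in>UNIV. card (F i))" .
qed


subsection \<open>Symbols for the Euler fields\<close>

text \<open>Partial derivatives with values in any normed space: phase and amplitude are treated as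
  complex functions, whereas \<open>partial_deriv\<close> is real.\<close>

definition pd :: "'n::finite \<Rightarrow> (real ^ 'n \<Rightarrow> 'b::real_normed_vector) \<Rightarrow> real ^ 'n \<Rightarrow> 'b" where
  "pd i f x = frechet_derivative f (at x) (axis i 1)"

lemma partial_deriv_eq_pd: "partial_deriv i f = pd i f"
  by (rule ext) (simp add: pd_def partial_deriv_def)

definition eul :: "'n::finite \<Rightarrow> (real ^ 'n \<Rightarrow> 'b::real_normed_vector) \<Rightarrow> real ^ 'n \<Rightarrow> 'b" where
  "eul i f x = (x $ i) *\<^sub>R pd i f x"

lemma pd_eqI: "(f has_derivative f') (at x) \<Longrightarrow> pd i f x = f' (axis i 1)"
  unfolding pd_def using frechet_derivative_at by metis

lemma pd_cong_open:
  assumes "open S" "x \<in> S" "\<And>y. y \<in> S \<Longrightarrow> f y = g y"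
  shows "pd i f x = pd i g x"
proof -
  have "(f has_derivative f') (at x) \<longleftrightarrow> (g has_derivative f') (at x)" for f'
    using has_derivative_transform_within_open[OF _ assms(1,2)] assms(3) by metis
  then show ?thesis
    by (simp add: pd_def frechet_derivative_def)
qed

lemma differentiable_cong_open:
  assumes "open S" "x \<in> S" "\<And>y. y \<in> S \<Longrightarrow> f y = g y"
  shows "f differentiable (at x) \<longleftrightarrow> g differentiable (at x)"
  unfolding differentiable_def
  using has_derivative_transform_within_open[OF _ assms(1,2)] assms(3) by metis

lemma eul_cong_open:
  assumes "open S" "x \<in> S" "\<And>y. y \<in> S \<Longrightarrow> f y = g y"
  shows "eul i f x = eul i g x"
  using pd_cong_open[OF assms] by (simp add: eul_def)

lemma eul_const [simp]: "eul i (\<lambda>x. c) = (\<lambda>x. 0)"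
  by (rule ext) (simp add: eul_def pd_def)

lemma eul_add:
  assumes "f differentiable (at x)" "g differentiable (at x)"
  shows "eul i (\<lambda>x. f x + g x) x = eul i f x + eul i g x"
proof -
  obtain f' g' where "(f has_derivative f') (at x)" "(g has_derivative g') (at x)"
    using assms unfolding differentiable_def by blast
  note d = this
  show ?thesis
    unfolding eul_def pd_eqI[OF d(1)] pd_eqI[OF d(2)] pd_eqI[OF has_derivative_add[OF d]]
    by (simp add: scaleR_add_right)
qed

lemma eul_mult:
  fixes f g :: "real ^ 'n::finite \<Rightarrow> 'b::real_normed_algebra"
  assumes "f differentiable (at x)" "g differentiable (at x)"
  shows "eul i (\<lambda>x. f x * g x) x = eul i f x * g x + f x * eul i g x"
proof -
  obtain f' g' where "(f has_derivative f') (at x)" "(g has_derivative g') (at x)"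
    using assms unfolding differentiable_def by blast
  note d = this
  show ?thesis
    unfolding eul_def pd_eqI[OF d(1)] pd_eqI[OF d(2)] pd_eqI[OF has_derivative_mult[OF d]]
    by (simp add: scaleR_add_right add.commute)
qed

lemma eul_inverse:
  fixes f :: "real ^ 'n::finite \<Rightarrow> 'b::real_normed_field"
  assumes "f differentiable (at x)" "f x \<noteq> 0"
  shows "eul i (\<lambda>x. inverse (f x)) x = - (eul i f x * (inverse (f x) * inverse (f x)))"
proof -
  obtain f' where d: "(f has_derivative f') (at x)"
    using assms unfolding differentiable_def by blast
  show ?thesis
    unfolding eul_def pd_eqI[OF d] pd_eqI[OF Deriv.has_derivative_inverse[OF assms(2) d]]
    by (simp add: mult_ac)
qed

text \<open>The constants are uniform in the parameter \<open>p\<close>, which is the frequency in the application.\<close>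

primrec symb :: "nat \<Rightarrow> (real ^ 'n::finite) set \<Rightarrow> ('p \<Rightarrow> real ^ 'n \<Rightarrow> real)
    \<Rightarrow> ('p \<Rightarrow> real ^ 'n \<Rightarrow> 'b::real_normed_field) \<Rightarrow> bool" where
  "symb 0 S w f \<longleftrightarrow> (\<forall>p. continuous_on S (f p)) \<and> (\<exists>C. \<forall>p. \<forall>x\<in>S. norm (f p x) \<le> C * w p x)"
| "symb (Suc m) S w f \<longleftrightarrow> (\<forall>p. \<forall>x\<in>S. f p differentiable (at x)) \<and>
     (\<exists>C. \<forall>p. \<forall>x\<in>S. norm (f p x) \<le> C * w p x) \<and> (\<forall>i. symb m S w (\<lambda>p. eul i (f p)))"

lemma symb_bound: "symb m S w f \<Longrightarrow> \<exists>C. \<forall>p. \<forall>x\<in>S. norm (f p x) \<le> C * w p x"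
  by (cases m) auto

lemma symb_bound_nonneg:
  assumes "symb m S w f" and w: "\<And>p x. x \<in> S \<Longrightarrow> 0 \<le> w p x"
  obtains C where "C \<ge> 0" "\<And>p x. x \<in> S \<Longrightarrow> norm (f p x) \<le> C * w p x"
proof -
  obtain C where C: "\<And>p x. x \<in> S \<Longrightarrow> norm (f p x) \<le> C * w p x"
    using symb_bound[OF assms(1)] by blast
  have "norm (f p x) \<le> \<bar>C\<bar> * w p x" if "x \<in> S" for p x
    using C[OF that, of p] mult_right_mono[OF abs_ge_self[of C] w[OF that, of p]] by linarith
  then show ?thesis using that[of "\<bar>C\<bar>"] by simp
qed

lemma symb_cont: "symb m S w f \<Longrightarrow> continuous_on S (f p)"
  by (cases m) (auto simp: differentiable_imp_continuous_within continuous_at_imp_continuous_on)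

lemma symb_SucD: "symb (Suc m) S w f \<Longrightarrow> symb m S w f"
proof (induction m arbitrary: f)
  case 0
  then show ?case using symb_cont[OF 0] by auto
qed auto

lemma symb_mono_weight:
  assumes "symb m S w f" and w: "\<And>p x. x \<in> S \<Longrightarrow> 0 \<le> w p x"
    and le: "\<And>p x. x \<in> S \<Longrightarrow> w p x \<le> C * w' p x"
  shows "symb m S w' f"
proof -
  have bd: "\<exists>C. \<forall>p. \<forall>x\<in>S. norm (g p x) \<le> C * w' p x"
    if g: "symb m S w g" for m and g :: "'b \<Rightarrow> (real, 'a) vec \<Rightarrow> 'c"
  proof -
    obtain B where B: "B \<ge> 0" "\<And>p x. x \<in> S \<Longrightarrow> norm (g p x) \<le> B * w p x"
      using symb_bound_nonneg[OF g w] by blast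
    have "norm (g p x) \<le> (B * C) * w' p x" if "x \<in> S" for p x
      using B(2)[OF that, of p] mult_left_mono[OF le[OF that, of p] B(1)] by (simp add: mult.assoc)
    then show ?thesis by blast
  qed
  show ?thesis using assms(1)
  proof (induction m arbitrary: f)
    case 0
    then show ?case using bd[OF 0] by simp
  next
    case (Suc m)
    then show ?case using bd[OF Suc.prems] by simp
  qed
qed

lemma symb_cong:
  assumes "open S" "symb m S w f" "\<And>p x. x \<in> S \<Longrightarrow> f p x = g p x"
  shows "symb m S w g"
  using assms(2,3)
proof (induction m arbitrary: f g)
  case 0
  then show ?case by (auto cong: continuous_on_cong)
next
  case (Suc m)
  have "symb m S w (\<lambda>p. eul i (g p))" for i
  proof (rule Suc.IH[of "\<lambda>p. eul i (f p)"])
    show "eul i (f p) x = eul i (g p) x" if "x \<in> S" for p x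
      by (rule eul_cong_open[OF assms(1) that]) (use Suc.prems in auto)
  qed (use Suc.prems in auto)
  moreover have "g p differentiable at x" if "x \<in> S" for p x
    using Suc.prems that differentiable_cong_open[OF assms(1) that, of "f p" "g p"] by auto
  ultimately show ?case using Suc.prems by auto
qed

lemma symb_add:
  assumes "open S" "symb m S w f" "symb m S w g"
  shows "symb m S w (\<lambda>p x. f p x + g p x)"
  using assms(2,3)
proof (induction m arbitrary: f g)
  case (0 f g)
  then obtain C B where "\<forall>p. \<forall>x\<in>S. norm (f p x) \<le> C * w p x" "\<forall>p. \<forall>x\<in>S. norm (g p x) \<le> B * w p x"
    by auto
  then have "\<forall>p. \<forall>x\<in>S. norm (f p x + g p x) \<le> (C + B) * w p x"
    unfolding distrib_right using norm_triangle_ineq add_mono by (meson order_trans)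
  then show ?case using 0 by (auto intro: continuous_intros)
next
  case (Suc m f g)
  obtain C B where "\<forall>p. \<forall>x\<in>S. norm (f p x) \<le> C * w p x" "\<forall>p. \<forall>x\<in>S. norm (g p x) \<le> B * w p x"
    using Suc.prems by auto
  then have "\<forall>p. \<forall>x\<in>S. norm (f p x + g p x) \<le> (C + B) * w p x"
    unfolding distrib_right using norm_triangle_ineq add_mono by (meson order_trans)
  moreover have "symb m S w (\<lambda>p. eul i (\<lambda>x. f p x + g p x))" for i
    by (rule symb_cong[OF assms(1) Suc.IH[of "\<lambda>p. eul i (f p)" "\<lambda>p. eul i (g p)"]])
      (use Suc.prems in \<open>auto simp: eul_add\<close>)
  ultimately show ?case using Suc.prems by auto
qed

lemma symb_zero: "symb m S w (\<lambda>p x. 0)"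
  by (induction m) (auto intro: exI[of _ 0])

text \<open>Powers of the frequency are constants in \<open>x\<close>. Taking their norm as the
  weight records the dependence on the parameter exactly.\<close>

lemma symb_const: "symb m S (\<lambda>p x. norm (c p)) (\<lambda>p x. c p)"
  by (cases m) (auto intro: exI[of _ 1] symb_zero)

lemma symb_sum:
  assumes "open S" "\<And>i. i \<in> I \<Longrightarrow> symb m S w (f i)"
  shows "symb m S w (\<lambda>p x. \<Sum>i\<in>I. f i p x)"
  using assms(2)
  by (induction I rule: infinite_finite_induct) (auto intro: symb_zero symb_add[OF assms(1)])

lemma symb_mult:
  assumes "open S" and "symb m S w f" "symb m S v g"
    and w: "\<And>p x. x \<in> S \<Longrightarrow> 0 \<le> w p x" and v: "\<And>p x. x \<in> S \<Longrightarrow> 0 \<le> v p x"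
  shows "symb m S (\<lambda>p x. w p x * v p x) (\<lambda>p x. f p x * g p x)"
proof -
  have bd: "\<exists>C. \<forall>p. \<forall>x\<in>S. norm (f p x * g p x) \<le> C * (w p x * v p x)"
    if f: "symb m S w f" and g: "symb m S v g" for m f g
  proof -
    obtain B where B: "B \<ge> 0" "\<And>p x. x \<in> S \<Longrightarrow> norm (f p x) \<le> B * w p x"
      using symb_bound_nonneg[OF f w] by blast
    obtain C where C: "C \<ge> 0" "\<And>p x. x \<in> S \<Longrightarrow> norm (g p x) \<le> C * v p x"
      using symb_bound_nonneg[OF g v] by blast
    have "norm (f p x * g p x) \<le> (B * C) * (w p x * v p x)" if "x \<in> S" for p x
      using mult_mono[OF B(2)[OF that, of p] C(2)[OF that, of p]] B(1) w[OF that]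
      by (simp add: norm_mult mult_ac)
    then show ?thesis by blast
  qed
  show ?thesis using assms(2,3)
  proof (induction m arbitrary: f g)
    case (0 f g)
    then show ?case using bd[OF 0] by (auto intro: continuous_intros)
  next
    case (Suc m f g)
    have "symb m S (\<lambda>p x. w p x * v p x) (\<lambda>p. eul i (\<lambda>x. f p x * g p x))" for i
    proof (rule symb_cong[OF assms(1)])
      show "symb m S (\<lambda>p x. w p x * v p x) (\<lambda>p x. eul i (f p) x * g p x + f p x * eul i (g p) x)"
        using Suc.prems symb_SucD[OF Suc.prems(1)] symb_SucD[OF Suc.prems(2)]
        by (intro symb_add[OF assms(1)] Suc.IH) auto
    qed (use Suc.prems in \<open>auto simp: eul_mult\<close>)
    then show ?case using Suc.prems bd[OF Suc.prems] by auto
  qed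
qed

text \<open>The derivative of \<open>1/f\<close> is that of \<open>f\<close> times
  \<open>-1/f^2\<close>, of weight \<open>w * w^-1 * w^-1 = w^-1\<close>, so the induction closes on
  itself.\<close>

lemma symb_inverse:
  assumes "open S" and "symb m S w f" 
    and w: "\<And>p x. x \<in> S \<Longrightarrow> 0 < w p x" and c: "c > 0" "\<And>p x. x \<in> S \<Longrightarrow> c * w p x \<le> norm (f p x)"
  shows "symb m S (\<lambda>p x. inverse (w p x)) (\<lambda>p x. inverse (f p x))"
proof -
  have nz: "f p x \<noteq> 0" if "x \<in> S" for p x
    using c(2)[OF that, of p] mult_pos_pos[OF c(1) w[OF that, of p]] by auto
  have bd: "\<forall>p. \<forall>x\<in>S. norm (inverse (f p x)) \<le> inverse c * inverse (w p x)"
  proof (intro allI ballI)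
    fix p x assume x: "x \<in> S"
    have "inverse (norm (f p x)) \<le> inverse (c * w p x)"
      by (rule le_imp_inverse_le[OF c(2)[OF x]]) (use c(1) w[OF x] in simp)
    then show "norm (inverse (f p x)) \<le> inverse c * inverse (w p x)"
      by (simp add: norm_inverse)
  qed
  have wi: "0 \<le> inverse (w p x)" if "x \<in> S" for p x using w[OF that, of p] by simp
  show ?thesis using assms(2)
  proof (induction m)
    case 0
    then show ?case using bd nz by (auto intro!: continuous_intros)
  next
    case (Suc m)
    have IH: "symb m S (\<lambda>p x. inverse (w p x)) (\<lambda>p x. inverse (f p x))"
      using Suc.IH symb_SucD[OF Suc.prems] .
    have "symb m S (\<lambda>p x. inverse (w p x)) (\<lambda>p. eul i (\<lambda>x. inverse (f p x)))" for i
    proof (rule symb_cong[OF assms(1)])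
      have "symb m S (\<lambda>p x. 1 * (w p x * (inverse (w p x) * inverse (w p x))))
         (\<lambda>p x. (-1) * (eul i (f p) x * (inverse (f p x) * inverse (f p x))))"
        using Suc.prems symb_const[of m S "\<lambda>_. -1"]
        by (intro symb_mult[OF assms(1)] IH) (auto simp: w wi less_imp_le)
      then show "symb m S (\<lambda>p x. inverse (w p x))
         (\<lambda>p x. (-1) * (eul i (f p) x * (inverse (f p x) * inverse (f p x))))"
        by (rule symb_mono_weight[where C=1])
          (auto simp: wi less_imp_le w less_imp_neq[OF w, symmetric])
    qed (use Suc.prems in \<open>auto simp: eul_inverse nz\<close>)
    then show ?case using Suc.prems bd nz by (auto simp del: norm_inverse)
  qed
qed


subsection \<open>Integration by parts\<close>

lemma has_derivative_zero_outside:
  fixes F :: "real ^ 'n::finite \<Rightarrow> 'b::real_normed_vector"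
  assumes "closed K" "\<And>x. x \<notin> K \<Longrightarrow> F x = 0" "x \<notin> K"
  shows "(F has_derivative (\<lambda>h. 0)) (at x)"
  by (rule has_derivative_transform_within_open[of "\<lambda>x. 0" _ _ _ "- K"]) (use assms in auto)

lemma pd_zero_outside:
  fixes F :: "real ^ 'n::finite \<Rightarrow> 'b::real_normed_vector"
  assumes "closed K" "\<And>x. x \<notin> K \<Longrightarrow> F x = 0" "x \<notin> K"
  shows "pd i F x = 0"
  using pd_eqI[OF has_derivative_zero_outside[OF assms]] by simp

lemma continuous_on_zero_outside:
  fixes F :: "'a::t2_space \<Rightarrow> 'b::real_normed_vector"
  assumes "closed K" "K \<subseteq> U" "open U" "continuous_on U F" "\<And>x. x \<notin> K \<Longrightarrow> F x = 0"
  shows "continuous_on UNIV F"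
proof -
  have "continuous_on (- K) F"
    using continuous_on_cong[of "- K" "- K" F "\<lambda>x. 0"] assms(5) by simp
  then have "continuous_on (U \<union> - K) F"
    using assms by (intro continuous_on_open_Un) auto
  moreover have "U \<union> - K = UNIV" using assms(2) by auto
  ultimately show ?thesis by simp
qed

lemma integrable_continuous_compact_support:
  fixes F :: "'a::euclidean_space \<Rightarrow> 'b::{banach, second_countable_topology}"
  assumes "compact K" "continuous_on UNIV F" "\<And>x. x \<notin> K \<Longrightarrow> F x = 0"
  shows "integrable lborel F"
proof -
  have "integrable lborel (\<lambda>x. indicator K x *\<^sub>R F x)"
    by (rule borel_integrable_compact[OF assms(1)]) (use assms(2) continuous_on_subset in blast)
  moreover have "(\<lambda>x. indicator K x *\<^sub>R F x) = F"
    using assms(3) by (auto simp: indicator_def)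
  ultimately show ?thesis by simp
qed

lemma integral_translate:
  fixes F :: "'a::euclidean_space \<Rightarrow> 'b::{banach, second_countable_topology}"
  assumes "continuous_on UNIV F"
  shows "(LINT x|lborel. F (a + x)) = (LINT x|lborel. F x)"
proof -
  have "(LINT x|lborel. F x) = (LINT x|distr lborel borel ((+) a). F x)"
    by (simp add: lborel_distr_plus)
  also have "\<dots> = (LINT x|lborel. F (a + x))"
    by (rule integral_distr) (use assms in \<open>auto intro: borel_measurable_continuous_onI\<close>)
  finally show ?thesis by simp
qed

text \<open>The difference quotients in direction \<open>i\<close> have integral zero by translation
  invariance, and they converge to the partial derivative under a common integrable bound. No
  iterated integral is involved.\<close>

lemma integral_pd_zero:
  fixes F :: "real ^ 'n::finite \<Rightarrow> complex"
  assumes K: "compact K" "K \<subseteq> U" "open U" and F0: "\<And>x. x \<notin> K \<Longrightarrow> F x = 0"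
    and dF: "\<And>x. x \<in> U \<Longrightarrow> F differentiable (at x)" and cF: "continuous_on U (pd i F)"
  shows "integrable lborel (pd i F)" "(LINT x|lborel. pd i F x) = 0"
proof -
  have clK: "closed K" using K by (simp add: compact_imp_closed)
  have pd0: "pd i F x = 0" if "x \<notin> K" for x by (rule pd_zero_outside[OF clK F0 that])
  have cpd: "continuous_on UNIV (pd i F)" using continuous_on_zero_outside[OF clK K(2,3) cF pd0] .
  have dF': "F differentiable (at x)" for x
  proof (cases "x \<in> K")
    case False
    have "(F has_derivative (\<lambda>h. 0)) (at x)"
      by (rule has_derivative_zero_outside[OF clK F0 False])
    then show ?thesis by (auto simp: differentiable_def)
  qed (use dF K in auto)
  have cont: "continuous_on UNIV F"
    by (simp add: continuous_on_eq_continuous_at differentiable_imp_continuous_within dF')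
  show "integrable lborel (pd i F)"
    by (rule integrable_continuous_compact_support[OF K(1) cpd pd0])
  have intF: "integrable lborel F"
    by (rule integrable_continuous_compact_support[OF K(1) cont F0])
  let ?e = "axis i 1 :: real ^ 'n"
  define h where "h n = 1 / real (Suc n)" for n
  have h: "0 < h n" "h n \<le> 1" for n by (auto simp: h_def)
  define s where "s n x = (F (h n *\<^sub>R ?e + x) - F x) /\<^sub>R h n" for n x
  have cs: "continuous_on UNIV (s n)" for n
  proof -
    have "continuous_on UNIV (\<lambda>x. F (h n *\<^sub>R ?e + x))"
      by (rule continuous_on_compose2[OF cont]) (auto intro!: continuous_intros)
    then show ?thesis
      unfolding s_def by (intro continuous_on_scaleR continuous_on_const continuous_on_diff cont)
  qed
  obtain B where B: "\<And>x. norm (pd i F x) \<le> B"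
  proof -
    have "bounded (pd i F ` K)"
      by (intro compact_imp_bounded compact_continuous_image K(1) continuous_on_subset[OF cpd]) auto
    then obtain B where "\<And>x. x \<in> K \<Longrightarrow> norm (pd i F x) \<le> B" by (auto simp: bounded_iff)
    then have "norm (pd i F x) \<le> max B 0" for x
      using pd0[of x] by (cases "x \<in> K") (auto simp: max.coboundedI1)
    then show thesis using that by blast
  qed
  define g where "g x t = F (t *\<^sub>R ?e + x)" for x t
  have g': "(g x has_vector_derivative pd i F (t *\<^sub>R ?e + x)) (at t)" for x t
  proof -
    have "((\<lambda>t. t *\<^sub>R ?e + x) has_derivative (\<lambda>t. t *\<^sub>R ?e)) (at t)"
      by (auto intro!: derivative_eq_intros)
    moreover have "(F has_derivative frechet_derivative F (at (t *\<^sub>R ?e + x))) (at (t *\<^sub>R ?e + x))"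
      using dF' by (simp add: frechet_derivative_works[symmetric])
    ultimately have "(g x has_derivative (\<lambda>t'. frechet_derivative F (at (t *\<^sub>R ?e + x)) (t' *\<^sub>R ?e))) (at t)"
      unfolding g_def by (rule has_derivative_compose)
    moreover have "linear (frechet_derivative F (at (t *\<^sub>R ?e + x)))"
      using dF' by (rule linear_frechet_derivative)
    ultimately show ?thesis
      by (simp add: has_vector_derivative_def pd_def linear_cmul)
  qed
  \<comment> \<open>Mean value inequality along the segment from \<open>x\<close> to
    \<open>x + h n e_i\<close>.\<close>
  have sB: "norm (s n x) \<le> B" for n x
  proof -
    have "norm (g x (h n) - g x 0) \<le> B * norm (h n - 0)"
    proof (rule differentiable_bound[of UNIV _ "\<lambda>t h. h *\<^sub>R pd i F (t *\<^sub>R ?e + x)"])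
      show "onorm (\<lambda>h. h *\<^sub>R pd i F (t *\<^sub>R ?e + x)) \<le> B" for t
      proof (rule onorm_le)
        show "norm (h *\<^sub>R pd i F (t *\<^sub>R ?e + x)) \<le> B * norm h" for h
          using mult_right_mono[OF B[of "t *\<^sub>R ?e + x"], of "norm h"] by (simp add: mult.commute)
      qed
    qed (use g' in \<open>auto simp: has_vector_derivative_def\<close>)
    moreover have "norm (s n x) = norm (g x (h n) - g x 0) / h n"
      using h(1)[of n] by (simp add: s_def g_def divide_inverse mult.commute)
    ultimately show ?thesis using h(1)[of n] by (simp add: pos_divide_le_eq)
  qed
  have slim: "(\<lambda>n. s n x) \<longlonglongrightarrow> pd i F x" for x
  proof -
    have "((\<lambda>t. (1 / norm (t - 0)) *\<^sub>R (g x t - (g x 0 + (t - 0) *\<^sub>R pd i F x))) \<longlongrightarrow> 0) (at 0)"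
      using g'[of x 0] unfolding has_vector_derivative_def has_derivative_at2 by simp
    moreover have "filterlim h (at 0) sequentially"
      unfolding h_def filterlim_at using LIMSEQ_inverse_real_of_nat
      by (auto simp: inverse_eq_divide)
    ultimately have "(\<lambda>n. (1 / norm (h n - 0)) *\<^sub>R (g x (h n) - (g x 0 + (h n - 0) *\<^sub>R pd i F x)))
        \<longlonglongrightarrow> 0"
      by (rule filterlim_compose)
    moreover have "(1 / norm (h n - 0)) *\<^sub>R (g x (h n) - (g x 0 + (h n - 0) *\<^sub>R pd i F x))
        = s n x - pd i F x" for n
      using h(1)[of n] by (simp add: s_def g_def algebra_simps inverse_eq_divide)
    ultimately have "(\<lambda>n. s n x - pd i F x) \<longlonglongrightarrow> 0" by simp
    then show ?thesis by (simp add: LIM_zero_iff)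
  qed
  obtain R where R: "\<And>x. x \<in> K \<Longrightarrow> norm x \<le> R" using compact_imp_bounded[OF K(1)] by (auto simp: bounded_iff)
  \<comment> \<open>The quotient at \<open>x\<close> also sees the point \<open>h n e_i + x\<close>,
    at distance at most 1; hence the radius \<open>R + 1\<close>.\<close>
  have s0: "s n x = 0" if "x \<notin> cball 0 (R + 1)" for n x
  proof -
    have "x \<notin> K" using R[of x] that by auto
    moreover have "h n *\<^sub>R ?e + x \<notin> K"
    proof
      assume "h n *\<^sub>R ?e + x \<in> K"
      then have "norm (h n *\<^sub>R ?e + x) \<le> R" using R by blast
      moreover have "norm x \<le> norm (h n *\<^sub>R ?e + x) + norm (h n *\<^sub>R ?e)"
        using norm_triangle_ineq4[of "h n *\<^sub>R ?e + x" "h n *\<^sub>R ?e"] by simp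
      moreover have "norm (h n *\<^sub>R ?e) \<le> 1" using h[of n] by simp
      ultimately show False using that by simp
    qed
    ultimately show ?thesis by (simp add: s_def F0)
  qed
  have "(\<lambda>n. LINT x|lborel. s n x) \<longlonglongrightarrow> (LINT x|lborel. pd i F x)"
  proof (rule integral_dominated_convergence[where w="\<lambda>x. indicator (cball 0 (R + 1)) x *\<^sub>R B"])
    show "integrable lborel (\<lambda>x. indicator (cball (0::real^'n) (R + 1)) x *\<^sub>R B)"
      by (rule borel_integrable_compact) auto
    show "AE x in lborel. norm (s n x) \<le> indicator (cball 0 (R + 1)) x *\<^sub>R B" for n
      using sB s0 by (auto simp: indicator_def) 
  qed (use slim cs cpd in \<open>auto intro: borel_measurable_continuous_onI\<close>)
  moreover have "(LINT x|lborel. s n x) = 0" for n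
  proof -
    have "integrable lborel (\<lambda>x. F (h n *\<^sub>R ?e + x))"
    proof (rule integrable_continuous_compact_support[of "(\<lambda>x. - (h n *\<^sub>R ?e) + x) ` K"])
      show "compact ((\<lambda>x. - (h n *\<^sub>R ?e) + x) ` K)" using K(1) compact_translation by blast
      show "continuous_on UNIV (\<lambda>x. F (h n *\<^sub>R ?e + x))"
        by (rule continuous_on_compose2[OF cont]) (auto intro: continuous_intros)
      fix x assume "x \<notin> (\<lambda>x. - (h n *\<^sub>R ?e) + x) ` K"
      moreover have "x = - (h n *\<^sub>R ?e) + (h n *\<^sub>R ?e + x)" by simp
      ultimately have "h n *\<^sub>R ?e + x \<notin> K" by (metis image_eqI)
      then show "F (h n *\<^sub>R ?e + x) = 0" using F0 by blast
    qed
    then show ?thesis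
      unfolding s_def using intF by (simp add: integral_translate[OF cont])
  qed
  ultimately show "(LINT x|lborel. pd i F x) = 0" by (simp add: LIMSEQ_const_iff)
qed

text \<open>
  For \<open>X = \<Sum>\<^sub>i (x\<^sub>i\<partial>\<^sub>i\<Phi>) x\<^sub>i\<partial>\<^sub>i\<close> one has \<open>(1 - \<i>\<lambda>X) e\<^bsup>\<i>\<lambda>\<Phi>\<^esup> = A e\<^bsup>\<i>\<lambda>\<Phi>\<^esup>\<close>, where \<open>A = 1 + \<lambda>\<^sup>2 \<Sum>\<^sub>i (x\<^sub>i\<partial>\<^sub>i\<Phi>)\<^sup>2\<close> is the
  density; \<open>ibp_op\<close> is the transpose of \<open>1 - \<i>\<lambda>X\<close> applied to \<open>f / A\<close>.  Since \<open>A \<ge> 1\<close>, no cutoff near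
  the zeros of the gradient is needed.
\<close>

definition ibp_density :: "(real ^ 'n::finite \<Rightarrow> complex) \<Rightarrow> real \<Rightarrow> real ^ 'n \<Rightarrow> complex" where
  "ibp_density \<Phi> l x = 1 + (complex_of_real l)\<^sup>2 * (\<Sum>i\<in>UNIV. eul i \<Phi> x * eul i \<Phi> x)"

definition ibp_field :: "(real ^ 'n::finite \<Rightarrow> complex) \<Rightarrow> (real \<Rightarrow> real ^ 'n \<Rightarrow> complex)
    \<Rightarrow> 'n \<Rightarrow> real \<Rightarrow> real ^ 'n \<Rightarrow> complex" where
  "ibp_field \<Phi> f i l x = eul i \<Phi> x * (f l x * inverse (ibp_density \<Phi> l x))"

definition ibp_op :: "(real ^ 'n::finite \<Rightarrow> complex) \<Rightarrow> (real \<Rightarrow> real ^ 'n \<Rightarrow> complex)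
    \<Rightarrow> real \<Rightarrow> real ^ 'n \<Rightarrow> complex" where
  "ibp_op \<Phi> f l x = f l x * inverse (ibp_density \<Phi> l x)
     + (\<Sum>i\<in>UNIV. \<i> * complex_of_real l * (ibp_field \<Phi> f i l x + eul i (ibp_field \<Phi> f i l) x))"

lemma differentiable_complex_of_real:
  assumes "f differentiable (at x within S)"
  shows "(\<lambda>x. complex_of_real (f x)) differentiable (at x within S)"
proof -
  obtain D where d: "(f has_derivative D) (at x within S)"
    using assms unfolding differentiable_def by blast
  have "((\<lambda>x. complex_of_real (f x)) has_derivative (\<lambda>h. complex_of_real (D h))) (at x within S)"
    by (rule has_derivative_of_real[OF d])
  then show ?thesis unfolding differentiable_def by (rule exI[of _ "\<lambda>h. complex_of_real (D h)"])
qed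

lemma eul_of_real:
  assumes "\<phi> differentiable (at x)"
  shows "eul i (\<lambda>x. complex_of_real (\<phi> x)) x = complex_of_real (eul i \<phi> x)"
proof -
  obtain f' where d: "(\<phi> has_derivative f') (at x)"
    using assms unfolding differentiable_def by blast
  show ?thesis
    unfolding eul_def pd_eqI[OF d] pd_eqI[OF has_derivative_of_real[OF d]]
    by (simp add: scaleR_conv_of_real)
qed

text \<open>As \<phi> is real, the sum of squares in the density is nonnegative and nothing can
  cancel the 1, so the density is comparable with \<open>(1 + |l| w)^2\<close> from both
  sides.\<close>

lemma symb_ibp_density:
  fixes \<phi> :: "real ^ 'n::finite \<Rightarrow> real"
  assumes S: "open S" and \<Phi>: "symb (Suc m) S (\<lambda>l::real. w) (\<lambda>l x. complex_of_real (\<phi> x))"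
    and w: "\<And>x. x \<in> S \<Longrightarrow> 0 \<le> w x"
    and c: "c > 0" "\<And>x. x \<in> S \<Longrightarrow> c * (w x)\<^sup>2 \<le> (\<Sum>i\<in>UNIV. (eul i \<phi> x)\<^sup>2)"
  shows "symb m S (\<lambda>l x. inverse ((1 + \<bar>l\<bar> * w x)\<^sup>2))
      (\<lambda>l x. inverse (ibp_density (\<lambda>x. complex_of_real (\<phi> x)) l x))"
    and "\<And>x l. x \<in> S \<Longrightarrow> ibp_density (\<lambda>x. complex_of_real (\<phi> x)) l x \<noteq> 0"
proof -
  let ?\<Phi> = "\<lambda>x. complex_of_real (\<phi> x)"
  have \<Phi>': "symb m S (\<lambda>l::real. w) (\<lambda>l. eul i ?\<Phi>)" for i using \<Phi> by simp
  have sq: "1 + (\<bar>l\<bar> * w x)\<^sup>2 \<le> (1 + \<bar>l\<bar> * w x)\<^sup>2" "(1 + \<bar>l\<bar> * w x)\<^sup>2 \<le> 2 * (1 + (\<bar>l\<bar> * w x)\<^sup>2)"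
    if "x \<in> S" for l x
    using w[OF that] sum_squares_bound[of 1 "\<bar>l\<bar> * w x"] by (auto simp: power2_sum)
  have dphi: "\<phi> differentiable (at x)" if x: "x \<in> S" for x
  proof -
    obtain D where "(?\<Phi> has_derivative D) (at x)"
      using \<Phi> x by (auto simp: differentiable_def)
    from has_derivative_Re[OF this] show ?thesis by (auto simp: differentiable_def)
  qed
  define G where "G x = (\<Sum>i\<in>UNIV. (eul i \<phi> x)\<^sup>2)" for x
  have dens: "ibp_density ?\<Phi> l x = complex_of_real (1 + l\<^sup>2 * G x)" if x: "x \<in> S" for l x
    using dphi[OF x] by (simp add: ibp_density_def G_def eul_of_real power2_eq_square)
  \<comment> \<open>From \<open>(1 + a)^2 \<le> 2 (1 + a^2)\<close> with \<open>a = |l| w\<close>;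
    the constant \<open>m\<close> has to satisfy \<open>2 m \<le> 1\<close> and
    \<open>2 m \<le> c\<close>.\<close>
  have low: "min (1/2) (c/2) * (1 + \<bar>l\<bar> * w x)\<^sup>2 \<le> norm (ibp_density ?\<Phi> l x)" if x: "x \<in> S" for l x
  proof -
    let ?m = "min (1/2) (c/2)"
    have "?m * (1 + \<bar>l\<bar> * w x)\<^sup>2 \<le> ?m * (2 * (1 + (\<bar>l\<bar> * w x)\<^sup>2))"
      by (rule mult_left_mono[OF sq(2)[OF x]]) (use c in auto)
    also have "\<dots> = 2 * ?m * 1 + l\<^sup>2 * (2 * ?m * (w x)\<^sup>2)" by (simp add: algebra_simps power_mult_distrib)
    also have "\<dots> \<le> 1 + l\<^sup>2 * G x"
    proof (intro add_mono mult_left_mono)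
      have "2 * ?m * (w x)\<^sup>2 \<le> c * (w x)\<^sup>2" by (rule mult_right_mono) auto
      then show "2 * ?m * (w x)\<^sup>2 \<le> G x" using c(2)[OF x] by (simp add: G_def)
    qed auto
    also have "\<dots> \<le> norm (ibp_density ?\<Phi> l x)"
      unfolding dens[OF x] norm_of_real by simp
    finally show ?thesis .
  qed
  have "symb m S (\<lambda>l x. (1 + \<bar>l\<bar> * w x)\<^sup>2) (\<lambda>l. ibp_density ?\<Phi> l)"
    unfolding ibp_density_def
  proof (rule symb_add[OF S])
    have "symb m S (\<lambda>(l::real) x. 1 :: real) (\<lambda>l x. 1 :: complex)"
      using symb_const[of m S "\<lambda>_::real. 1::complex"] by simp
    then show "symb m S (\<lambda>l x. (1 + \<bar>l\<bar> * w x)\<^sup>2) (\<lambda>l x. 1 :: complex)"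
      by (rule symb_mono_weight[where C=1]) (use w in auto)
    have "symb m S (\<lambda>l x. norm ((complex_of_real l)\<^sup>2) * (w x * w x))
        (\<lambda>l x. (complex_of_real l)\<^sup>2 * (\<Sum>i\<in>UNIV. eul i ?\<Phi> x * eul i ?\<Phi> x))"
      using \<Phi>' w by (intro symb_mult[OF S] symb_sum[OF S] symb_const) auto
    then show "symb m S (\<lambda>l x. (1 + \<bar>l\<bar> * w x)\<^sup>2)
        (\<lambda>l x. (complex_of_real l)\<^sup>2 * (\<Sum>i\<in>UNIV. eul i ?\<Phi> x * eul i ?\<Phi> x))"
    proof (rule symb_mono_weight[where C=1])
      show "norm ((complex_of_real l)\<^sup>2) * (w x * w x) \<le> 1 * (1 + \<bar>l\<bar> * w x)\<^sup>2" if "x \<in> S" for l x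
        using sq(1)[OF that, of l] by (simp add: norm_power norm_mult power_mult_distrib flip: power2_eq_square)
    qed (use w in auto)
  qed
  then show "symb m S (\<lambda>l x. inverse ((1 + \<bar>l\<bar> * w x)\<^sup>2)) (\<lambda>l x. inverse (ibp_density ?\<Phi> l x))"
  proof (rule symb_inverse[OF S _ _ _ low])
    show "0 < (1 + \<bar>l\<bar> * w x)\<^sup>2" if "x \<in> S" for l x
      by (rule zero_less_power) (use w[OF that] in \<open>simp add: add_pos_nonneg\<close>)
  qed (use c in auto)
  show "ibp_density ?\<Phi> l x \<noteq> 0" if "x \<in> S" for l x
  proof -
    have "0 < min (1/2) (c/2) * (1 + \<bar>l\<bar> * w x)\<^sup>2"
      by (intro mult_pos_pos zero_less_power) (use w[OF that] c in \<open>auto simp: add_pos_nonneg\<close>)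
    then show ?thesis using low[OF that, of l] by auto
  qed
qed

text \<open>The operator costs a factor \<open>|l| w\<close>, which is absorbed by one of the two
  factors of \<open>(1 + |l| w)^-2\<close> coming from the density. The net gain is one factor of
  decay, at the price of one Euler derivative of \<open>f\<close>.\<close>

lemma symb_ibp:
  fixes \<phi> :: "real ^ 'n::finite \<Rightarrow> real" and W :: "real \<Rightarrow> real ^ 'n \<Rightarrow> real"
  assumes S: "open S" and \<Phi>: "symb (Suc (Suc m)) S (\<lambda>l::real. w) (\<lambda>l x. complex_of_real (\<phi> x))"
    and w: "\<And>x. x \<in> S \<Longrightarrow> 0 \<le> w x" and W: "\<And>l x. x \<in> S \<Longrightarrow> 0 \<le> W l x"
    and c: "c > 0" "\<And>x. x \<in> S \<Longrightarrow> c * (w x)\<^sup>2 \<le> (\<Sum>i\<in>UNIV. (eul i \<phi> x)\<^sup>2)"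
    and f: "symb (Suc m) S W f"
  shows "symb (Suc m) S (\<lambda>l x. w x * (W l x * inverse ((1 + \<bar>l\<bar> * w x)\<^sup>2)))
           (ibp_field (\<lambda>x. complex_of_real (\<phi> x)) f i)"
    and "symb m S (\<lambda>l x. W l x * inverse (1 + \<bar>l\<bar> * w x)) (ibp_op (\<lambda>x. complex_of_real (\<phi> x)) f)"
proof -
  let ?\<Phi> = "\<lambda>x. complex_of_real (\<phi> x)"
  let ?W = "\<lambda>l x. W l x * inverse (1 + \<bar>l\<bar> * w x)"
  let ?V = "\<lambda>l x. w x * (W l x * inverse ((1 + \<bar>l\<bar> * w x)\<^sup>2))"
  have inv: "symb (Suc m) S (\<lambda>l x. inverse ((1 + \<bar>l\<bar> * w x)\<^sup>2)) (\<lambda>l x. inverse (ibp_density ?\<Phi> l x))"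
    using symb_ibp_density(1)[OF S \<Phi> w c] by simp
  have fi: "symb (Suc m) S (\<lambda>l x. W l x * inverse ((1 + \<bar>l\<bar> * w x)\<^sup>2))
      (\<lambda>l x. f l x * inverse (ibp_density ?\<Phi> l x))"
    using W by (intro symb_mult[OF S f inv]) auto
  have \<Phi>': "symb (Suc m) S (\<lambda>l::real. w) (\<lambda>l. eul i ?\<Phi>)" for i using \<Phi> by simp
  have fld: "symb (Suc m) S ?V (ibp_field ?\<Phi> f i)" for i
    unfolding ibp_field_def using w W by (intro symb_mult[OF S \<Phi>' fi]) auto
  then show "symb (Suc m) S ?V (ibp_field ?\<Phi> f i)" .
  have pos: "0 < 1 + \<bar>l\<bar> * w x" if "x \<in> S" for l x
    using w[OF that] by (simp add: add_pos_nonneg)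
  have inv_le: "inverse ((1 + \<bar>l\<bar> * w x)\<^sup>2) \<le> inverse (1 + \<bar>l\<bar> * w x)" if "x \<in> S" for l x
    using w[OF that] by (intro le_imp_inverse_le pos that self_le_power) auto
  have t1: "symb m S ?W (\<lambda>l x. f l x * inverse (ibp_density ?\<Phi> l x))"
    by (rule symb_mono_weight[OF symb_SucD[OF fi], where C=1])
      (use W inv_le in \<open>auto intro!: mult_left_mono\<close>)
  have t2: "symb m S ?W (\<lambda>l x. (\<i> * complex_of_real l) *
       (ibp_field ?\<Phi> f i l x + eul i (ibp_field ?\<Phi> f i l) x))" for i
  proof -
    have "symb m S ?V (\<lambda>l x. ibp_field ?\<Phi> f i l x + eul i (ibp_field ?\<Phi> f i l) x)"
      using fld symb_SucD[OF fld] by (intro symb_add[OF S]) auto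
    then have "symb m S (\<lambda>l x. norm (\<i> * complex_of_real l) * ?V l x)
      (\<lambda>l x. (\<i> * complex_of_real l) * (ibp_field ?\<Phi> f i l x + eul i (ibp_field ?\<Phi> f i l) x))"
      using w W by (intro symb_mult[OF S symb_const]) auto
    then show ?thesis
    proof (rule symb_mono_weight[where C=1])
      fix l x assume x: "x \<in> S"
      have "\<bar>l\<bar> * w x * inverse (1 + \<bar>l\<bar> * w x) \<le> 1"
        using pos[OF x, of l] by (simp add: field_simps)
      then have "W l x * inverse (1 + \<bar>l\<bar> * w x) * (\<bar>l\<bar> * w x * inverse (1 + \<bar>l\<bar> * w x))
        \<le> W l x * inverse (1 + \<bar>l\<bar> * w x) * 1"
        using W[OF x, of l] pos[OF x, of l] by (intro mult_left_mono) auto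
      then show "norm (\<i> * complex_of_real l) * ?V l x \<le> 1 * ?W l x"
        by (simp add: norm_mult power2_eq_square mult_ac)
    qed (use w W in auto)
  qed
  show "symb m S ?W (ibp_op ?\<Phi> f)"
    unfolding ibp_op_def using t1 t2 by (intro symb_add[OF S] symb_sum[OF S]) (auto simp: mult_ac)
qed

lemma ibp_op_zero:
  assumes "closed K" "\<And>x. x \<notin> K \<Longrightarrow> f l x = 0" "x \<notin> K"
  shows "ibp_op \<Phi> f l x = 0"
  using pd_zero_outside[of K "ibp_field \<Phi> f i l" x i for i] assms
  by (simp add: ibp_op_def ibp_field_def eul_def)

text \<open>The two integrands differ by a sum of partial derivatives of the compactly supported
  \<open>F i\<close>, which integrate to zero. The undifferentiated field in \<open>ibp_op\<close>
  comes from differentiating the factor \<open>x_i\<close> of the Euler field.\<close>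

lemma ibp_integral:
  fixes \<phi> :: "real ^ 'n::finite \<Rightarrow> real" and W :: "real \<Rightarrow> real ^ 'n \<Rightarrow> real"
  assumes S: "open S" and K: "compact K" "K \<subseteq> S"
    and \<Phi>: "symb (Suc (Suc m)) S (\<lambda>l::real. w) (\<lambda>l x. complex_of_real (\<phi> x))"
    and w: "\<And>x. x \<in> S \<Longrightarrow> 0 \<le> w x" and W: "\<And>l x. x \<in> S \<Longrightarrow> 0 \<le> W l x"
    and c: "c > 0" "\<And>x. x \<in> S \<Longrightarrow> c * (w x)\<^sup>2 \<le> (\<Sum>i\<in>UNIV. (eul i \<phi> x)\<^sup>2)"
    and f: "symb (Suc m) S W f" and f0: "\<And>l x. x \<notin> K \<Longrightarrow> f l x = 0"
  shows "(LINT x|lborel. exp (\<i> * complex_of_real (l * \<phi> x)) * f l x)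
       = (LINT x|lborel. exp (\<i> * complex_of_real (l * \<phi> x)) * ibp_op (\<lambda>x. complex_of_real (\<phi> x)) f l x)"
proof -
  let ?\<Phi> = "\<lambda>x. complex_of_real (\<phi> x)"
  let ?h = "\<lambda>i. ibp_field ?\<Phi> f i l"
  define E where "E x = exp (\<i> * complex_of_real (l * \<phi> x))" for x
  define F where "F i x = complex_of_real (x $ i) * (?h i x * E x)" for i x
  have clK: "closed K" using K by (simp add: compact_imp_closed)
  have h: "?h i differentiable (at x)" if "x \<in> S" for i x
    using symb_ibp(1)[OF S \<Phi> w W c f] that by simp
  have hc: "continuous_on S (?h i)" "continuous_on S (eul i (?h i))" for i
    using symb_cont[OF symb_ibp(1)[OF S \<Phi> w W c f]] symb_cont[of m S _ "\<lambda>l. eul i (ibp_field ?\<Phi> f i l)" l]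
      symb_ibp(1)[OF S \<Phi> w W c f, of i] unfolding symb.simps by blast+
  have \<Phi>c: "continuous_on S ?\<Phi>" "continuous_on S (eul i ?\<Phi>)" for i
    using symb_cont[OF \<Phi>] symb_cont[of "Suc m" S "\<lambda>l. w" "\<lambda>l. eul i ?\<Phi>"] \<Phi> by auto
  have E': "E differentiable (at x)" "eul i E x = \<i> * complex_of_real l * eul i ?\<Phi> x * E x"
    if x: "x \<in> S" for i x
  proof -
    obtain f' where d: "(?\<Phi> has_derivative f') (at x)"
      using \<Phi> x by (auto simp: differentiable_def)
    have d2: "(E has_derivative (\<lambda>h. \<i> * complex_of_real l * f' h * E x)) (at x)"
    proof -
      have "(exp has_derivative (*) (exp y)) (at y)" for y :: complex
        using DERIV_exp[of y] by (simp add: has_field_derivative_def)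
      from has_derivative_compose[OF has_derivative_mult_right[OF d] this, of "\<i> * complex_of_real l"]
      show ?thesis unfolding E_def[abs_def] by (simp add: mult_ac)
    qed
    show "E differentiable (at x)" using d2 differentiable_def by blast
    show "eul i E x = \<i> * complex_of_real l * eul i ?\<Phi> x * E x"
      unfolding eul_def pd_eqI[OF d] pd_eqI[OF d2] by simp
  qed
  have Ec: "continuous_on S E"
    using E'(1) by (simp add: differentiable_imp_continuous_within continuous_at_imp_continuous_on)
  have F': "F i differentiable (at x)"
      "pd i (F i) x = ?h i x * E x + eul i (?h i) x * E x + ?h i x * (\<i> * complex_of_real l * eul i ?\<Phi> x * E x)"
    if x: "x \<in> S" for i x
  proof -
    have dhE: "(\<lambda>x. ?h i x * E x) differentiable (at x)"
      using h[OF x] E'(1)[OF x] by (rule differentiable_mult)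
    then obtain g' where d: "((\<lambda>x. ?h i x * E x) has_derivative g') (at x)"
      by (auto simp: differentiable_def)
    have dF: "(F i has_derivative (\<lambda>k. complex_of_real (x $ i) * g' k + complex_of_real (k $ i) * (?h i x * E x))) (at x)"
      unfolding F_def
      by (rule has_derivative_mult[OF _ d])
        (intro has_derivative_of_real bounded_linear_imp_has_derivative bounded_linear_vec_nth)
    show "F i differentiable (at x)" using dF differentiable_def by blast
    have "pd i (F i) x = eul i (\<lambda>x. ?h i x * E x) x + ?h i x * E x"
      unfolding pd_eqI[OF dF] eul_def pd_eqI[OF d] by (simp add: scaleR_conv_of_real)
    then show "pd i (F i) x = ?h i x * E x + eul i (?h i) x * E x + ?h i x * (\<i> * complex_of_real l * eul i ?\<Phi> x * E x)"
      unfolding eul_mult[OF h[OF x] E'(1)[OF x]] E'(2)[OF x] by simp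
  qed
  have h0: "?h i x = 0" if "x \<notin> K" for i x using f0[OF that] by (simp add: ibp_field_def)
  have F0: "F i x = 0" if "x \<notin> K" for i x using h0[OF that] by (simp add: F_def)
  have cF: "continuous_on S (pd i (F i))" for i
    by (subst continuous_on_cong[OF refl F'(2)]) (auto intro!: continuous_intros hc Ec \<Phi>c)
  note Fint = integral_pd_zero[OF K S F0 F'(1) cF]
  have Lc: "continuous_on S (ibp_op ?\<Phi> f l)"
    by (rule symb_cont[OF symb_ibp(2)[OF S \<Phi> w W c f]])
  have L0: "ibp_op ?\<Phi> f l x = 0" if "x \<notin> K" for x
    by (rule ibp_op_zero[OF clK _ that]) (rule f0)
  have iL: "integrable lborel (\<lambda>x. E x * ibp_op ?\<Phi> f l x)"
  proof (rule integrable_continuous_compact_support[OF K(1)])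
    show "continuous_on UNIV (\<lambda>x. E x * ibp_op ?\<Phi> f l x)"
      by (rule continuous_on_zero_outside[OF clK K(2) S])
        (auto intro!: continuous_intros Ec Lc simp: L0)
  qed (simp add: L0)
  have "E x * f l x = E x * ibp_op ?\<Phi> f l x - (\<Sum>i\<in>UNIV. \<i> * complex_of_real l * pd i (F i) x)" for x
  proof (cases "x \<in> S")
    case True
    let ?A = "ibp_density ?\<Phi> l x"
    have nz: "?A \<noteq> 0"
      using symb_ibp_density(2)[OF S \<Phi> w c True] .
    \<comment> \<open>The terms in which the exponential is differentiated add up to
      \<open>-(A - 1)/A\<close> times the integrand; together with the summand \<open>f/A\<close> of
      \<open>ibp_op\<close> they restore \<open>f\<close>.\<close>
    have "(\<Sum>i\<in>UNIV. \<i> * complex_of_real l * pd i (F i) x)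
       = E x * (\<Sum>i\<in>UNIV. \<i> * complex_of_real l * (?h i x + eul i (?h i) x))
         - E x * f l x * inverse ?A * ((complex_of_real l)\<^sup>2 * (\<Sum>i\<in>UNIV. eul i ?\<Phi> x * eul i ?\<Phi> x))"
      unfolding sum_distrib_left sum_subtractf[symmetric]
      by (rule sum.cong[OF refl]) (simp add: F'(2)[OF True] ibp_field_def algebra_simps power2_eq_square)
    moreover have "(complex_of_real l)\<^sup>2 * (\<Sum>i\<in>UNIV. eul i ?\<Phi> x * eul i ?\<Phi> x) = ?A - 1"
      by (simp add: ibp_density_def)
    ultimately show ?thesis using nz by (simp add: ibp_op_def algebra_simps)
  next
    case False
    then have "x \<notin> K" using K by blast
    moreover have "pd i (F i) x = 0" for i by (rule pd_zero_outside[OF clK F0 \<open>x \<notin> K\<close>])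
    ultimately show ?thesis using f0 L0 by simp
  qed
  then have "(LINT x|lborel. E x * f l x)
     = (LINT x|lborel. E x * ibp_op ?\<Phi> f l x - (\<Sum>i\<in>UNIV. \<i> * complex_of_real l * pd i (F i) x))"
    by simp
  also have "\<dots> = (LINT x|lborel. E x * ibp_op ?\<Phi> f l x)"
    using iL Fint by simp
  finally show ?thesis by (simp add: E_def)
qed

text \<open>The bound is a nonnegative integral, which makes sense before the weight is known to be
  integrable on \<open>S\<close>.\<close>

lemma ibp_iterate:
  fixes \<phi> :: "real ^ 'n::finite \<Rightarrow> real" and W :: "real \<Rightarrow> real ^ 'n \<Rightarrow> real"
  assumes S: "open S" and K: "compact K" "K \<subseteq> S"
    and w: "\<And>x. x \<in> S \<Longrightarrow> 0 \<le> w x"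
    and c: "c > 0" "\<And>x. x \<in> S \<Longrightarrow> c * (w x)\<^sup>2 \<le> (\<Sum>i\<in>UNIV. (eul i \<phi> x)\<^sup>2)"
    and \<Phi>: "symb (Suc m) S (\<lambda>l::real. w) (\<lambda>l x. complex_of_real (\<phi> x))"
    and W: "\<And>l x. x \<in> S \<Longrightarrow> 0 \<le> W l x"
    and f: "symb m S W f" and f0: "\<And>l x. x \<notin> K \<Longrightarrow> f l x = 0"
  shows "\<exists>C\<ge>0. \<forall>l. ennreal (cmod (LINT x|lborel. exp (\<i> * complex_of_real (l * \<phi> x)) * f l x))
     \<le> (\<integral>\<^sup>+x\<in>S. ennreal (C * (W l x * inverse (1 + \<bar>l\<bar> * w x) ^ m)) \<partial>lborel)"
  using \<Phi> W f f0
proof (induction m arbitrary: W f)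
  case (0 W f)
  obtain C where C: "C \<ge> 0" "\<And>l x. x \<in> S \<Longrightarrow> norm (f l x) \<le> C * W l x"
    using symb_bound_nonneg[OF 0(3,2)] by blast
  have "ennreal (cmod (LINT x|lborel. exp (\<i> * complex_of_real (l * \<phi> x)) * f l x))
     \<le> (\<integral>\<^sup>+x\<in>S. ennreal (C * W l x) \<partial>lborel)" for l
  proof -
    let ?g = "\<lambda>x. exp (\<i> * complex_of_real (l * \<phi> x)) * f l x"
    \<comment> \<open>For a non-integrable \<open>?g\<close> the left-hand side is 0 by
      convention.\<close>
    have "ennreal (cmod (LINT x|lborel. ?g x)) \<le> (\<integral>\<^sup>+x. ennreal (cmod (?g x)) \<partial>lborel)"
      by (cases "integrable lborel ?g") (auto simp: integral_norm_bound_ennreal not_integrable_integral_eq)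
    also have "\<dots> \<le> (\<integral>\<^sup>+x\<in>S. ennreal (C * W l x) \<partial>lborel)"
    proof (rule nn_integral_mono)
      fix x
      show "ennreal (cmod (?g x)) \<le> ennreal (C * W l x) * indicator S x"
        using C(2)[of x l] 0(4)[of x l] K(2)
        by (cases "x \<in> S") (auto simp: norm_mult norm_exp_eq_Re ennreal_leI)
    qed
    finally show ?thesis .
  qed
  then show ?case using C(1) by auto
next
  case (Suc m W f)
  let ?\<Phi> = "\<lambda>x. complex_of_real (\<phi> x)"
  let ?W = "\<lambda>l x. W l x * inverse (1 + \<bar>l\<bar> * w x)"
  have "\<exists>C\<ge>0. \<forall>l. ennreal (cmod (LINT x|lborel. exp (\<i> * complex_of_real (l * \<phi> x)) * ibp_op ?\<Phi> f l x))
     \<le> (\<integral>\<^sup>+x\<in>S. ennreal (C * (?W l x * inverse (1 + \<bar>l\<bar> * w x) ^ m)) \<partial>lborel)"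
  proof (rule Suc.IH)
    show "symb (Suc m) S (\<lambda>l::real. w) (\<lambda>l x. ?\<Phi> x)" by (rule symb_SucD[OF Suc.prems(1)])
    show "symb m S ?W (ibp_op ?\<Phi> f)"
      by (rule symb_ibp(2)[OF S Suc.prems(1) w Suc.prems(2) c Suc.prems(3)])
    show "ibp_op ?\<Phi> f l x = 0" if "x \<notin> K" for l x
      by (rule ibp_op_zero[OF compact_imp_closed[OF K(1)] _ that]) (rule Suc.prems(4))
  qed (use Suc.prems(2) w in auto)
  moreover have "(LINT x|lborel. exp (\<i> * complex_of_real (l * \<phi> x)) * f l x)
       = (LINT x|lborel. exp (\<i> * complex_of_real (l * \<phi> x)) * ibp_op ?\<Phi> f l x)" for l
    by (rule ibp_integral[OF S K Suc.prems(1) w Suc.prems(2) c Suc.prems(3,4)])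
  ultimately show ?case by (simp add: mult.assoc)
qed


subsection \<open>Power series\<close>

definition psum :: "(nat ^ 'n::finite \<Rightarrow> real) \<Rightarrow> real ^ 'n \<Rightarrow> real" where
  "psum c x = infsum (\<lambda>\<alpha>. c \<alpha> * mpow x \<alpha>) UNIV"

definition vsize :: "nat ^ 'n::finite \<Rightarrow> nat" where
  "vsize \<alpha> = (\<Sum>i\<in>UNIV. \<alpha> $ i)"

text \<open>Absolute convergence on the open polydisc of radius \<open>R\<close>, tested on its
  positive diagonal. It involves only the absolute values of the coefficients and so passes to every
  coefficientwise smaller family.\<close>

definition ps_conv :: "real \<Rightarrow> (nat ^ 'n::finite \<Rightarrow> real) \<Rightarrow> bool" where
  "ps_conv R c \<longleftrightarrow> (\<forall>r. 0 < r \<longrightarrow> r < R \<longrightarrow> (\<lambda>\<alpha>. \<bar>c \<alpha>\<bar> * r ^ vsize \<alpha>) summable_on UNIV)"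

lemma abs_mpow_le:
  assumes "\<And>i. \<bar>x $ i\<bar> \<le> r"
  shows "\<bar>mpow x \<alpha>\<bar> \<le> r ^ vsize \<alpha>"
proof -
  have "\<bar>mpow x \<alpha>\<bar> = (\<Prod>i\<in>UNIV. \<bar>x $ i\<bar> ^ (\<alpha> $ i))" by (simp add: mpow_def abs_prod power_abs)
  also have "\<dots> \<le> (\<Prod>i\<in>UNIV. r ^ (\<alpha> $ i))"
    using assms by (intro prod_mono conjI power_mono) auto
  finally show ?thesis by (simp add: vsize_def power_sum)
qed

lemma mpow_add: "mpow x (\<alpha> + \<beta>) = mpow x \<alpha> * mpow x \<beta>"
  by (simp add: mpow_def power_add prod.distrib)

lemma mpow_axis_exponent: "mpow x (axis j m) = (x $ j) ^ m"
proof -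
  have "mpow x (axis j m) = (\<Prod>i\<in>UNIV. if i = j then (x $ j) ^ m else 1)"
    unfolding mpow_def by (rule prod.cong) (auto simp: axis_def)
  then show ?thesis by simp
qed

lemma ps_conv_has_sum:
  assumes "ps_conv R c" "\<And>i. \<bar>x $ i\<bar> < R"
  shows "(\<lambda>\<alpha>. c \<alpha> * mpow x \<alpha>) summable_on UNIV" "((\<lambda>\<alpha>. c \<alpha> * mpow x \<alpha>) has_sum psum c x) UNIV"
    "(\<lambda>\<alpha>. \<bar>c \<alpha> * mpow x \<alpha>\<bar>) summable_on UNIV"
proof -
  define m where "m = Max (range (\<lambda>i. \<bar>x $ i\<bar>))"
  have "m < R" unfolding m_def using assms(2) by (subst Max_less_iff) auto
  have m: "\<bar>x $ i\<bar> \<le> m" for i unfolding m_def by (rule Max_ge) auto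
  have "0 \<le> m" using m[of undefined] by linarith
  define r where "r = (m + R) / 2"
  have r: "0 < r" "r < R" "\<And>i. \<bar>x $ i\<bar> \<le> r" using \<open>m < R\<close> \<open>0 \<le> m\<close> m order_trans[OF m, of r] by (auto simp: r_def)
  have "(\<lambda>\<alpha>. \<bar>c \<alpha>\<bar> * r ^ vsize \<alpha>) summable_on UNIV" using assms(1) r by (simp add: ps_conv_def)
  then show abs: "(\<lambda>\<alpha>. \<bar>c \<alpha> * mpow x \<alpha>\<bar>) summable_on UNIV"
  proof (rule summable_on_comparison_test)
    show "\<bar>c \<alpha> * mpow x \<alpha>\<bar> \<le> \<bar>c \<alpha>\<bar> * r ^ vsize \<alpha>" for \<alpha>
      unfolding abs_mult using abs_mpow_le[OF r(3)] by (intro mult_left_mono) auto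
  qed auto
  then show "(\<lambda>\<alpha>. c \<alpha> * mpow x \<alpha>) summable_on UNIV"
    using summable_on_iff_abs_summable_on_real[of "\<lambda>\<alpha>. c \<alpha> * mpow x \<alpha>" UNIV] by simp
  then show "((\<lambda>\<alpha>. c \<alpha> * mpow x \<alpha>) has_sum psum c x) UNIV"
    unfolding psum_def by (rule has_sum_infsum)
qed

text \<open>Unconditional summability of reals is absolute. At the point with all coordinates
  \<open>r\<close> it therefore gives convergence on the whole polydisc of radius
  \<open>r\<close>.\<close>

lemma has_power_series_psum:
  fixes \<phi> :: "real ^ 'n::finite \<Rightarrow> real"
  assumes "has_power_series \<phi> c"
  obtains R where "0 < R" "ps_conv R c" "\<And>x. (\<And>i. \<bar>x $ i\<bar> < R) \<Longrightarrow> \<phi> x = psum c x"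
proof -
  obtain U where U: "open U" "0 \<in> U" "\<And>x. x \<in> U \<Longrightarrow> ((\<lambda>\<alpha>. c \<alpha> * mpow x \<alpha>) has_sum \<phi> x) UNIV"
    using assms unfolding has_power_series_def eventually_nhds by blast
  from U(1,2) obtain e where e: "e > 0" "ball 0 e \<subseteq> U" unfolding open_contains_ball by blast
  define R where "R = e / real CARD('n)"
  have R: "R > 0" using e by (simp add: R_def)
  have inU: "x \<in> U" if x: "\<And>i. \<bar>x $ i\<bar> < R" for x
  proof -
    have "norm x \<le> (\<Sum>i\<in>UNIV. \<bar>x $ i\<bar>)" by (rule norm_le_l1_cart)
    also have "\<dots> < (\<Sum>i\<in>(UNIV :: 'n set). R)" using x by (intro sum_strict_mono) auto
    also have "\<dots> = e" by (simp add: R_def)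
    finally show ?thesis using e(2) by auto
  qed
  show thesis
  proof (rule that[OF R])
    show "ps_conv R c" unfolding ps_conv_def
    proof (intro allI impI)
      fix r assume r: "0 < r" "r < R"
      have "(\<chi> i. r) \<in> U" using r by (intro inU) auto
      then have "(\<lambda>\<alpha>. c \<alpha> * mpow (\<chi> i. r) \<alpha>) summable_on UNIV"
        by (rule has_sum_imp_summable[OF U(3)])
      then have "(\<lambda>\<alpha>. \<bar>c \<alpha> * mpow (\<chi> i. r) \<alpha>\<bar>) summable_on UNIV"
        using summable_on_iff_abs_summable_on_real[of "\<lambda>\<alpha>. c \<alpha> * mpow (\<chi> i. r) \<alpha>" UNIV] by simp
      then show "(\<lambda>\<alpha>. \<bar>c \<alpha>\<bar> * r ^ vsize \<alpha>) summable_on UNIV"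
        using r by (simp add: abs_mult mpow_def vsize_def flip: power_sum)
    qed
    show "\<phi> x = psum c x" if "\<And>i. \<bar>x $ i\<bar> < R" for x
      using U(3)[OF inU[OF that]] unfolding psum_def by (simp add: infsumI)
  qed
qed

lemma linear_power_bound:
  fixes q :: real
  assumes "0 < q" "q < 1"
  shows "\<exists>K. \<forall>n. real n * q ^ n \<le> K"
proof -
  have "(\<lambda>n. real n * q ^ n) \<longlonglongrightarrow> 0" using powser_times_n_limit_0[of q] assms by simp
  then have "Bseq (\<lambda>n. real n * q ^ n)" by (rule convergent_imp_Bseq[OF convergentI])
  then obtain K where "\<forall>n. norm (real n * q ^ n) \<le> K" unfolding Bseq_def by blast
  then have "\<forall>n. real n * q ^ n \<le> K" unfolding real_norm_def abs_le_iff by blast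
  then show ?thesis by blast
qed

text \<open>For \<open>r < s < R\<close> the factor \<open>\<alpha>_i \<le> |\<alpha>|\<close> is
  absorbed by \<open>(r/s)^|\<alpha>|\<close>, so the radius does not shrink.\<close>

lemma ps_conv_mult:
  assumes "ps_conv R c"
  shows "ps_conv R (\<lambda>\<alpha>. real (\<alpha> $ i) * c \<alpha>)"
  unfolding ps_conv_def
proof (intro allI impI)
  fix r assume r: "0 < r" "r < R"
  define s where "s = (r + R) / 2"
  have s: "r < s" "s < R" "0 < s" using r by (auto simp: s_def)
  have "0 < r / s" "r / s < 1" using r s by auto
  then have "\<exists>K. \<forall>n. real n * (r / s) ^ n \<le> K" by (rule linear_power_bound)
  then obtain K where K: "\<And>n. real n * (r / s) ^ n \<le> K" by blast
  have "(\<lambda>\<alpha>. K * (\<bar>c \<alpha>\<bar> * s ^ vsize \<alpha>)) summable_on UNIV"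
    using assms s unfolding ps_conv_def by (intro summable_on_cmult_right) auto
  then show "(\<lambda>\<alpha>. \<bar>real (\<alpha> $ i) * c \<alpha>\<bar> * r ^ vsize \<alpha>) summable_on UNIV"
  proof (rule summable_on_comparison_test)
    fix \<alpha> :: "nat ^ 'a"
    have "\<alpha> $ i \<le> vsize \<alpha>" unfolding vsize_def by (rule member_le_sum) auto
    then have "real (\<alpha> $ i) * r ^ vsize \<alpha> \<le> real (vsize \<alpha>) * r ^ vsize \<alpha>"
      using r by (intro mult_right_mono) auto
    also have "\<dots> = real (vsize \<alpha>) * (r / s) ^ vsize \<alpha> * s ^ vsize \<alpha>" using s by (simp add: power_divide)
    also have "\<dots> \<le> K * s ^ vsize \<alpha>" using K s by (intro mult_right_mono) auto
    finally have "\<bar>c \<alpha>\<bar> * (real (\<alpha> $ i) * r ^ vsize \<alpha>) \<le> \<bar>c \<alpha>\<bar> * (K * s ^ vsize \<alpha>)"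
      by (intro mult_left_mono) auto
    then show "\<bar>real (\<alpha> $ i) * c \<alpha>\<bar> * r ^ vsize \<alpha> \<le> K * (\<bar>c \<alpha>\<bar> * s ^ vsize \<alpha>)"
      by (simp add: abs_mult mult_ac)
  qed (use r in auto)
qed

text \<open>The \<open>i\<close>-th partial derivative of a monomial. If
  \<open>\<alpha> $ i = 0\<close> the truncated exponent does no harm, as the factor in front
  vanishes.\<close>

definition dmono :: "'n::finite \<Rightarrow> nat ^ 'n \<Rightarrow> real ^ 'n \<Rightarrow> real" where
  "dmono i \<alpha> x = real (\<alpha> $ i) * (x $ i) ^ (\<alpha> $ i - 1) * (\<Prod>j\<in>UNIV - {i}. (x $ j) ^ (\<alpha> $ j))"

lemma has_derivative_mpow:
  "((\<lambda>x. mpow x \<alpha>) has_derivative (\<lambda>h. \<Sum>i\<in>UNIV. h $ i * dmono i \<alpha> x)) (at x within S)"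
proof -
  have "((\<lambda>x. \<Prod>i\<in>UNIV. (x $ i) ^ (\<alpha> $ i)) has_derivative
    (\<lambda>h. \<Sum>i\<in>UNIV. (real (\<alpha> $ i) * (h $ i) * (x $ i) ^ (\<alpha> $ i - 1)) * (\<Prod>j\<in>UNIV - {i}. (x $ j) ^ (\<alpha> $ j)))) (at x within S)"
    by (intro has_derivative_prod has_derivative_power bounded_linear_imp_has_derivative bounded_linear_vec_nth)
  then show ?thesis unfolding mpow_def dmono_def by (simp add: mult_ac)
qed

lemma times_dmono: "x $ i * dmono i \<alpha> x = real (\<alpha> $ i) * mpow x \<alpha>"
proof (cases "\<alpha> $ i")
  case (Suc m)
  have "mpow x \<alpha> = (x $ i) ^ (\<alpha> $ i) * (\<Prod>j\<in>UNIV - {i}. (x $ j) ^ (\<alpha> $ j))"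
    unfolding mpow_def by (rule prod.remove) auto
  then show ?thesis by (simp add: dmono_def Suc)
qed (simp add: dmono_def)

lemma eul_mpow: "eul i (\<lambda>x. mpow x \<alpha>) x = real (\<alpha> $ i) * mpow x \<alpha>"
proof -
  have "pd i (\<lambda>x. mpow x \<alpha>) x = (\<Sum>k\<in>UNIV. axis i 1 $ k * dmono k \<alpha> x)"
    by (rule pd_eqI[OF has_derivative_mpow])
  also have "\<dots> = dmono i \<alpha> x" by (simp add: axis_def if_distrib[of "\<lambda>a. a * _"] sum.delta' cong: if_cong)
  finally show ?thesis by (simp add: eul_def times_dmono)
qed

lemma abs_dmono_le:
  assumes x: "\<And>j. \<bar>x $ j\<bar> \<le> r" and r: "0 < r"
  shows "\<bar>dmono i \<alpha> x\<bar> \<le> real (\<alpha> $ i) * r ^ vsize \<alpha> / r"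
proof (cases "\<alpha> $ i")
  case (Suc m)
  have "vsize \<alpha> = \<alpha> $ i + (\<Sum>j\<in>UNIV - {i}. \<alpha> $ j)" unfolding vsize_def by (rule sum.remove) auto
  then have v: "r ^ vsize \<alpha> = r * (r ^ m * (\<Prod>j\<in>UNIV - {i}. r ^ (\<alpha> $ j)))"
    by (simp add: Suc power_add power_sum)
  have "\<bar>dmono i \<alpha> x\<bar> = real (\<alpha> $ i) * (\<bar>x $ i\<bar> ^ m * (\<Prod>j\<in>UNIV - {i}. \<bar>x $ j\<bar> ^ (\<alpha> $ j)))"
    by (simp add: dmono_def Suc abs_mult abs_prod power_abs)
  also have "\<dots> \<le> real (\<alpha> $ i) * (r ^ m * (\<Prod>j\<in>UNIV - {i}. r ^ (\<alpha> $ j)))"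
    using x r by (intro mult_left_mono mult_mono prod_mono power_mono conjI prod_nonneg) (auto intro: order_trans)
  finally show ?thesis unfolding v using r by simp
qed (simp add: dmono_def)

text \<open>Termwise differentiation. The unordered sum becomes a series along an enumeration
  \<open>e\<close> of the multi-indices, and the differentiated series converges uniformly on a
  convex box around \<open>x\<close> by the M-test.\<close>

lemma psum_has_derivative:
  fixes c :: "nat ^ 'n::finite \<Rightarrow> real"
  assumes c: "ps_conv R c" and x: "\<And>i. \<bar>x $ i\<bar> < R"
  shows "psum c differentiable (at x)" "eul i (psum c) x = psum (\<lambda>\<alpha>. real (\<alpha> $ i) * c \<alpha>) x"
proof -
  define m where "m = Max (range (\<lambda>i. \<bar>x $ i\<bar>))"
  have mR: "m < R" unfolding m_def using x by (subst Max_less_iff) auto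
  have m: "\<bar>x $ i\<bar> \<le> m" for i unfolding m_def by (rule Max_ge) auto
  have m0: "0 \<le> m" using m[of undefined] by linarith
  define r where "r = (m + R) / 2"
  have r: "0 < r" "r < R" "\<And>i. \<bar>x $ i\<bar> < r"
  proof -
    show "0 < r" "r < R" using mR m0 by (auto simp: r_def)
    show "\<bar>x $ i\<bar> < r" for i using m[of i] mR by (simp add: r_def)
  qed
  define S where "S = {y :: real ^ 'n. \<forall>i. \<bar>y $ i\<bar> < r}"
  have Seq: "S = box (\<chi> i. - r) (\<chi> i. r)" unfolding S_def by (auto simp: mem_box_cart abs_less_iff minus_less_iff)
  have S: "open S" "convex S" "x \<in> S" 
    using r(3) unfolding Seq by (simp_all add: mem_box_cart abs_less_iff minus_less_iff convex_box open_box)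
  have "infinite (UNIV :: (nat ^ 'n) set)"
  proof -
    have "inj (\<lambda>k. \<chi> i. k :: nat ^ 'n)" by (auto simp: inj_def vec_eq_iff)
    then show ?thesis using finite_imageD infinite_UNIV_nat by (metis finite_subset subset_UNIV)
  qed
  then obtain e :: "nat \<Rightarrow> nat ^ 'n" where e: "bij e"
    using countableE_infinite[of "UNIV :: (nat ^ 'n) set"] bij_betw_inv by (metis countableI_type)
  have sums: "(\<lambda>n. f (e n)) sums s" if "(f has_sum s) UNIV" for f :: "nat ^ 'n \<Rightarrow> real" and s
  proof -
    have "((\<lambda>n. f (e n)) has_sum s) UNIV"
      using that e by (subst has_sum_reindex_bij_betw[OF e, of f]) simp
    then show ?thesis by (rule has_sum_imp_sums)
  qed
  define A where "A i y = (\<Sum>n. c (e n) * dmono i (e n) y)" for i y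
  define M where "M i n = \<bar>c (e n)\<bar> * (real (e n $ i) * r ^ vsize (e n) / r)" for i n
  have M: "summable (M i)" for i
  proof -
    have "(\<lambda>\<alpha>. \<bar>real (\<alpha> $ i) * c \<alpha>\<bar> * r ^ vsize \<alpha>) summable_on UNIV"
      using ps_conv_mult[OF c, of i] r by (simp add: ps_conv_def)
    then have "(\<lambda>\<alpha>. inverse r * (\<bar>real (\<alpha> $ i) * c \<alpha>\<bar> * r ^ vsize \<alpha>)) summable_on UNIV"
      by (rule summable_on_cmult_right)
    then obtain s where "((\<lambda>\<alpha>. inverse r * (\<bar>real (\<alpha> $ i) * c \<alpha>\<bar> * r ^ vsize \<alpha>)) has_sum s) UNIV"
      by (auto simp: summable_on_def)
    from sums[OF this] show ?thesis
      unfolding M_def by (simp add: sums_iff abs_mult divide_inverse mult_ac)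
  qed
  have AM: "norm (c (e n) * dmono i (e n) y) \<le> M i n" if "y \<in> S" for i n y
    unfolding M_def real_norm_def abs_mult
    using abs_dmono_le[of y r i "e n"] that r by (intro mult_left_mono) (auto simp: S_def less_imp_le)
  have ul: "uniform_limit S (\<lambda>n y. \<Sum>k<n. c (e k) * dmono i (e k) y) (A i) sequentially" for i
    unfolding A_def by (rule Weierstrass_m_test[OF AM M])
  have summ: "summable (\<lambda>n. c (e n) * dmono i (e n) y)" if "y \<in> S" for i y
    by (rule summable_comparison_test'[OF M AM[OF that]])
  define f' where "f' n y h = c (e n) * (\<Sum>i\<in>UNIV. h $ i * dmono i (e n) y)" for n y and h :: "real ^ 'n"
  define g' where "g' y h = (\<Sum>i\<in>UNIV. h $ i * A i y)" for y and h :: "real ^ 'n"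
  have "\<exists>g. \<forall>y\<in>S. (\<lambda>n. c (e n) * mpow y (e n)) sums g y \<and> (g has_derivative g' y) (at y within S)"
  proof (rule has_derivative_series[OF S(2) _ _ S(3)])
    show "((\<lambda>y. c (e n) * mpow y (e n)) has_derivative f' n y) (at y within S)" for n y
      unfolding f'_def by (intro has_derivative_mult_right has_derivative_mpow)
    show "(\<lambda>n. c (e n) * mpow x (e n)) sums psum c x"
      by (rule sums) (rule ps_conv_has_sum[OF c x])
    fix \<epsilon> :: real assume \<epsilon>: "\<epsilon> > 0"
    define \<delta> where "\<delta> = \<epsilon> / real CARD('n)"
    have \<delta>: "\<delta> > 0" using \<epsilon> by (simp add: \<delta>_def)
    have "\<forall>\<^sub>F n in sequentially. \<forall>i\<in>UNIV. \<forall>y\<in>S. dist (\<Sum>k<n. c (e k) * dmono i (e k) y) (A i y) < \<delta>"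
      using ul \<delta> by (intro eventually_ball_finite) (auto simp: uniform_limit_iff)
    then show "\<forall>\<^sub>F n in sequentially. \<forall>y\<in>S. \<forall>h. norm ((\<Sum>k<n. f' k y h) - g' y h) \<le> \<epsilon> * norm h"
    proof (rule eventually_mono, intro ballI allI)
      fix n y and h :: "real ^ 'n"
      assume n: "\<forall>i\<in>UNIV. \<forall>y\<in>S. dist (\<Sum>k<n. c (e k) * dmono i (e k) y) (A i y) < \<delta>" and y: "y \<in> S"
      have "(\<Sum>k<n. f' k y h) = (\<Sum>i\<in>UNIV. h $ i * (\<Sum>k<n. c (e k) * dmono i (e k) y))"
        unfolding f'_def sum_distrib_left by (subst sum.swap) (simp add: mult_ac)
      then have "(\<Sum>k<n. f' k y h) - g' y h = (\<Sum>i\<in>UNIV. h $ i * ((\<Sum>k<n. c (e k) * dmono i (e k) y) - A i y))"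
        by (simp add: g'_def sum_subtractf right_diff_distrib)
      also have "norm \<dots> \<le> (\<Sum>i\<in>(UNIV :: 'n set). norm h * \<delta>)"
      proof (rule sum_norm_le)
        fix i
        show "norm (h $ i * ((\<Sum>k<n. c (e k) * dmono i (e k) y) - A i y)) \<le> norm h * \<delta>"
          unfolding real_norm_def abs_mult
          using n y component_le_norm_cart[of h i] by (intro mult_mono) (auto simp: dist_real_def less_imp_le)
      qed
      also have "\<dots> = \<epsilon> * norm h" by (simp add: \<delta>_def)
      finally show "norm ((\<Sum>k<n. f' k y h) - g' y h) \<le> \<epsilon> * norm h" .
    qed
  qed
  then obtain g where g: "\<And>y. y \<in> S \<Longrightarrow> (\<lambda>n. c (e n) * mpow y (e n)) sums g y"
      "\<And>y. y \<in> S \<Longrightarrow> (g has_derivative g' y) (at y within S)" by blast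
  have gp: "g y = psum c y" if y: "y \<in> S" for y
  proof -
    have "\<bar>y $ i\<bar> < R" for i using y r by (auto simp: S_def intro: less_trans)
    from sums[OF ps_conv_has_sum(2)[OF c this]] show ?thesis using g(1)[OF y] sums_unique2 by blast
  qed
  have "(g has_derivative g' x) (at x)" using g(2)[OF S(3)] at_within_open[OF S(3,1)] by simp
  then have d: "(psum c has_derivative g' x) (at x)"
    by (rule has_derivative_transform_within_open[OF _ S(1,3)]) (rule gp)
  then show "psum c differentiable (at x)" by (auto simp: differentiable_def)
  have "pd i (psum c) x = A i x"
    unfolding pd_eqI[OF d] g'_def by (simp add: axis_def if_distrib[of "\<lambda>a. a * _"] sum.delta' cong: if_cong)
  then have "eul i (psum c) x = x $ i * A i x" by (simp add: eul_def)
  also have "\<dots> = (\<Sum>n. x $ i * (c (e n) * dmono i (e n) x))"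
    unfolding A_def by (rule suminf_mult[symmetric]) (rule summ[OF S(3)])
  also have "\<dots> = (\<Sum>n. (real (e n $ i) * c (e n)) * mpow x (e n))"
  proof (rule suminf_cong)
    show "x $ i * (c (e n) * dmono i (e n) x) = real (e n $ i) * c (e n) * mpow x (e n)" for n
      unfolding mult.left_commute[of "x $ i" "c (e n)"] times_dmono by simp
  qed
  also have "\<dots> = psum (\<lambda>\<alpha>. real (\<alpha> $ i) * c \<alpha>) x"
    using sums[OF ps_conv_has_sum(2)[OF ps_conv_mult[OF c] x]] by (simp add: sums_iff)
  finally show "eul i (psum c) x = psum (\<lambda>\<alpha>. real (\<alpha> $ i) * c \<alpha>) x" .
qed

text \<open>If \<open>v\<close> lies below \<alpha>, then
  \<open>x^\<alpha> = x^v x^(\<alpha> - v)\<close>: the first factor is part of the weight, the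
  second is at most \<open>r^|\<alpha>| / r^D\<close>, where \<open>D\<close> is the largest size of
  an element of \<open>V\<close>.\<close>

lemma psum_bound:
  fixes c :: "nat ^ 'n::finite \<Rightarrow> real"
  assumes c: "ps_conv R c" and r: "0 < r" "r < R" "r \<le> 1" and V: "finite V"
    and dom: "\<And>\<alpha>. c \<alpha> \<noteq> 0 \<Longrightarrow> \<exists>v\<in>V. \<forall>i. v $ i \<le> \<alpha> $ i"
  shows "\<exists>C. \<forall>x. (\<forall>i. \<bar>x $ i\<bar> \<le> r) \<longrightarrow> \<bar>psum c x\<bar> \<le> C * monomial_weight V x"
proof -
  define D where "D = Max (insert 0 (vsize ` V))"
  have D: "vsize v \<le> D" if "v \<in> V" for v unfolding D_def using V that by (intro Max_ge) auto
  define K where "K = infsum (\<lambda>\<alpha>. \<bar>c \<alpha>\<bar> * r ^ vsize \<alpha>) UNIV"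
  have sm: "(\<lambda>\<alpha>. \<bar>c \<alpha>\<bar> * r ^ vsize \<alpha>) summable_on UNIV" using c r by (simp add: ps_conv_def)
  show ?thesis
  proof (intro exI[of _ "K / r ^ D"] allI impI)
    fix x :: "real ^ 'n" assume "\<forall>i. \<bar>x $ i\<bar> \<le> r"
    then have x: "\<And>i. \<bar>x $ i\<bar> \<le> r" by blast
    let ?w = "monomial_weight V x"
    have w0: "0 \<le> ?w" by (simp add: monomial_weight_def sum_nonneg)
    have le: "norm (c \<alpha> * mpow x \<alpha>) \<le> ?w / r ^ D * (\<bar>c \<alpha>\<bar> * r ^ vsize \<alpha>)" for \<alpha>
    proof (cases "c \<alpha> = 0")
      case False
      obtain v where v: "v \<in> V" "\<And>i. v $ i \<le> \<alpha> $ i" using dom[OF False] by blast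
      have \<alpha>: "\<alpha> = v + (\<alpha> - v)" using v(2) by (simp add: vec_eq_iff)
      have vs: "vsize \<alpha> = vsize v + vsize (\<alpha> - v)"
        by (subst \<alpha>) (simp only: vsize_def vector_add_component sum.distrib)
      have "\<bar>mpow x \<alpha>\<bar> = \<bar>mpow x v\<bar> * \<bar>mpow x (\<alpha> - v)\<bar>"
        by (subst \<alpha>) (simp only: mpow_add abs_mult)
      also have "\<dots> \<le> \<bar>mpow x v\<bar> * r ^ vsize (\<alpha> - v)" using abs_mpow_le[OF x] by (intro mult_left_mono) auto
      also have "\<dots> \<le> ?w * r ^ vsize (\<alpha> - v)"
        unfolding monomial_weight_def using v V r by (intro mult_right_mono member_le_sum) auto
      also have "\<dots> \<le> ?w * (r ^ vsize \<alpha> / r ^ D)"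
      proof (intro mult_left_mono w0)
        have "r ^ vsize (\<alpha> - v) * r ^ D \<le> r ^ vsize (\<alpha> - v) * r ^ vsize v"
          using r D[OF v(1)] by (intro mult_left_mono power_decreasing) auto
        then show "r ^ vsize (\<alpha> - v) \<le> r ^ vsize \<alpha> / r ^ D"
          using r by (simp add: pos_le_divide_eq vs power_add mult.commute)
      qed
      finally have "\<bar>c \<alpha>\<bar> * \<bar>mpow x \<alpha>\<bar> \<le> \<bar>c \<alpha>\<bar> * (?w * (r ^ vsize \<alpha> / r ^ D))" by (intro mult_left_mono) auto
      then show ?thesis by (simp add: abs_mult mult_ac)
    qed (use w0 r in simp)
    have "norm (psum c x) \<le> infsum (\<lambda>\<alpha>. ?w / r ^ D * (\<bar>c \<alpha>\<bar> * r ^ vsize \<alpha>)) UNIV"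
      unfolding psum_def
    proof (rule norm_infsum_le[OF _ _ le])
      have "\<bar>x $ i\<bar> < R" for i using x[of i] r by linarith
      then show "((\<lambda>\<alpha>. c \<alpha> * mpow x \<alpha>) has_sum infsum (\<lambda>\<alpha>. c \<alpha> * mpow x \<alpha>) UNIV) UNIV"
        using ps_conv_has_sum(2)[OF c] unfolding psum_def by blast
      show "((\<lambda>\<alpha>. ?w / r ^ D * (\<bar>c \<alpha>\<bar> * r ^ vsize \<alpha>)) has_sum
          infsum (\<lambda>\<alpha>. ?w / r ^ D * (\<bar>c \<alpha>\<bar> * r ^ vsize \<alpha>)) UNIV) UNIV"
        by (rule has_sum_infsum[OF summable_on_cmult_right[OF sm]])
    qed
    also have "\<dots> = ?w / r ^ D * K" unfolding K_def by (rule infsum_cmult_right) (use sm in simp)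
    finally show "\<bar>psum c x\<bar> \<le> K / r ^ D * ?w" by (simp add: mult_ac)
  qed
qed

text \<open>An Euler derivative multiplies each coefficient by \<open>\<alpha>_i\<close> and does
  not enlarge the support, so the same bound holds at every order.\<close>

lemma symb_psum:
  fixes c :: "nat ^ 'n::finite \<Rightarrow> real"
  assumes c: "ps_conv R c" and r: "0 < r" "r < R" "r \<le> 1" and V: "finite V"
    and dom: "\<And>\<alpha>. c \<alpha> \<noteq> 0 \<Longrightarrow> \<exists>v\<in>V. \<forall>i. v $ i \<le> \<alpha> $ i"
    and S: "open S" "\<And>x i. x \<in> S \<Longrightarrow> \<bar>x $ i\<bar> \<le> r"
  shows "symb m S (\<lambda>p :: 'p. monomial_weight V) (\<lambda>p x. complex_of_real (psum c x))"
  using c dom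
proof (induction m arbitrary: c)
  case (0 c)
  have "\<exists>C. \<forall>x. (\<forall>i. \<bar>x $ i\<bar> \<le> r) \<longrightarrow> \<bar>psum c x\<bar> \<le> C * monomial_weight V x"
    by (rule psum_bound[OF 0(1) r V]) (rule 0(2))
  then obtain C where C: "\<forall>x. (\<forall>i. \<bar>x $ i\<bar> \<le> r) \<longrightarrow> \<bar>psum c x\<bar> \<le> C * monomial_weight V x"
    by (elim exE)
  have xR: "\<bar>x $ i\<bar> < R" if "x \<in> S" for x i using S(2)[OF that, of i] r by linarith
  have d: "psum c differentiable (at x)" if "x \<in> S" for x
    by (rule psum_has_derivative(1)[OF 0(1) xR[OF that]])
  have "continuous_on S (psum c)"
    using d by (simp add: continuous_at_imp_continuous_on differentiable_imp_continuous_within)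
  then have "continuous_on S (\<lambda>x. complex_of_real (psum c x))" by (rule continuous_on_of_real)
  moreover have "\<forall>x\<in>S. norm (complex_of_real (psum c x)) \<le> C * monomial_weight V x"
    using C S(2) unfolding norm_of_real by blast
  ultimately show ?case unfolding symb.simps by blast
next
  case (Suc m c)
  have "\<exists>C. \<forall>x. (\<forall>i. \<bar>x $ i\<bar> \<le> r) \<longrightarrow> \<bar>psum c x\<bar> \<le> C * monomial_weight V x"
    by (rule psum_bound[OF Suc.prems(1) r V]) (rule Suc.prems(2))
  then obtain C where C: "\<forall>x. (\<forall>i. \<bar>x $ i\<bar> \<le> r) \<longrightarrow> \<bar>psum c x\<bar> \<le> C * monomial_weight V x"
    by (elim exE)
  have xR: "\<bar>x $ i\<bar> < R" if "x \<in> S" for x i using S(2)[OF that, of i] r by linarith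
  have d: "psum c differentiable (at x)" if "x \<in> S" for x
    by (rule psum_has_derivative(1)[OF Suc.prems(1) xR[OF that]])
  have d': "(\<lambda>x. complex_of_real (psum c x)) differentiable (at x)" if "x \<in> S" for x
    by (rule differentiable_complex_of_real[OF d[OF that]])
  have "symb m S (\<lambda>p :: 'p. monomial_weight V) (\<lambda>p. eul i (\<lambda>x. complex_of_real (psum c x)))" for i
  proof (rule symb_cong[OF S(1)])
    show "symb m S (\<lambda>p :: 'p. monomial_weight V) (\<lambda>p x. complex_of_real (psum (\<lambda>\<alpha>. real (\<alpha> $ i) * c \<alpha>) x))"
      by (rule Suc.IH[OF ps_conv_mult[OF Suc.prems(1)]]) (use Suc.prems(2) in auto)
    show "complex_of_real (psum (\<lambda>\<alpha>. real (\<alpha> $ i) * c \<alpha>) x) = eul i (\<lambda>x. complex_of_real (psum c x)) x"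
      if "x \<in> S" for x
      unfolding eul_of_real[OF d[OF that]] psum_has_derivative(2)[OF Suc.prems(1) xR[OF that]] ..
  qed
  moreover have "\<forall>x\<in>S. norm (complex_of_real (psum c x)) \<le> C * monomial_weight V x"
    using C S(2) unfolding norm_of_real by blast
  ultimately show ?case unfolding symb.simps using d' by blast
qed


subsection \<open>Newton polyhedra\<close>

definition newton_hull :: "(nat ^ 'n::finite) set \<Rightarrow> (real ^ 'n) set" where
  "newton_hull V = convex hull (\<Union>\<alpha>\<in>V. {rvec \<alpha> + v | v. \<forall>i. 0 \<le> v $ i})"

lemma newton_polyhedron_eq_hull: "newton_polyhedron \<phi> = newton_hull (ps_supp \<phi>)"
  by (simp add: newton_polyhedron_def newton_hull_def)

text \<open>The orthant at a dominated exponent is contained in the orthant at the exponent below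
  it.\<close>

lemma newton_hull_dominated:
  fixes V S :: "(nat ^ 'n::finite) set"
  assumes "V \<subseteq> S" "\<And>\<alpha>. \<alpha> \<in> S \<Longrightarrow> \<exists>v\<in>V. \<forall>i. v $ i \<le> \<alpha> $ i"
  shows "newton_hull S = newton_hull V"
proof -
  have "{rvec \<alpha> + y | y. \<forall>i. 0 \<le> y $ i} \<subseteq> (\<Union>\<alpha>\<in>V. {rvec \<alpha> + v | v. \<forall>i. 0 \<le> v $ i})" if \<alpha>: "\<alpha> \<in> S" for \<alpha>
  proof safe
    fix y :: "real ^ 'n" assume y: "\<forall>i. 0 \<le> y $ i"
    obtain v where v: "v \<in> V" "\<forall>i. v $ i \<le> \<alpha> $ i" using assms(2)[OF \<alpha>] by blast
    have "rvec \<alpha> + y = rvec v + (rvec \<alpha> - rvec v + y)" by simp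
    moreover have "\<forall>i. 0 \<le> (rvec \<alpha> - rvec v + y) $ i" using y v(2) by simp
    ultimately show "rvec \<alpha> + y \<in> (\<Union>\<alpha>\<in>V. {rvec \<alpha> + v | v. \<forall>i. 0 \<le> v $ i})" using v(1) by blast
  qed
  then have "(\<Union>\<alpha>\<in>S. {rvec \<alpha> + v | v. \<forall>i. 0 \<le> v $ i}) = (\<Union>\<alpha>\<in>V. {rvec \<alpha> + v | v. \<forall>i. 0 \<le> v $ i})"
    using assms(1) by blast
  then show ?thesis by (simp add: newton_hull_def)
qed

lemma convex_nonneg_cone: "convex {v :: real ^ 'n::finite. \<forall>i. 0 \<le> v $ i}"
  by (auto simp: convex_def)

lemma closed_nonneg_cone: "closed {v :: real ^ 'n::finite. \<forall>i. 0 \<le> v $ i}"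
  by (intro closed_Collect_all closed_Collect_le continuous_intros)

lemma newton_hull_eq:
  "newton_hull V = {x + y | x y. x \<in> convex hull (rvec ` V) \<and> y \<in> {v. \<forall>i. 0 \<le> v $ i}}"
proof -
  have "(\<Union>\<alpha>\<in>V. {rvec \<alpha> + v | v. \<forall>i. 0 \<le> v $ i}) = rvec ` V + {v. \<forall>i. 0 \<le> v $ i}"
    by (auto simp: set_plus_def)
  then have "newton_hull V = convex hull (rvec ` V) + {v. \<forall>i. 0 \<le> v $ i}"
    unfolding newton_hull_def convex_hull_set_plus
    by (simp add: convex_hull_set_plus hull_same[of convex, OF convex_nonneg_cone])
  then show ?thesis by (auto simp: set_plus_def)
qed

lemma convex_newton_hull: "convex (newton_hull V)"
  by (simp add: newton_hull_def)

lemma closed_newton_hull: "finite V \<Longrightarrow> closed (newton_hull (V :: (nat ^ 'n::finite) set))"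
proof -
  assume "finite V"
  then have "closed (\<Union>x\<in>convex hull (rvec ` V). \<Union>y\<in>{v :: real ^ 'n. \<forall>i. 0 \<le> v $ i}. {x + y})"
    by (intro compact_closed_sums finite_imp_compact_convex_hull closed_nonneg_cone) simp
  moreover have "newton_hull V = (\<Union>x\<in>convex hull (rvec ` V). \<Union>y\<in>{v. \<forall>i. 0 \<le> v $ i}. {x + y})"
    unfolding newton_hull_eq by blast
  ultimately show ?thesis by simp
qed

lemma newton_hull_add:
  assumes "x \<in> newton_hull V" "\<And>i. 0 \<le> y $ i"
  shows "x + y \<in> newton_hull V"
proof -
  obtain a b where "x = a + b" "a \<in> convex hull (rvec ` V)" "\<forall>i. 0 \<le> b $ i"
    using assms(1) unfolding newton_hull_eq by auto
  then have "x + y = a + (b + y)" "a \<in> convex hull (rvec ` V)" "b + y \<in> {v. \<forall>i. 0 \<le> v $ i}"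
    using assms(2) by (auto simp: add.assoc)
  then show ?thesis unfolding newton_hull_eq by blast
qed

lemma hull_subset_newton_hull: "convex hull (rvec ` V) \<subseteq> newton_hull V"
proof
  fix x assume "x \<in> convex hull (rvec ` V)"
  then have "x + 0 \<in> newton_hull V" unfolding newton_hull_eq by force
  then show "x \<in> newton_hull V" by simp
qed

lemma rvec_in_newton_hull: "v \<in> V \<Longrightarrow> rvec v \<in> newton_hull V"
  using hull_subset_newton_hull[of V] hull_inc[of "rvec v" "rvec ` V" convex] by auto

lemma newton_hull_inner_ge:
  assumes V: "finite V" and x: "x \<in> newton_hull V" and t: "\<And>i. 0 \<le> t $ i"
  shows "min_weight V t \<le> x \<bullet> t"
proof -
  obtain a b where ab: "x = a + b" "a \<in> convex hull (rvec ` V)" "\<forall>i. 0 \<le> b $ i"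
    using x unfolding newton_hull_eq by auto
  have "convex hull (rvec ` V) \<subseteq> {y. t \<bullet> y \<ge> min_weight V t}"
  proof (rule hull_minimal)
    show "rvec ` V \<subseteq> {y. t \<bullet> y \<ge> min_weight V t}"
      using V by (auto simp: min_weight_def inner_commute)
  qed (rule convex_halfspace_ge)
  then have "min_weight V t \<le> a \<bullet> t" using ab(2) by (auto simp: inner_commute)
  moreover have "0 \<le> b \<bullet> t" using ab(3) t by (simp add: inner_vec_def sum_nonneg)
  ultimately show ?thesis by (simp add: ab(1) inner_add_left)
qed

text \<open>A single segment in direction \<open>e\<close> makes the face invariant in that
  direction. Some point strictly between \<open>x + s e\<close> and \<open>a\<close> also lies
  between \<open>x\<close> and a point of the segment, hence in \<open>F\<close>, and the face
  property yields \<open>x + s e\<close>.\<close>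

lemma face_ray:
  assumes F: "F face_of N" and up: "\<And>x s. x \<in> N \<Longrightarrow> 0 \<le> s \<Longrightarrow> x + s *\<^sub>R e \<in> N"
    and a: "a \<in> F" "a + t *\<^sub>R e \<in> F" "0 < t" and x: "x \<in> F" and s: "0 \<le> s"
  shows "x + s *\<^sub>R e \<in> F"
proof (cases "x + s *\<^sub>R e = a")
  case False
  have FN: "F \<subseteq> N" using F by (rule face_of_imp_subset)
  have cF: "convex F" using F by (rule face_of_imp_convex)
  \<comment> \<open>Any value in \<open>[s/(s+t), 1)\<close> that is positive will do: the point
    reached on the segment from \<open>a\<close> then has parameter
    \<open>r \<le> 1\<close>.\<close>
  define \<epsilon> where "\<epsilon> = (s + t / 2) / (s + t)"
  have \<epsilon>: "0 < \<epsilon>" "\<epsilon> < 1" using a s by (auto simp: \<epsilon>_def field_simps)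
  have st: "s + t > 0" using a s by simp
  have "(1 - \<epsilon>) * s \<le> \<epsilon> * t"
  proof -
    have "(t / 2) * s \<le> (s + t / 2) * t" using a s by (simp add: algebra_simps)
    moreover have "1 - \<epsilon> = (t / 2) / (s + t)" using st by (simp add: \<epsilon>_def field_simps)
    ultimately have "(1 - \<epsilon>) * s = (t / 2) * s / (s + t)" "\<epsilon> * t = (s + t / 2) * t / (s + t)"
      by (simp_all add: \<epsilon>_def)
    then show ?thesis using st \<open>(t / 2) * s \<le> (s + t / 2) * t\<close> by (simp only: divide_right_mono less_imp_le)
  qed
  then have r: "0 \<le> (1 - \<epsilon>) * s / (\<epsilon> * t)" "(1 - \<epsilon>) * s / (\<epsilon> * t) \<le> 1"
    using \<epsilon> a s by (auto simp: pos_divide_le_eq)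
  define r where "r = (1 - \<epsilon>) * s / (\<epsilon> * t)"
  have "a + (r * t) *\<^sub>R e = (1 - r) *\<^sub>R a + r *\<^sub>R (a + t *\<^sub>R e)" by (simp add: algebra_simps)
  then have b: "a + (r * t) *\<^sub>R e \<in> F" using convexD_alt[OF cF a(1,2), of r] r by (simp add: r_def)
  define m where "m = (1 - \<epsilon>) *\<^sub>R x + \<epsilon> *\<^sub>R (a + (r * t) *\<^sub>R e)"
  have mF: "m \<in> F" unfolding m_def using convexD_alt[OF cF x b, of \<epsilon>] \<epsilon> by simp
  have "\<epsilon> * (r * t) = (1 - \<epsilon>) * s" using \<epsilon> a by (simp add: r_def)
  then have "m = (1 - \<epsilon>) *\<^sub>R (x + s *\<^sub>R e) + \<epsilon> *\<^sub>R a"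
    by (simp add: m_def scaleR_add_right)
  then have "m \<in> open_segment (x + s *\<^sub>R e) a" using False \<epsilon> by (auto simp: in_segment)
  from face_ofD[OF F this _ _ mF] show ?thesis using up[OF _ s] x a(1) FN by blast
qed (use a in simp)

text \<open>A face is encoded by two finite data, the exponents it contains and the coordinate
  directions in which it contains a segment. Counting these codes bounds the number of
  faces.\<close>

lemma face_newton_hull_eq:
  fixes V :: "(nat ^ 'n::finite) set"
  assumes V: "finite V" and F: "F face_of newton_hull V"
  shows "F = {x + y | x y. x \<in> convex hull (rvec ` {v\<in>V. rvec v \<in> F}) \<and> (\<forall>i. 0 \<le> y $ i) \<and>
      (\<forall>i. i \<notin> {i. \<exists>a\<in>F. \<exists>t>0. a + t *\<^sub>R axis i 1 \<in> F} \<longrightarrow> y $ i = 0)}" (is "F = ?R")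
proof -
  let ?N = "newton_hull V"
  have FN: "F \<subseteq> ?N" using F by (rule face_of_imp_subset)
  have cF: "convex F" using F by (rule face_of_imp_convex)
  show ?thesis
  proof
    show "F \<subseteq> ?R"
    proof
      fix z assume z: "z \<in> F"
      then obtain x y where xy: "z = x + y" "x \<in> convex hull (rvec ` V)" "\<forall>i. 0 \<le> y $ i"
        using FN unfolding newton_hull_eq by blast
      have xN: "x \<in> ?N" using xy(2) hull_subset_newton_hull by blast
      have xF: "x \<in> F"
      proof (cases "y = 0")
        case False
        have "x + 2 *\<^sub>R y \<in> ?N" using xN xy(3) by (intro newton_hull_add) auto
        \<comment> \<open>\<open>z\<close> is the midpoint of \<open>x\<close> and
          \<open>x + 2y\<close>, so the face property puts \<open>x\<close> into
          \<open>F\<close>.\<close>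
        moreover have "z = (1 - 1/2) *\<^sub>R x + (1/2) *\<^sub>R (x + 2 *\<^sub>R y)" by (simp add: xy(1) algebra_simps flip: scaleR_add_left)
        then have "z \<in> open_segment x (x + 2 *\<^sub>R y)"
          using False unfolding in_segment by (intro conjI exI[of _ "1/2"]) auto
        ultimately show ?thesis using face_ofD[OF F _ xN _ z] by blast
      qed (use z xy in simp)
      have "F \<inter> convex hull (rvec ` V) face_of (?N \<inter> convex hull (rvec ` V))"
        by (rule face_of_slice[OF F convex_convex_hull])
      then have "F \<inter> convex hull (rvec ` V) face_of (convex hull (rvec ` V))"
        using hull_subset_newton_hull[of V] by (simp add: Int_absorb1)
      then obtain S' where S': "S' \<subseteq> rvec ` V" "F \<inter> convex hull (rvec ` V) = convex hull S'"
        using face_of_convex_hull_subset[of "rvec ` V"] V by (metis finite_imageI finite_imp_compact)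
      have "S' \<subseteq> rvec ` {v\<in>V. rvec v \<in> F}" using S' hull_subset[of S' convex] by blast
      then have "convex hull S' \<subseteq> convex hull (rvec ` {v\<in>V. rvec v \<in> F})" by (rule hull_mono)
      then have "x \<in> convex hull (rvec ` {v\<in>V. rvec v \<in> F})" using S'(2) xF xy(2) by blast
      moreover have "y $ i = 0" if i: "i \<notin> {i. \<exists>a\<in>F. \<exists>t>0. a + t *\<^sub>R axis i 1 \<in> F}" for i
      proof (rule ccontr)
        assume "y $ i \<noteq> 0"
        then have yi: "0 < y $ i" using xy(3) by (metis order_le_less)
        let ?e = "(y $ i) *\<^sub>R axis i 1 :: real ^ 'n"
        have "x + (y - ?e) \<in> ?N"
        proof (rule newton_hull_add[OF xN])
          show "0 \<le> (y - ?e) $ k" for k using xy(3) by (cases "k = i") (auto simp: axis_def)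
        qed
        moreover have "z + ?e \<in> ?N"
        proof (rule newton_hull_add)
          show "z \<in> ?N" using z FN by blast
          show "0 \<le> ?e $ k" for k using yi by (auto simp: axis_def)
        qed
        \<comment> \<open>\<open>z\<close> is the midpoint of \<open>z - ?e\<close> and
          \<open>z + ?e\<close>. Both lie in the polyhedron, so \<open>z + ?e\<close> would lie in
          \<open>F\<close> and \<open>i\<close> would be a direction of \<open>F\<close>.\<close>
        moreover have "z = (1 - 1/2) *\<^sub>R (x + (y - ?e)) + (1/2) *\<^sub>R (z + ?e)"
          unfolding xy(1) by (simp add: vec_eq_iff field_simps)
        moreover have "x + (y - ?e) \<noteq> z + ?e"
        proof
          assume "x + (y - ?e) = z + ?e"
          then have "(x + (y - ?e)) $ i = (z + ?e) $ i" by (rule arg_cong)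
          then show False using yi xy(1) by (simp add: axis_def)
        qed
        ultimately have "x + (y - ?e) \<in> newton_hull V" "z + ?e \<in> newton_hull V"
            "z \<in> open_segment (x + (y - ?e)) (z + ?e)"
          unfolding in_segment by (blast, blast, intro conjI exI[of _ "1/2"]) auto
        then have "z + ?e \<in> F" using face_ofD[OF F _ _ _ z, of "x + (y - ?e)" "z + ?e"] by blast
        then show False using i z yi by blast
      qed
      ultimately show "z \<in> ?R" using xy(1,3) by blast
    qed
    show "?R \<subseteq> F"
    proof safe
      fix x y :: "real ^ 'n"
      assume x: "x \<in> convex hull (rvec ` {v\<in>V. rvec v \<in> F})" and y: "\<forall>i. 0 \<le> y $ i"
        and y0: "\<forall>i. i \<notin> {i. \<exists>a\<in>F. \<exists>t>0. a + t *\<^sub>R axis i 1 \<in> F} \<longrightarrow> y $ i = 0"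
      have "convex hull (rvec ` {v\<in>V. rvec v \<in> F}) \<subseteq> F" by (rule hull_minimal) (use cF in auto)
      then have xF: "x \<in> F" using x by blast
      \<comment> \<open>The coordinates of \<open>y\<close> are added one at a time, each by
        \<open>face_ray\<close>.\<close>
      have "x + (\<Sum>i\<in>A. (y $ i) *\<^sub>R axis i 1) \<in> F" if "finite A" for A
        using that
      proof (induction A)
        case (insert i A)
        show ?case
        proof (cases "\<exists>a\<in>F. \<exists>t>0. a + t *\<^sub>R axis i 1 \<in> F")
          case True
          then obtain a t where at: "a \<in> F" "t > 0" "a + t *\<^sub>R axis i 1 \<in> F" by blast
          have "x + (\<Sum>i\<in>A. (y $ i) *\<^sub>R axis i 1) + (y $ i) *\<^sub>R axis i 1 \<in> F"
          proof (rule face_ray[OF F _ at(1,3,2) insert.IH])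
            show "z + s *\<^sub>R axis i 1 \<in> ?N" if "z \<in> ?N" "0 \<le> s" for z s
              using that by (intro newton_hull_add) (auto simp: axis_def)
          qed (use y in simp)
          then show ?thesis using insert.hyps by (simp add: add_ac)
        next
          case False
          then have "y $ i = 0" using y0 by blast
          then show ?thesis using insert by simp
        qed
      qed (use xF in simp)
      from this[of UNIV] have "x + (\<Sum>i\<in>UNIV. (y $ i) *\<^sub>R axis i 1) \<in> F" by simp
      then show "x + y \<in> F" using basis_expansion[of y] by (simp add: scalar_mult_eq_scaleR)
    qed
  qed
qed

section \<open>Facets of the Newton polyhedron and their normals\<close>

text \<open>A closed convex set with finitely many faces is a polyhedron. This makes available that
  facets are exposed and that they cover the relative boundary.\<close>

lemma polyhedron_newton_hull:
  fixes V :: "(nat ^ 'n::finite) set"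
  assumes V: "finite V"
  shows "polyhedron (newton_hull V)"
proof -
  let ?g = "\<lambda>(A :: (nat ^ 'n) set, I :: 'n set).
     {x + y | x y. x \<in> convex hull (rvec ` A) \<and> (\<forall>i. 0 \<le> y $ i) \<and> (\<forall>i. i \<notin> I \<longrightarrow> y $ i = 0)}"
  have "{F. F face_of newton_hull V} \<subseteq> ?g ` (Pow V \<times> UNIV)"
  proof (rule subsetI)
    fix F assume "F \<in> {F. F face_of newton_hull V}"
    then have "F face_of newton_hull V" by (rule CollectD)
    from face_newton_hull_eq[OF V this]
    have "F = ?g ({v\<in>V. rvec v \<in> F}, {i. \<exists>a\<in>F. \<exists>t>0. a + t *\<^sub>R axis i 1 \<in> F})" by simp
    moreover have "({v\<in>V. rvec v \<in> F}, {i. \<exists>a\<in>F. \<exists>t>0. a + t *\<^sub>R axis i 1 \<in> F}) \<in> Pow V \<times> UNIV" by auto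
    ultimately show "F \<in> ?g ` (Pow V \<times> UNIV)" by (rule image_eqI)
  qed
  moreover have "finite (Pow V \<times> (UNIV :: 'n set set))" using V by simp
  ultimately have "finite {F. F face_of newton_hull V}" by (rule finite_surj[rotated])
  then show ?thesis
    by (simp add: polyhedron_eq_finite_faces closed_newton_hull[OF V] convex_newton_hull)
qed

lemma interior_newton_hull:
  assumes "x \<in> newton_hull V" "\<And>i. x $ i < y $ i"
  shows "y \<in> interior (newton_hull V)"
proof (rule interiorI)
  have "{z. \<forall>i. x $ i < z $ i} = (\<Inter>i. {z. x $ i < z $ i})" by auto
  moreover have "open (\<Inter>i. {z. x $ i < z $ i})"
    by (intro open_INT ballI open_Collect_less continuous_intros) simp
  ultimately show "open {z. \<forall>i. x $ i < z $ i}" by simp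
  show "y \<in> {z. \<forall>i. x $ i < z $ i}" using assms(2) by simp
  show "{z. \<forall>i. x $ i < z $ i} \<subseteq> newton_hull V"
  proof
    fix z assume "z \<in> {z. \<forall>i. x $ i < z $ i}"
    then have "x + (z - x) \<in> newton_hull V"
      by (intro newton_hull_add[OF assms(1)]) (auto simp: less_imp_le)
    then show "z \<in> newton_hull V" by simp
  qed
qed

lemma interior_newton_hull_nonempty:
  assumes "V \<noteq> {}"
  shows "interior (newton_hull V) \<noteq> {}"
proof -
  obtain v where "v \<in> V" using assms by blast
  then have "rvec v + 1 \<in> interior (newton_hull V)"
    by (intro interior_newton_hull[OF rvec_in_newton_hull]) auto
  then show ?thesis by blast
qed

lemma aff_dim_newton_hull:
  fixes V :: "(nat ^ 'n::finite) set"
  assumes "V \<noteq> {}"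
  shows "aff_dim (newton_hull V) = int CARD('n)"
proof -
  have "affine hull (newton_hull V) = UNIV"
    by (rule affine_hull_nonempty_interior[OF interior_newton_hull_nonempty[OF assms]])
  then have "aff_dim (newton_hull V) = aff_dim (UNIV :: (real ^ 'n) set)"
    using aff_dim_affine_hull[of "newton_hull V"] by simp
  then show ?thesis by (simp add: aff_dim_UNIV)
qed

text \<open>A hyperplane off the origin has one normal normalised to the value 1; it links the
  normals of facets to arbitrary supporting functionals.\<close>

lemma hyperplane_eq_imp_proportional:
  fixes a w :: "'a::euclidean_space"
  assumes w: "w \<noteq> 0" and eq: "{x. x \<bullet> w = 1} = {x. x \<bullet> a = b}"
  shows "a = b *\<^sub>R w"
proof -
  define x0 where "x0 = w /\<^sub>R (w \<bullet> w)"
  have x0w: "x0 \<bullet> w = 1" using w by (simp add: x0_def)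
  then have x0a: "x0 \<bullet> a = b" using eq by blast
  \<comment> \<open>The part of \<open>a - b w\<close> orthogonal to \<open>w\<close>. It is
    parallel to the hyperplane, hence orthogonal to \<open>a\<close> as well, and it turns out to be
    all of \<open>a - b w\<close>.\<close>
  define d where "d = a - b *\<^sub>R w - ((a - b *\<^sub>R w) \<bullet> w / (w \<bullet> w)) *\<^sub>R w"
  have dw: "d \<bullet> w = 0" using w by (simp add: d_def inner_diff_left)
  then have "(x0 + d) \<bullet> w = 1" using x0w by (simp add: inner_add_left)
  then have "(x0 + d) \<bullet> a = b" using eq by blast
  then have da: "d \<bullet> a = 0" using x0a by (simp add: inner_add_left)
  have "x0 \<bullet> (a - b *\<^sub>R w) = 0" using x0a x0w by (simp add: inner_diff_right)
  then have "(a - b *\<^sub>R w) \<bullet> w = 0" using w by (simp add: x0_def inner_commute)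
  then have "d = a - b *\<^sub>R w" by (simp add: d_def)
  moreover have "d \<bullet> (a - b *\<^sub>R w) = 0" using da dw by (simp add: inner_diff_right)
  ultimately have "d \<bullet> d = 0" by simp
  then show ?thesis using \<open>d = a - b *\<^sub>R w\<close> by simp
qed

lemma affine_hull_facet_newton_hull:
  fixes V :: "(nat ^ 'n::finite) set"
  assumes V: "V \<noteq> {}" and F: "F facet_of newton_hull V" "F \<subseteq> {\<xi>. \<xi> \<bullet> w = 1}"
  shows "affine hull F = {\<xi>. \<xi> \<bullet> w = 1}" and "w \<noteq> 0"
proof -
  have Fne: "F \<noteq> {}" "aff_dim F = int CARD('n) - 1"
    using F(1) aff_dim_newton_hull[OF V] by (auto simp: facet_of_def)
  show w: "w \<noteq> 0" using F(2) Fne(1) by auto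
  have eq: "{\<xi>. \<xi> \<bullet> w = 1} = {\<xi>. w \<bullet> \<xi> = 1}" by (simp add: inner_commute)
  have aff: "affine {\<xi>. \<xi> \<bullet> w = 1}" unfolding eq by (rule affine_hyperplane)
  show "affine hull F = {\<xi>. \<xi> \<bullet> w = 1}"
  proof (rule affine_dim_equal)
    show "affine hull F \<subseteq> {\<xi>. \<xi> \<bullet> w = 1}" by (rule hull_minimal[OF F(2)]) (rule aff)
    show "aff_dim (affine hull F) = aff_dim {\<xi>. \<xi> \<bullet> w = 1}"
      unfolding eq using w Fne by (simp add: aff_dim_affine_hull aff_dim_hyperplane)
  qed (use Fne aff in auto)
qed

text \<open>The polyhedron recedes along every positive coordinate direction, on which a functional
  bounded above cannot increase.\<close>

lemma facet_newton_hull_nonpos: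
  assumes x: "x \<in> newton_hull V" and sub: "newton_hull V \<subseteq> {x. a \<bullet> x \<le> b}"
  shows "a $ i \<le> 0"
proof (rule ccontr)
  assume "\<not> a $ i \<le> 0"
  then have ai: "a $ i > 0" by simp
  define s where "s = (\<bar>b - a \<bullet> x\<bar> + 1) / a $ i"
  have "x + s *\<^sub>R axis i 1 \<in> newton_hull V"
    using ai by (intro newton_hull_add[OF x]) (auto simp: axis_def s_def)
  then have "a \<bullet> (x + s *\<^sub>R axis i 1) \<le> b" using sub by blast
  moreover have "a \<bullet> (x + s *\<^sub>R axis i 1) = a \<bullet> x + (\<bar>b - a \<bullet> x\<bar> + 1)"
    using ai by (simp add: inner_add_right inner_axis s_def)
  ultimately show False by linarith
qed

text \<open>The definition of a normal mentions only the facet. The supporting inequality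
  \<open>a x \<le> b\<close> comes from the polyhedron; uniqueness of the normal gives
  \<open>a = b w\<close>, and \<open>b < 0\<close> reverses it.\<close>

lemma facet_normal_ge:
  fixes V :: "(nat ^ 'n::finite) set"
  assumes V: "finite V" "V \<noteq> {}" and w: "w \<in> facet_normals (newton_hull V)" and x: "x \<in> newton_hull V"
  shows "1 \<le> x \<bullet> w"
proof -
  obtain F where F: "F facet_of newton_hull V" "F \<subseteq> {\<xi>. \<xi> \<bullet> w = 1}" and w0: "\<And>i. 0 \<le> w $ i"
    using w unfolding facet_normals_def by blast
  note aff = affine_hull_facet_newton_hull[OF V(2) F]
  obtain a b where ab: "a \<noteq> 0" "newton_hull V \<subseteq> {x. a \<bullet> x \<le> b}" "F = newton_hull V \<inter> {x. a \<bullet> x = b}"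
    using facet_of_polyhedron[OF polyhedron_newton_hull[OF V(1)] F(1)] by blast
  have affa: "affine hull F = {x. x \<bullet> a = b}"
  proof (rule affine_dim_equal)
    have eq: "{x. x \<bullet> a = b} = {x. a \<bullet> x = b}" by (simp add: inner_commute)
    show "affine {x. x \<bullet> a = b}" unfolding eq by (rule affine_hyperplane)
    then show "affine hull F \<subseteq> {x. x \<bullet> a = b}" using ab(3) by (intro hull_minimal) (auto simp: inner_commute)
    show "aff_dim (affine hull F) = aff_dim {x. x \<bullet> a = b}"
      using F(1) ab(1) aff_dim_newton_hull[OF V(2)] unfolding eq by (auto simp: facet_of_def)
  qed (use F(1) in \<open>auto simp: facet_of_def\<close>)
  have abw: "a = b *\<^sub>R w"
    by (rule hyperplane_eq_imp_proportional[OF aff(2) trans[OF aff(1)[symmetric] affa]])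
  obtain i where "w $ i \<noteq> 0" using aff(2) by (auto simp: vec_eq_iff)
  then have wi: "w $ i > 0" using w0[of i] by simp
  have "b < 0"
  proof -
    have "a $ i \<le> 0" by (rule facet_newton_hull_nonpos[OF x ab(2)])
    then have "b \<le> 0" using wi abw by (simp add: mult_le_0_iff)
    moreover have "b \<noteq> 0" using abw ab(1) by auto
    ultimately show ?thesis by simp
  qed
  moreover have "b * (x \<bullet> w) \<le> b * 1" using x ab(2) abw by (auto simp: inner_commute)
  ultimately show ?thesis by (simp add: mult_le_cancel_left)
qed

lemma finite_facet_normals:
  fixes V :: "(nat ^ 'n::finite) set"
  assumes V: "finite V" "V \<noteq> {}"
  shows "finite (facet_normals (newton_hull V))"
proof -
  let ?W = "facet_normals (newton_hull V)"
  have "\<exists>F. F facet_of newton_hull V \<and> F \<subseteq> {\<xi>. \<xi> \<bullet> w = 1}" if "w \<in> ?W" for w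
    using that unfolding facet_normals_def by blast
  then obtain f where f: "\<And>w. w \<in> ?W \<Longrightarrow> f w facet_of newton_hull V \<and> f w \<subseteq> {\<xi>. \<xi> \<bullet> w = 1}"
    by metis
  have "inj_on f ?W"
  proof (rule inj_onI)
    fix w w' assume ww: "w \<in> ?W" "w' \<in> ?W" "f w = f w'"
    have "{\<xi>. \<xi> \<bullet> w = 1} = {\<xi>. \<xi> \<bullet> w' = 1}" "w \<noteq> 0"
      using affine_hull_facet_newton_hull[OF V(2), of "f w" w] affine_hull_facet_newton_hull[OF V(2), of "f w" w']
        f[OF ww(1)] f[OF ww(2)] ww(3) by auto
    from hyperplane_eq_imp_proportional[OF this(2,1)] show "w = w'" by simp
  qed
  moreover have "f ` ?W \<subseteq> {F. F facet_of newton_hull V}" using f by blast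
  ultimately show ?thesis
    using finite_polyhedron_facets[OF polyhedron_newton_hull[OF V(1)]] by (metis finite_imageD finite_subset)
qed

text \<open>The sum of the coordinates is at least 1 on every nonzero exponent and does not decrease
  under adding nonnegative vectors.\<close>

lemma zero_notin_newton_hull:
  assumes V: "finite V" "0 \<notin> V" "V \<noteq> {}" and x: "x \<in> newton_hull V"
  shows "x \<noteq> 0"
proof -
  have "1 \<le> rvec v \<bullet> 1" if "v \<in> V" for v
  proof -
    have "v \<noteq> 0" using that V(2) by blast
    then obtain i where "v $ i \<noteq> 0" by (auto simp: vec_eq_iff)
    then have "1 \<le> real (v $ i)" by simp
    also have "\<dots> \<le> (\<Sum>i\<in>UNIV. real (v $ i))" by (rule member_le_sum) auto
    finally show ?thesis by (simp add: inner_vec_def)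
  qed
  then have "1 \<le> min_weight V 1" unfolding min_weight_def using V by (subst Min_ge_iff) auto
  also have "\<dots> \<le> x \<bullet> 1" by (rule newton_hull_inner_ge[OF V(1) x]) simp
  finally show ?thesis by auto
qed

section \<open>The boundary point on a ray and its smallest face\<close>

text \<open>The ray through \<open>q\<close> enters the polyhedron at the infimum \<tau> of its
  parameters, at a boundary point, hence on a facet. All coordinates of this point are positive, so
  the facet lies in no coordinate hyperplane.\<close>

lemma newton_boundary_point:
  fixes V :: "(nat ^ 'n::finite) set" and q :: "real ^ 'n"
  assumes V: "finite V" "V \<noteq> {}" "0 \<notin> V" and q: "\<And>i. 0 < q $ i"
  obtains \<tau> w where "0 < \<tau>" "\<tau> *\<^sub>R q \<in> newton_hull V" "w \<in> facet_normals (newton_hull V)" "(\<tau> *\<^sub>R q) \<bullet> w = 1"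
proof -
  let ?N = "newton_hull V"
  define T where "T = {\<tau>. 0 \<le> \<tau> \<and> \<tau> *\<^sub>R q \<in> ?N}"
  have "closed ({0..} \<inter> (\<lambda>\<tau>. \<tau> *\<^sub>R q) -` ?N)"
    by (intro closed_Int closed_atLeast continuous_closed_vimage closed_newton_hull V) (auto intro!: continuous_intros)
  then have clT: "closed T" by (simp add: T_def vimage_def Int_def)
  obtain v where v: "v \<in> V" using V by blast
  obtain \<mu> where \<mu>: "0 < \<mu>" "\<And>i. \<mu> \<le> q $ i"
    using q by (intro that[of "Min (range (($) q))"]) auto
  \<comment> \<open>Far enough along the ray for \<open>s q\<close> to dominate
    \<open>v\<close>.\<close>
  define s where "s = (\<Sum>i\<in>UNIV. real (v $ i)) / \<mu>"
  have s0: "0 \<le> s" using \<mu> by (simp add: s_def sum_nonneg)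
  have "rvec v + (s *\<^sub>R q - rvec v) \<in> ?N"
  proof (rule newton_hull_add[OF rvec_in_newton_hull[OF v]])
    fix i
    have "real (v $ i) \<le> (\<Sum>i\<in>UNIV. real (v $ i))" by (rule member_le_sum) auto
    also have "\<dots> = s * \<mu>" using \<mu> by (simp add: s_def)
    also have "\<dots> \<le> s * q $ i" using s0 \<mu> by (intro mult_left_mono) auto
    finally show "0 \<le> (s *\<^sub>R q - rvec v) $ i" by simp
  qed
  then have "s \<in> T" using s0 by (simp add: T_def)
  then have Tne: "T \<noteq> {}" by blast
  have Tb: "bdd_below T" by (auto simp: T_def bdd_below_def)
  define \<tau> where "\<tau> = Inf T"
  have \<tau>T: "\<tau> \<in> T" unfolding \<tau>_def by (rule closed_contains_Inf[OF Tne Tb clT])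
  have \<tau>0: "\<tau> > 0"
  proof -
    have "\<tau> \<noteq> 0" using \<tau>T zero_notin_newton_hull[OF V(1,3,2)] by (force simp: T_def)
    then show ?thesis using \<tau>T by (simp add: T_def)
  qed
  let ?p = "\<tau> *\<^sub>R q"
  have pN: "?p \<in> ?N" using \<tau>T by (simp add: T_def)
  have "?p \<notin> interior ?N"
  proof
    assume "?p \<in> interior ?N"
    then obtain e where e: "e > 0" "ball ?p e \<subseteq> ?N" by (auto simp: mem_interior)
    \<comment> \<open>A step back along the ray that stays inside the ball and keeps the parameter
      positive.\<close>
    define h where "h = min (\<tau> / 2) (e / (2 * (norm q + 1)))"
    have "norm q + 1 > 0" by (simp add: add_nonneg_pos)
    have h: "0 < h" "h < \<tau>" "h * (norm q + 1) \<le> e / 2"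
    proof -
      show "0 < h" "h < \<tau>" using \<open>norm q + 1 > 0\<close> e \<tau>0 by (auto simp: h_def)
      have "h \<le> (e / 2) / (norm q + 1)" by (simp add: h_def)
      then show "h * (norm q + 1) \<le> e / 2" using \<open>norm q + 1 > 0\<close> by (simp only: pos_le_divide_eq)
    qed
    have "h * norm q < e"
      using h e by (simp add: algebra_simps)
    then have "(\<tau> - h) *\<^sub>R q \<in> ball ?p e" using h by (simp add: dist_norm algebra_simps)
    then have "\<tau> - h \<in> T" using e h by (auto simp: T_def)
    then have "\<tau> \<le> \<tau> - h" unfolding \<tau>_def by (intro cInf_lower Tb)
    then show False using h by simp
  qed
  then have "?p \<in> rel_frontier ?N"
    unfolding rel_frontier_nonempty_interior[OF interior_newton_hull_nonempty[OF V(2)]]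
    using pN closure_subset by (auto simp: frontier_def)
  then obtain F where F: "F facet_of ?N" "?p \<in> F"
    unfolding rel_frontier_of_polyhedron[OF polyhedron_newton_hull[OF V(1)]] by blast
  obtain a b where ab: "a \<noteq> 0" "?N \<subseteq> {x. a \<bullet> x \<le> b}" "F = ?N \<inter> {x. a \<bullet> x = b}"
    using facet_of_polyhedron[OF polyhedron_newton_hull[OF V(1)] F(1)] by blast
  have a0: "a $ i \<le> 0" for i by (rule facet_newton_hull_nonpos[OF pN ab(2)])
  have "b < 0"
  proof -
    obtain i where "a $ i \<noteq> 0" using ab(1) by (metis vec_eq_iff zero_index)
    then have "a $ i < 0" using a0[of i] by simp
    then have "(\<Sum>i\<in>UNIV. a $ i * ?p $ i) < (\<Sum>i\<in>(UNIV :: 'n set). 0)"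
      using a0 q \<tau>0 by (intro sum_strict_mono_ex1) (auto simp: mult_le_0_iff mult_less_0_iff less_imp_le)
    then have "a \<bullet> ?p < 0" by (simp add: inner_vec_def)
    then show ?thesis using F(2) ab(3) by auto
  qed
  \<comment> \<open>Both \<open>b\<close> and the entries of \<open>a\<close> are nonpositive, so
    the quotient is a nonnegative normal with value 1 on \<open>F\<close>.\<close>
  define w where "w = a /\<^sub>R b"
  have wF: "F \<subseteq> {\<xi>. \<xi> \<bullet> w = 1}" using ab(3) \<open>b < 0\<close> by (auto simp: w_def inner_commute)
  have "w \<in> facet_normals ?N"
    unfolding facet_normals_def
  proof (intro CollectI conjI allI exI[of _ F])
    show "0 \<le> w $ i" for i using a0[of i] \<open>b < 0\<close> by (simp add: w_def mult_nonpos_nonpos)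
    show "\<not> (\<exists>j. F \<subseteq> {\<xi>. \<xi> $ j = 0})"
    proof
      assume "\<exists>j. F \<subseteq> {\<xi>. \<xi> $ j = 0}"
      then obtain j where "?p $ j = 0" using F(2) by blast
      then show False using q[of j] \<tau>0 by simp
    qed
  qed (use F wF in auto)
  moreover have "?p \<bullet> w = 1" using wF F(2) by blast
  ultimately show thesis using that \<tau>0 pN by blast
qed

text \<open>If \<open>p\<close> were on the relative boundary of a face of maximal codimension, it
  would lie on a facet of that face, whose codimension is larger by one.\<close>

lemma max_codim_attained:
  fixes N :: "(real ^ 'n::finite) set"
  assumes N: "polyhedron N" and p: "p \<in> N"
  obtains F where "F face_of N" "p \<in> rel_interior F" "max_codim N p = nat (int CARD('n) - aff_dim F)"
proof -
  let ?g = "\<lambda>F. nat (int CARD('n) - aff_dim F)"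
  let ?A = "{F. F face_of N \<and> p \<in> F}"
  have fin: "finite ?A" using finite_polyhedron_faces[OF N] by (rule finite_subset[rotated]) blast
  have "N \<in> ?A" using p polyhedron_imp_convex[OF N] by (simp add: face_of_refl)
  then have ne: "?A \<noteq> {}" by blast
  have "max_codim N p \<in> ?g ` ?A" unfolding max_codim_def using fin ne by (intro Max_in) auto
  then obtain F where F: "F face_of N" "p \<in> F" "max_codim N p = ?g F" by blast
  have "p \<in> rel_interior F"
  proof (rule ccontr)
    assume "p \<notin> rel_interior F"
    moreover have pF: "polyhedron F" by (rule face_of_polyhedron_polyhedron[OF N F(1)])
    ultimately obtain G where G: "G facet_of F" "p \<in> G"
      using rel_boundary_of_polyhedron[OF pF] F(2) by blast
    have "G face_of N" using G F(1) face_of_trans by (auto simp: facet_of_def)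
    then have "?g G \<le> ?g F"
      unfolding F(3)[symmetric] max_codim_def using fin G(2) by (intro Max_ge) auto
    moreover have "aff_dim G = aff_dim F - 1" using G(1) by (simp add: facet_of_def)
    moreover have "aff_dim F \<le> int CARD('n)" using aff_dim_le_DIM[of F] by simp
    ultimately show False by linarith
  qed
  then show thesis using that F by blast
qed

text \<open>A basis of the direction space of \<open>F\<close>, scaled until both
  \<open>p + u\<close> and \<open>p - u\<close> stay in the ball around \<open>p\<close> whose trace
  on the affine hull belongs to \<open>F\<close>.\<close>

lemma rel_interior_directions:
  fixes F :: "'a::euclidean_space set"
  assumes p: "p \<in> rel_interior F"
  obtains D where "independent D" "int (card D) = aff_dim F" "\<And>u. u \<in> D \<Longrightarrow> p + u \<in> F \<and> p - u \<in> F"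
proof -
  obtain e where e: "p \<in> F" "e > 0" "ball p e \<inter> affine hull F \<subseteq> F"
    using p unfolding mem_rel_interior_ball by blast
  have pa: "p \<in> affine hull F" using e(1) by (rule hull_inc)
  have "\<exists>B. B \<subseteq> (+) (- p) ` F \<and> independent B \<and> card B = dim ((+) (- p) ` F)"
    by (rule basis_exists[of "(+) (- p) ` F"]) auto
  then obtain B where B: "B \<subseteq> (+) (- p) ` F" "independent B" "card B = dim ((+) (- p) ` F)"
    by (elim exE conjE)
  have fB: "finite B" using independent_imp_finite[OF B(2)] .
  \<comment> \<open>The summand 1 makes \<open>R\<close> strictly larger than every norm, and
    positive even for empty \<open>B\<close>.\<close>
  define R where "R = (\<Sum>b\<in>B. norm b) + 1"
  have R: "norm b < R" if "b \<in> B" for b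
    using member_le_sum[OF that, of norm] fB by (simp add: R_def)
  have R0: "0 < R" by (simp add: R_def add_nonneg_pos sum_nonneg)
  define h where "h = e / R"
  have h: "0 < h" using e R0 by (simp add: h_def)
  have key: "p + s *\<^sub>R b \<in> F" if b: "b \<in> B" and s: "\<bar>s\<bar> = h" for s b
  proof -
    have "p + b \<in> F" using B(1) b by auto
    then have "p + b \<in> affine hull F" by (rule hull_inc)
    then have "(1 - s) *\<^sub>R p + s *\<^sub>R (p + b) \<in> affine hull F"
      using pa by (intro mem_affine[OF affine_affine_hull]) auto
    moreover have "(1 - s) *\<^sub>R p + s *\<^sub>R (p + b) = p + s *\<^sub>R b" by (simp add: algebra_simps)
    moreover have "p + s *\<^sub>R b \<in> ball p e"
    proof -
      have "h * norm b < h * R" using R[OF b] h by simp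
      also have "\<dots> = e" using R0 by (simp add: h_def)
      finally show ?thesis using s by (simp add: dist_norm)
    qed
    ultimately show ?thesis using e(3) by auto
  qed
  show thesis
  proof (rule that)
    have inj: "inj_on ((*\<^sub>R) h) B" using h by (simp add: inj_on_def)
    show "independent ((*\<^sub>R) h ` B)"
      using linear_independent_injective_image[OF linear_scaleR B(2)] h by (simp add: inj_on_def inj_def)
    show "int (card ((*\<^sub>R) h ` B)) = aff_dim F"
      using card_image[OF inj] B(3) aff_dim_eq_dim[OF pa] by simp
    fix u assume "u \<in> (*\<^sub>R) h ` B"
    then obtain b where b: "b \<in> B" "u = h *\<^sub>R b" by blast
    show "p + u \<in> F \<and> p - u \<in> F" using key[OF b(1), of h] key[OF b(1), of "- h"] h b(2) by simp
  qed
qed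

text \<open>The interface between convex geometry and the lattice sum. \<open>D\<close> spans the
  directions of the smallest face through \<open>p\<close>; since \<open>p + u\<close> and
  \<open>p - u\<close> both lie in the polyhedron, the support function is below
  \<open>p \<bullet> t\<close> by at least \<open>|u \<bullet> t|\<close>.\<close>

lemma newton_floor_geometry:
  fixes V :: "(nat ^ 'n::finite) set" and \<beta> :: "nat ^ 'n"
  assumes V: "finite V" "V \<noteq> {}" "0 \<notin> V"
  defines "N \<equiv> newton_hull V" and "c \<equiv> newton_floor (newton_hull V) (\<beta> + 1)"
  shows "0 < c" and "\<exists>p D. rvec (\<beta> + 1) = c *\<^sub>R p \<and> independent (insert p D) \<and> p \<notin> D
     \<and> (\<forall>t. (\<forall>i. 0 \<le> t $ i) \<longrightarrow> min_weight V t \<le> p \<bullet> t)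
     \<and> (\<forall>t. \<forall>u\<in>D. (\<forall>i. 0 \<le> t $ i) \<longrightarrow> min_weight V t \<le> p \<bullet> t - \<bar>u \<bullet> t\<bar>)
     \<and> CARD('n) - (card D + 1) = newton_log_index N \<beta> - 1"
proof -
  let ?q = "rvec (\<beta> + 1) :: real ^ 'n"
  let ?W = "facet_normals N"
  obtain \<tau> w where \<tau>: "0 < \<tau>" "\<tau> *\<^sub>R ?q \<in> N" and w: "w \<in> ?W" "(\<tau> *\<^sub>R ?q) \<bullet> w = 1"
    using newton_boundary_point[OF V, of ?q] unfolding N_def by auto
  have finW: "finite ?W" unfolding N_def by (rule finite_facet_normals[OF V(1,2)])
  \<comment> \<open>The facet hit by the ray gives the value \<open>1/\<tau>\<close>, and every
    other normal at least that much.\<close>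
  have "Min ((\<lambda>w. ?q \<bullet> w) ` ?W) = 1 / \<tau>"
  proof (rule Min_eqI)
    show "1 / \<tau> \<le> y" if "y \<in> (\<lambda>w. ?q \<bullet> w) ` ?W" for y
    proof -
      from that obtain w' where w': "w' \<in> ?W" "y = ?q \<bullet> w'" by blast
      have "1 \<le> (\<tau> *\<^sub>R ?q) \<bullet> w'"
        using facet_normal_ge[OF V(1,2)] w'(1) \<tau>(2) unfolding N_def by blast
      then show ?thesis using \<tau>(1) w'(2) by (simp add: pos_divide_le_eq mult.commute)
    qed
    show "1 / \<tau> \<in> (\<lambda>w. ?q \<bullet> w) ` ?W"
      using w \<tau>(1) by (intro image_eqI[of _ _ w]) (auto simp: field_simps)
  qed (use finW in simp)
  then have c: "c = 1 / \<tau>" using w(1) unfolding c_def newton_floor_def N_def by auto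
  show "0 < c" using \<tau>(1) c by simp
  define p where "p = \<tau> *\<^sub>R ?q"
  have qp: "?q = c *\<^sub>R p" using \<tau>(1) by (simp add: p_def c)
  have p_eq: "p = ?q /\<^sub>R c" using \<tau>(1) by (simp add: p_def c)
  have pN: "p \<in> N" using \<tau>(2) by (simp add: p_def)
  have polN: "polyhedron N" unfolding N_def by (rule polyhedron_newton_hull[OF V(1)])
  obtain F where F: "F face_of N" "p \<in> rel_interior F" "max_codim N p = nat (int CARD('n) - aff_dim F)"
    using max_codim_attained[OF polN pN] by blast
  obtain D where D: "independent D" "int (card D) = aff_dim F" "\<And>u. u \<in> D \<Longrightarrow> p + u \<in> F \<and> p - u \<in> F"
    using rel_interior_directions[OF F(2)] by blast
  have DN: "p + u \<in> N \<and> p - u \<in> N" if "u \<in> D" for u using D(3)[OF that] face_of_imp_subset[OF F(1)] by blast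
  have ge: "1 \<le> x \<bullet> w" if "x \<in> N" for x
    using facet_normal_ge[OF V(1,2)] w(1) that unfolding N_def by blast
  have pw: "p \<bullet> w = 1" using w(2) by (simp add: p_def)
  \<comment> \<open>\<open>w\<close> is at least 1 on the polyhedron and equals 1 at
    \<open>p\<close>, so it cannot change along a direction that is admissible both ways. Thus
    \<open>w\<close> separates \<open>p\<close> from \<open>span D\<close>.\<close>
  have uw: "w \<bullet> u = 0" if "u \<in> D" for u
  proof -
    have "1 \<le> p \<bullet> w + u \<bullet> w" "1 \<le> p \<bullet> w - u \<bullet> w"
      using ge[of "p + u"] ge[of "p - u"] DN[OF that] by (simp_all only: inner_add_left inner_diff_left)
    then show ?thesis using pw by (simp add: inner_commute)
  qed
  have "p \<notin> span D"
  proof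
    assume "p \<in> span D"
    then have "orthogonal w p" by (rule orthogonal_to_span) (use uw in \<open>simp add: orthogonal_def\<close>)
    then show False using pw by (simp add: orthogonal_def inner_commute)
  qed
  then have "independent (insert p D)" "p \<notin> D"
    using D(1) span_base by (auto simp: independent_insert)
  moreover have "min_weight V t \<le> p \<bullet> t" if "\<forall>i. 0 \<le> t $ i" for t
    using newton_hull_inner_ge[OF V(1)] pN that unfolding N_def by blast
  moreover have "min_weight V t \<le> p \<bullet> t - \<bar>u \<bullet> t\<bar>" if "u \<in> D" "\<forall>i. 0 \<le> t $ i" for t u
  proof -
    have "min_weight V t \<le> (p + u) \<bullet> t" "min_weight V t \<le> (p - u) \<bullet> t"
      using newton_hull_inner_ge[OF V(1)] DN[OF that(1)] that(2) unfolding N_def by blast+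
    then show ?thesis by (simp add: inner_add_left inner_diff_left abs_if)
  qed
  \<comment> \<open>\<open>card D\<close> is the dimension of the face; the further 1 is the
    direction \<open>p\<close>, in which there is decay as well.\<close>
  moreover have "CARD('n) - (card D + 1) = newton_log_index N \<beta> - 1"
    using F(3) D(2) unfolding newton_log_index_def p_eq c_def N_def by simp
  ultimately show "\<exists>p D. ?q = c *\<^sub>R p \<and> independent (insert p D) \<and> p \<notin> D
     \<and> (\<forall>t. (\<forall>i. 0 \<le> t $ i) \<longrightarrow> min_weight V t \<le> p \<bullet> t)
     \<and> (\<forall>t. \<forall>u\<in>D. (\<forall>i. 0 \<le> t $ i) \<longrightarrow> min_weight V t \<le> p \<bullet> t - \<bar>u \<bullet> t\<bar>)
     \<and> CARD('n) - (card D + 1) = newton_log_index N \<beta> - 1"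
    using qp by blast
qed


subsection \<open>The gradient of a nondegenerate series\<close>

lemma finite_family_convergent_subseq:
  fixes b :: "'v \<Rightarrow> nat \<Rightarrow> real"
  assumes "finite V" "\<And>v n. v \<in> V \<Longrightarrow> \<bar>b v n\<bar> \<le> 1"
  shows "\<exists>r :: nat \<Rightarrow> nat. strict_mono r \<and> (\<forall>v\<in>V. convergent (\<lambda>n. b v (r n)))"
  using assms
proof (induction V)
    case empty
    show ?case by (intro exI[of _ id]) (auto simp: strict_mono_def)
  next
    case (insert v V)
    then obtain r :: "nat \<Rightarrow> nat" where r: "strict_mono r" "\<forall>v\<in>V. convergent (\<lambda>n. b v (r n))" by auto
    have "bounded (range (\<lambda>n. b v (r n)))"
      using insert.prems unfolding bounded_iff by (intro exI[of _ 1]) auto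
    then obtain l s where s: "strict_mono s" "((\<lambda>n. b v (r n)) \<circ> s) \<longlonglongrightarrow> l"
      using bounded_imp_convergent_subsequence[of "\<lambda>n. b v (r n)"] by auto
    show ?case
    proof (intro exI[of _ "r \<circ> s"] conjI ballI)
      show "strict_mono (r \<circ> s)" using r(1) s(1) by (rule strict_mono_o)
      fix u assume "u \<in> insert v V"
      then show "convergent (\<lambda>n. b u ((r \<circ> s) n))"
      proof
        assume "u = v"
        then show ?thesis using s(2) by (auto simp: convergent_def o_def)
      next
        assume "u \<in> V"
        then have "convergent ((\<lambda>n. b u (r n)) \<circ> s)"
          using r(2) s(1) convergent_subseq_convergent by blast
        then show ?thesis by (simp add: o_def)
      qed
    qed
qed

lemma mpow_exp:
  assumes "\<And>i. x $ i \<noteq> 0"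
  shows "\<bar>mpow x \<alpha>\<bar> = exp (- (rvec \<alpha> \<bullet> (\<chi> i. - ln \<bar>x $ i\<bar>)))"
proof -
  have "\<bar>mpow x \<alpha>\<bar> = (\<Prod>i\<in>UNIV. exp (real (\<alpha> $ i) * ln \<bar>x $ i\<bar>))"
    using assms by (simp add: mpow_def abs_prod power_abs exp_of_nat_mult)
  also have "\<dots> = exp (\<Sum>i\<in>UNIV. real (\<alpha> $ i) * ln \<bar>x $ i\<bar>)" by (simp add: exp_sum)
  finally show ?thesis by (simp add: inner_vec_def sum_negf)
qed

lemma mpow_nonzero: "(\<And>i. x $ i \<noteq> 0) \<Longrightarrow> mpow x \<alpha> \<noteq> 0"
  by (simp add: mpow_def)

lemma psum_add:
  assumes "ps_conv R c" "ps_conv R d" "\<And>i. \<bar>x $ i\<bar> < R"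
  shows "psum (\<lambda>\<alpha>. c \<alpha> + d \<alpha>) x = psum c x + psum d x"
  unfolding psum_def distrib_right
  by (rule infsum_add[OF ps_conv_has_sum(1)[OF assms(1,3)] ps_conv_has_sum(1)[OF assms(2,3)]])

lemma psum_finite:
  assumes "finite A" "\<And>\<alpha>. \<alpha> \<notin> A \<Longrightarrow> c \<alpha> = 0"
  shows "psum c x = (\<Sum>\<alpha>\<in>A. c \<alpha> * mpow x \<alpha>)"
proof -
  have "psum c x = infsum (\<lambda>\<alpha>. c \<alpha> * mpow x \<alpha>) A"
    unfolding psum_def by (rule infsum_cong_neutral) (use assms(2) in auto)
  then show ?thesis using assms(1) by simp
qed

lemma ps_conv_mono:
  assumes "ps_conv R c" "\<And>\<alpha>. \<bar>d \<alpha>\<bar> \<le> \<bar>c \<alpha>\<bar>"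
  shows "ps_conv R d"
  unfolding ps_conv_def
proof (intro allI impI)
  fix r assume r: "0 < r" "r < R"
  have "(\<lambda>\<alpha>. \<bar>c \<alpha>\<bar> * r ^ vsize \<alpha>) summable_on UNIV" using assms(1) r by (simp add: ps_conv_def)
  then show "(\<lambda>\<alpha>. \<bar>d \<alpha>\<bar> * r ^ vsize \<alpha>) summable_on UNIV"
  proof (rule summable_on_comparison_test)
    show "\<bar>d \<alpha>\<bar> * r ^ vsize \<alpha> \<le> \<bar>c \<alpha>\<bar> * r ^ vsize \<alpha>" for \<alpha>
      using assms(2) r by (intro mult_right_mono) auto
  qed (use r in auto)
qed

lemma continuous_on_mpow [continuous_intros]: "continuous_on S (\<lambda>x. mpow x \<alpha>)"
  unfolding mpow_def by (intro continuous_intros)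

text \<open>The exponents \<open>t n\<close> split into a bounded part in the span of the differences of the
  active monomials and a part orthogonal to them; far out the latter is a positive covector that
  selects exactly the active monomials.\<close>

lemma eventually_orthogonal_part_selects:
  fixes t :: "nat \<Rightarrow> real ^ 'n::finite" and V V1 :: "(nat ^ 'n) set"
  assumes V: "finite V" "V1 \<subseteq> V" "v0 \<in> V1"
    and t: "\<And>i. filterlim (\<lambda>n. t n $ i) at_top sequentially"
    and bd: "\<And>v. v \<in> V1 \<Longrightarrow> \<exists>K. \<forall>n. \<bar>(rvec v - rvec v0) \<bullet> t n\<bar> \<le> K"
    and unbd: "\<And>v. v \<in> V - V1 \<Longrightarrow> filterlim (\<lambda>n. (rvec v - rvec v0) \<bullet> t n) at_top sequentially"
  shows "\<exists>s K. (\<forall>n. norm (s n) \<le> K) \<and> (\<forall>n. \<forall>v\<in>V1. (rvec v - rvec v0) \<bullet> (t n - s n) = 0) \<and>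
    eventually (\<lambda>n. (\<forall>i. 0 < (t n - s n) $ i) \<and> (\<forall>v\<in>V - V1. 0 < (rvec v - rvec v0) \<bullet> (t n - s n))) sequentially"
proof -
  define B where "B = (\<lambda>v. rvec v - rvec v0) ` V1"
  have fB: "finite B" unfolding B_def using V finite_subset by blast
  have "\<exists>y. y \<in> span B \<and> (\<forall>b\<in>B. b \<bullet> (t n - y) = 0)" for n
  proof -
    obtain y z where "y \<in> span B" "\<And>w. w \<in> span B \<Longrightarrow> orthogonal z w" "t n = y + z"
      using orthogonal_subspace_decomp_exists[of B "t n"] by metis
    then show ?thesis
      by (intro exI[of _ y]) (auto simp: orthogonal_def inner_commute dest: span_base)
  qed
  then obtain s where s: "\<And>n. s n \<in> span B" "\<And>n b. b \<in> B \<Longrightarrow> b \<bullet> (t n - s n) = 0" by metis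
  obtain \<delta> where \<delta>: "\<delta> > 0" "\<And>x. x \<in> span B \<Longrightarrow> \<delta> * norm x \<le> (\<Sum>b\<in>B. \<bar>b \<bullet> x\<bar>)"
    using span_norm_lower_bound[OF fB] by metis
  have "\<forall>b\<in>B. \<exists>K. \<forall>n. \<bar>b \<bullet> t n\<bar> \<le> K" unfolding B_def using bd by blast
  then obtain K where K: "\<And>b n. b \<in> B \<Longrightarrow> \<bar>b \<bullet> t n\<bar> \<le> K b" by metis
  \<comment> \<open>\<open>s n\<close> and \<open>t n\<close> have the same pairings with
    \<open>B\<close>, which are bounded, and on \<open>span B\<close> these pairings control the
    norm.\<close>
  have sK: "norm (s n) \<le> (\<Sum>b\<in>B. K b) / \<delta>" for n
  proof -
    have "(\<Sum>b\<in>B. \<bar>b \<bullet> s n\<bar>) \<le> (\<Sum>b\<in>B. K b)"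
    proof (rule sum_mono)
      fix b assume b: "b \<in> B"
      have "b \<bullet> s n = b \<bullet> t n" using s(2)[OF b, of n] by (simp add: inner_diff_right)
      then show "\<bar>b \<bullet> s n\<bar> \<le> K b" using K[OF b] by simp
    qed
    then have "\<delta> * norm (s n) \<le> (\<Sum>b\<in>B. K b)" using \<delta>(2)[OF s(1)] by (rule order_trans[rotated])
    then show ?thesis using \<delta>(1) by (simp add: pos_le_divide_eq mult.commute)
  qed
  define L where "L = (\<Sum>b\<in>B. K b) / \<delta>"
  have ev1: "eventually (\<lambda>n. \<forall>i\<in>UNIV. 0 < (t n - s n) $ i) sequentially"
  proof (rule eventually_ball_finite)
    show "\<forall>i\<in>UNIV. \<forall>\<^sub>F n in sequentially. 0 < (t n - s n) $ i"
    proof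
      fix i
      have "\<forall>\<^sub>F n in sequentially. L < t n $ i" using t[of i] by (simp add: filterlim_at_top_dense)
      then show "\<forall>\<^sub>F n in sequentially. 0 < (t n - s n) $ i"
      proof (rule eventually_mono)
        fix n assume "L < t n $ i"
        moreover have "\<bar>s n $ i\<bar> \<le> L" using component_le_norm_cart[of "s n" i] sK[of n] by (simp add: L_def)
        ultimately show "0 < (t n - s n) $ i" by simp
      qed
    qed
  qed simp
  have ev2: "eventually (\<lambda>n. \<forall>v\<in>V - V1. 0 < (rvec v - rvec v0) \<bullet> (t n - s n)) sequentially"
  proof (rule eventually_ball_finite)
    show "\<forall>v\<in>V - V1. \<forall>\<^sub>F n in sequentially. 0 < (rvec v - rvec v0) \<bullet> (t n - s n)"
    proof
      fix v assume v: "v \<in> V - V1"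
      have "\<forall>\<^sub>F n in sequentially. norm (rvec v - rvec v0) * L < (rvec v - rvec v0) \<bullet> t n"
        using unbd[OF v] by (simp add: filterlim_at_top_dense)
      then show "\<forall>\<^sub>F n in sequentially. 0 < (rvec v - rvec v0) \<bullet> (t n - s n)"
      proof (rule eventually_mono)
        fix n assume n: "norm (rvec v - rvec v0) * L < (rvec v - rvec v0) \<bullet> t n"
        have "(rvec v - rvec v0) \<bullet> s n \<le> norm (rvec v - rvec v0) * norm (s n)" by (rule norm_cauchy_schwarz)
        also have "\<dots> \<le> norm (rvec v - rvec v0) * L"
          using sK[of n] by (intro mult_left_mono) (auto simp: L_def)
        finally show "0 < (rvec v - rvec v0) \<bullet> (t n - s n)" using n by (simp add: inner_diff_right)
      qed
    qed
  qed (use V in simp)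
  show ?thesis
  proof (intro exI[of _ s] exI[of _ L] conjI allI ballI)
    show "norm (s n) \<le> L" for n using sK by (simp add: L_def)
    show "(rvec v - rvec v0) \<bullet> (t n - s n) = 0" if "v \<in> V1" for n v using s(2) that by (simp add: B_def)
    show "eventually (\<lambda>n. (\<forall>i. 0 < (t n - s n) $ i) \<and> (\<forall>v\<in>V - V1. 0 < (rvec v - rvec v0) \<bullet> (t n - s n))) sequentially"
      using eventually_conj[OF ev1 ev2] by simp
  qed
qed

text \<open>The region is compact, contains all sign patterns and avoids the coordinate hyperplanes,
  so the continuous positive sum has a positive minimum.\<close>

lemma face_sum_lower_bound:
  fixes V1 :: "(nat ^ 'n::finite) set"
  assumes nd: "\<And>y. (\<And>i. y $ i \<noteq> 0) \<Longrightarrow> \<exists>i. (\<Sum>\<alpha>\<in>V1. real (\<alpha> $ i) * c \<alpha> * mpow y \<alpha>) \<noteq> 0"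
  shows "\<exists>\<delta>>0. \<forall>y. (\<forall>i. exp (- K) \<le> \<bar>y $ i\<bar> \<and> \<bar>y $ i\<bar> \<le> exp K) \<longrightarrow>
    \<delta> \<le> (\<Sum>i\<in>UNIV. \<bar>\<Sum>\<alpha>\<in>V1. real (\<alpha> $ i) * c \<alpha> * mpow y \<alpha>\<bar>)"
proof -
  let ?S = "{y :: real ^ 'n. \<forall>i. exp (- K) \<le> \<bar>y $ i\<bar> \<and> \<bar>y $ i\<bar> \<le> exp K}"
  let ?f = "\<lambda>y. \<Sum>i\<in>UNIV. \<bar>\<Sum>\<alpha>\<in>V1. real (\<alpha> $ i) * c \<alpha> * mpow y \<alpha>\<bar>"
  have "closed ?S"
    by (intro closed_Collect_all closed_Collect_conj closed_Collect_le continuous_intros)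
  moreover have "bounded ?S"
  proof -
    have "?S \<subseteq> cbox (\<chi> i. - exp K) (\<chi> i. exp K)" by (auto simp: mem_box_cart abs_le_iff minus_le_iff)
    then show ?thesis using bounded_cbox bounded_subset by blast
  qed
  ultimately have cS: "compact ?S" by (simp add: compact_eq_bounded_closed)
  have pos: "0 < ?f y" if y: "y \<in> ?S" for y
  proof -
    have "y $ i \<noteq> 0" for i
    proof -
      have "exp (- K) \<le> \<bar>y $ i\<bar>" using y by blast
      then show ?thesis using exp_gt_zero[of "- K"] by force
    qed
    then obtain i where "(\<Sum>\<alpha>\<in>V1. real (\<alpha> $ i) * c \<alpha> * mpow y \<alpha>) \<noteq> 0" using nd by blast
    then show ?thesis by (intro sum_pos2[of UNIV i]) auto
  qed
  have "\<exists>\<delta>>0. \<forall>y\<in>?S. \<delta> \<le> ?f y"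
  proof (cases "?S = {}")
    case False
    have "continuous_on ?S ?f" by (intro continuous_intros)
    from continuous_attains_inf[OF cS False this] show ?thesis using pos by blast
  next
    case True
    show ?thesis unfolding True by (intro exI[of _ 1]) simp
  qed
  then show ?thesis by blast
qed

text \<open>Moves a counterexample to an open condition off the coordinate hyperplanes, where
  logarithms of the coordinates exist.\<close>

lemma nonzero_witness:
  fixes S :: "(real ^ 'n::finite) set"
  assumes "open S" "x \<in> S"
  shows "\<exists>y\<in>S. \<forall>i. y $ i \<noteq> 0"
proof -
  obtain e where e: "e > 0" "ball x e \<subseteq> S" using assms open_contains_ball by blast
  define h where "h = e / (2 * real CARD('n))"
  have h: "h > 0" using e by (simp add: h_def)
  define z where "z = (\<chi> i. if x $ i = 0 then h else 0)"
  have "norm z \<le> (\<Sum>i\<in>UNIV. \<bar>z $ i\<bar>)" by (rule norm_le_l1_cart)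
  also have "\<dots> \<le> (\<Sum>i\<in>(UNIV :: 'n set). h)" using h by (intro sum_mono) (simp add: z_def)
  also have "\<dots> = e / 2" by (simp add: h_def)
  finally have "x + z \<in> ball x e" using e by (simp add: dist_norm)
  then have "x + z \<in> S" using e by blast
  moreover have "(x + z) $ i \<noteq> 0" for i using h by (simp add: z_def)
  ultimately show ?thesis by blast
qed

lemma continuous_on_psum:
  assumes "ps_conv R c" "\<And>x i. x \<in> S \<Longrightarrow> \<bar>x $ i\<bar> < R"
  shows "continuous_on S (psum c)"
proof (rule continuous_at_imp_continuous_on, rule ballI)
  fix x assume "x \<in> S"
  then show "isCont (psum c) x"
    using psum_has_derivative(1)[OF assms(1), of x] assms(2) differentiable_imp_continuous_within by blast
qed

text \<open>No limit of rescaled points is taken. The sequence yields a set \<open>V1\<close> of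
  comparable dominant monomials, on which removing a common exponential factor leaves points in a
  fixed compact region. There the face part is bounded below, whereas the assumed violation and the
  smallness of all other terms force it to be \<open>o(a n)\<close>.\<close>

lemma psum_gradient_lower_bound:
  fixes c :: "nat ^ 'n::finite \<Rightarrow> real"
  assumes c: "ps_conv R c" "0 < R" and V: "finite V"
    and dom: "\<And>\<alpha>. c \<alpha> \<noteq> 0 \<Longrightarrow> \<exists>v\<in>V. \<forall>i. v $ i \<le> \<alpha> $ i"
    and nd: "\<And>\<omega> y. (\<And>i. 0 < \<omega> $ i) \<Longrightarrow> (\<And>i. y $ i \<noteq> 0) \<Longrightarrow> V \<noteq> {} \<Longrightarrow>
      \<exists>i. (\<Sum>\<alpha>\<in>{v\<in>V. rvec v \<bullet> \<omega> = min_weight V \<omega>}. real (\<alpha> $ i) * c \<alpha> * mpow y \<alpha>) \<noteq> 0"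
  shows "\<exists>r>0. \<exists>\<delta>>0. r < R \<and> (\<forall>x. (\<forall>i. \<bar>x $ i\<bar> < r) \<longrightarrow>
      \<delta> * monomial_weight V x \<le> (\<Sum>i\<in>UNIV. \<bar>psum (\<lambda>\<alpha>. real (\<alpha> $ i) * c \<alpha>) x\<bar>))"
proof (rule ccontr)
  let ?D = "\<lambda>i x. psum (\<lambda>\<alpha>. real (\<alpha> $ i) * c \<alpha>) x"
  let ?G = "\<lambda>x. \<Sum>i\<in>UNIV. \<bar>?D i x\<bar>"
  let ?w = "monomial_weight V"
  assume "\<not> ?thesis"
  then have neg: "\<exists>x. (\<forall>i. \<bar>x $ i\<bar> < r) \<and> ?G x < \<delta> * ?w x" if "0 < r" "r < R" "0 < \<delta>" for r \<delta>
    using that by (meson not_le)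
  \<comment> \<open>The violated inequality is strict, hence an open condition.\<close>
  have ex: "\<exists>x. (\<forall>i. \<bar>x $ i\<bar> < r) \<and> ?G x < \<delta> * ?w x \<and> (\<forall>i. x $ i \<noteq> 0)" if r: "0 < r" "r < R" "0 < \<delta>" for r \<delta>
  proof -
    let ?P = "{x :: real ^ 'n. \<forall>i. \<bar>x $ i\<bar> < r}"
    have "?P = box (\<chi> i. - r) (\<chi> i. r)" by (auto simp: mem_box_cart abs_less_iff minus_less_iff)
    then have oP: "open ?P" using open_box by simp
    have "continuous_on ?P (\<lambda>x. \<delta> * ?w x - ?G x)"
      unfolding monomial_weight_def using r
      by (intro continuous_intros continuous_on_psum[OF ps_conv_mult[OF c(1)]]) (auto intro: less_trans)
    then have "open ((\<lambda>x. \<delta> * ?w x - ?G x) -` {0<..} \<inter> ?P)"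
      by (intro continuous_on_open_vimage[THEN iffD1, rule_format, OF oP]) auto
    moreover from neg[OF r] obtain x where "x \<in> (\<lambda>x. \<delta> * ?w x - ?G x) -` {0<..} \<inter> ?P" by auto
    ultimately have "\<exists>y \<in> (\<lambda>x. \<delta> * ?w x - ?G x) -` {0<..} \<inter> ?P. \<forall>i. y $ i \<noteq> 0"
      by (rule nonzero_witness)
    then show ?thesis by auto
  qed
  define \<rho> where "\<rho> n = min 1 R / real (n + 2)" for n
  have \<rho>: "0 < \<rho> n" "\<rho> n < R" "\<rho> n < 1" for n
  proof -
    have "min 1 R / real (n + 2) < min 1 R / 1" using c(2) by (intro divide_strict_left_mono) auto
    then show "\<rho> n < R" "\<rho> n < 1" by (auto simp: \<rho>_def)
    show "0 < \<rho> n" using c(2) by (simp add: \<rho>_def)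
  qed
  have "\<forall>n. \<exists>x. (\<forall>i. \<bar>x $ i\<bar> < \<rho> n) \<and> ?G x < inverse (real (Suc n)) * ?w x \<and> (\<forall>i. x $ i \<noteq> 0)"
    by (intro allI ex \<rho>) simp
  then obtain X where "\<forall>n. (\<forall>i. \<bar>X n $ i\<bar> < \<rho> n) \<and> ?G (X n) < inverse (real (Suc n)) * ?w (X n) \<and> (\<forall>i. X n $ i \<noteq> 0)"
    by (rule choice[THEN exE])
  then have X: "\<bar>X n $ i\<bar> < \<rho> n" "?G (X n) < inverse (real (Suc n)) * ?w (X n)" "X n $ i \<noteq> 0" for n i
    by blast+
  have Vne: "V \<noteq> {}"
  proof
    assume "V = {}"
    then have "?G (X 0) < 0" using X(2)[of 0] by (simp add: monomial_weight_def)
    moreover have "0 \<le> ?G (X 0)" by (intro sum_nonneg) auto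
    ultimately show False by simp
  qed
  have "\<exists>v\<in>V. \<forall>u\<in>V. \<bar>mpow (X n) u\<bar> \<le> \<bar>mpow (X n) v\<bar>" for n
  proof -
    have "Max ((\<lambda>v. \<bar>mpow (X n) v\<bar>) ` V) \<in> (\<lambda>v. \<bar>mpow (X n) v\<bar>) ` V" using V Vne by (intro Max_in) auto
    then obtain v where "v \<in> V" "Max ((\<lambda>v. \<bar>mpow (X n) v\<bar>) ` V) = \<bar>mpow (X n) v\<bar>" by blast
    moreover have "\<bar>mpow (X n) u\<bar> \<le> Max ((\<lambda>v. \<bar>mpow (X n) v\<bar>) ` V)" if "u \<in> V" for u
      using V that by (intro Max_ge) auto
    ultimately show ?thesis by (intro bexI[of _ v]) auto
  qed
  then obtain top where top: "\<And>n. top n \<in> V" "\<And>n u. u \<in> V \<Longrightarrow> \<bar>mpow (X n) u\<bar> \<le> \<bar>mpow (X n) (top n)\<bar>" by metis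
  have "\<exists>v0\<in>V. infinite {n. top n = v0}"
    using pigeonhole_infinite_rel[of "UNIV :: nat set" V "\<lambda>n v. top n = v"] V top(1) by auto
  then obtain v0 where v0: "v0 \<in> V" "infinite {n. top n = v0}" by blast
  obtain r0 :: "nat \<Rightarrow> nat" where r0: "strict_mono r0" "\<And>n. top (r0 n) = v0"
    using infinite_enumerate[OF v0(2)] by blast
  \<comment> \<open>Ratios to a monomial that is maximal along the whole subsequence, hence in
    [0, 1]; a further subsequence makes all of them converge.\<close>
  define b where "b v n = \<bar>mpow (X (r0 n)) v\<bar> / \<bar>mpow (X (r0 n)) v0\<bar>" for v n
  have b1: "\<bar>b v n\<bar> \<le> 1" if "v \<in> V" for v n
  proof -
    have "0 < \<bar>mpow (X (r0 n)) v0\<bar>" using mpow_nonzero[of "X (r0 n)" v0] X(3) by simp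
    then show ?thesis using top(2)[OF that, of "r0 n"] r0(2)[of n] by (simp add: b_def)
  qed
  have "\<exists>r :: nat \<Rightarrow> nat. strict_mono r \<and> (\<forall>v\<in>V. convergent (\<lambda>n. b v (r n)))"
    by (rule finite_family_convergent_subseq[OF V]) (rule b1)
  then obtain r1 :: "nat \<Rightarrow> nat" where r1: "strict_mono r1" "\<And>v. v \<in> V \<Longrightarrow> convergent (\<lambda>n. b v (r1 n))"
    by blast
  define Y where "Y n = X (r0 (r1 n))" for n
  have idx: "n \<le> r0 (r1 n)" for n
    using strict_mono_imp_increasing[OF strict_mono_o[OF r0(1) r1(1)], of n] by simp
  define t where "t n = (\<chi> i. - ln \<bar>Y n $ i\<bar>)" for n
  have Y: "Y n $ i \<noteq> 0" "\<bar>Y n $ i\<bar> < \<rho> n" for n i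
  proof -
    show "Y n $ i \<noteq> 0" using X(3) by (simp add: Y_def)
    have "\<bar>Y n $ i\<bar> < \<rho> (r0 (r1 n))" using X(1) by (simp add: Y_def)
    also have "\<dots> \<le> \<rho> n" unfolding \<rho>_def using idx[of n] c(2) by (intro divide_left_mono) auto
    finally show "\<bar>Y n $ i\<bar> < \<rho> n" .
  qed
  have \<rho>0: "\<rho> \<longlonglongrightarrow> 0"
  proof -
    have "(\<lambda>n. min 1 R * inverse (real (Suc (Suc n)))) \<longlonglongrightarrow> min 1 R * 0"
      by (rule tendsto_mult[OF tendsto_const LIMSEQ_Suc[OF LIMSEQ_inverse_real_of_nat]])
    then show ?thesis by (simp add: \<rho>_def[abs_def] divide_inverse)
  qed
  have Y0: "(\<lambda>n. \<bar>Y n $ i\<bar>) \<longlonglongrightarrow> 0" for i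
    by (rule tendsto_sandwich[OF _ _ tendsto_const \<rho>0]) (use Y(2) in \<open>auto intro!: always_eventually less_imp_le\<close>)
  have t_top: "filterlim (\<lambda>n. t n $ i) at_top sequentially" for i
  proof -
    have "filterlim (\<lambda>n. \<bar>Y n $ i\<bar>) (at_right 0) sequentially"
      using Y0[of i] Y(1) by (auto simp: filterlim_at)
    then have "filterlim (\<lambda>n. ln \<bar>Y n $ i\<bar>) at_bot sequentially" by (rule filterlim_compose[OF ln_at_0])
    then show ?thesis by (simp add: t_def filterlim_uminus_at_bot)
  qed
  have mY: "\<bar>mpow (Y n) v\<bar> = exp (- (rvec v \<bullet> t n))" for n v unfolding t_def by (rule mpow_exp) (rule Y)
  have bY: "b v (r1 n) = exp (- ((rvec v - rvec v0) \<bullet> t n))" for v n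
    unfolding b_def Y_def[symmetric] mY by (simp add: exp_diff[symmetric] inner_diff_left)
  \<comment> \<open>The monomials that remain comparable with \<open>v0\<close>. For the others the
    ratio tends to 0, that is, the difference of exponents tends to infinity on
    \<open>t n\<close>.\<close>
  define V1 where "V1 = {v\<in>V. lim (\<lambda>n. b v (r1 n)) \<noteq> 0}"
  have blim: "(\<lambda>n. b v (r1 n)) \<longlonglongrightarrow> lim (\<lambda>n. b v (r1 n))" if "v \<in> V" for v
    using r1(2)[OF that] by (simp add: convergent_LIMSEQ_iff)
  have "b v0 (r1 n) = 1" for n by (simp add: bY)
  then have v01: "v0 \<in> V1" using v0(1) by (simp add: V1_def)
  have bd: "\<exists>K. \<forall>n. \<bar>(rvec v - rvec v0) \<bullet> t n\<bar> \<le> K" if v: "v \<in> V1" for v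
  proof -
    have "(\<lambda>n. ln (b v (r1 n))) \<longlonglongrightarrow> ln (lim (\<lambda>n. b v (r1 n)))"
      using v by (intro tendsto_ln blim) (auto simp: V1_def)
    then have "Bseq (\<lambda>n. ln (b v (r1 n)))" by (rule convergent_imp_Bseq[OF convergentI])
    then obtain K where "\<And>n. norm (ln (b v (r1 n))) \<le> K" unfolding Bseq_def by blast
    then show ?thesis unfolding bY by (intro exI[of _ K]) simp
  qed
  have unbd: "filterlim (\<lambda>n. (rvec v - rvec v0) \<bullet> t n) at_top sequentially" if v: "v \<in> V - V1" for v
  proof -
    have "(\<lambda>n. b v (r1 n)) \<longlonglongrightarrow> 0" using blim[of v] v by (auto simp: V1_def)
    then have "filterlim (\<lambda>n. b v (r1 n)) (at_right 0) sequentially" by (auto simp: filterlim_at bY)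
    then have "filterlim (\<lambda>n. ln (b v (r1 n))) at_bot sequentially" by (rule filterlim_compose[OF ln_at_0])
    then show ?thesis by (simp add: bY filterlim_uminus_at_bot)
  qed
  have V1V: "V1 \<subseteq> V" by (auto simp: V1_def)
  have fV1: "finite V1" using V V1V finite_subset by blast
  have "\<exists>s K. (\<forall>n. norm (s n) \<le> K) \<and> (\<forall>n. \<forall>v\<in>V1. (rvec v - rvec v0) \<bullet> (t n - s n) = 0) \<and>
    eventually (\<lambda>n. (\<forall>i. 0 < (t n - s n) $ i) \<and> (\<forall>v\<in>V - V1. 0 < (rvec v - rvec v0) \<bullet> (t n - s n))) sequentially"
    by (rule eventually_orthogonal_part_selects[OF V V1V v01]) (fact t_top bd unbd)+
  then obtain s K where s': "\<forall>n. norm (s n) \<le> K" "\<forall>n. \<forall>v\<in>V1. (rvec v - rvec v0) \<bullet> (t n - s n) = 0"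
    "eventually (\<lambda>n. (\<forall>i. 0 < (t n - s n) $ i) \<and> (\<forall>v\<in>V - V1. 0 < (rvec v - rvec v0) \<bullet> (t n - s n))) sequentially"
    by (elim exE conjE)
  have s: "norm (s n) \<le> K" "v \<in> V1 \<Longrightarrow> (rvec v - rvec v0) \<bullet> (t n - s n) = 0" for n v using s' by auto
  \<comment> \<open>A single index suffices: its covector is positive and minimal over
    \<open>V\<close> exactly on \<open>V1\<close>, so the nondegeneracy hypothesis applies to
    \<open>V1\<close>.\<close>
  obtain n0 where n0: "\<And>i. 0 < (t n0 - s n0) $ i" "\<And>v. v \<in> V - V1 \<Longrightarrow> 0 < (rvec v - rvec v0) \<bullet> (t n0 - s n0)"
    using eventually_happens[OF s'(3)] by auto
  have sel: "{v\<in>V. rvec v \<bullet> (t n0 - s n0) = min_weight V (t n0 - s n0)} = V1"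
  proof -
    let ?o = "t n0 - s n0"
    have e1: "rvec v \<bullet> ?o = rvec v0 \<bullet> ?o" if "v \<in> V1" for v using s(2)[OF that, of n0] by (simp add: inner_diff_left)
    have e2: "rvec v0 \<bullet> ?o < rvec v \<bullet> ?o" if "v \<in> V - V1" for v using n0(2)[OF that] by (simp add: inner_diff_left)
    have "min_weight V ?o = rvec v0 \<bullet> ?o"
      unfolding min_weight_def
    proof (rule Min_eqI)
      show "rvec v0 \<bullet> ?o \<le> y" if "y \<in> (\<lambda>v. rvec v \<bullet> ?o) ` V" for y
      proof -
        from that obtain v where v: "v \<in> V" "y = rvec v \<bullet> ?o" by blast
        show ?thesis unfolding v(2)
        proof (cases "v \<in> V1")
          case False
          then show "rvec v0 \<bullet> ?o \<le> rvec v \<bullet> ?o" using v(1) by (intro less_imp_le e2) blast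
        qed (simp add: e1)
      qed
    qed (use V v0(1) in auto)
    moreover have "v \<in> V1" if "v \<in> V" "rvec v \<bullet> ?o = rvec v0 \<bullet> ?o" for v
    proof (rule ccontr)
      assume "v \<notin> V1"
      then have "rvec v0 \<bullet> ?o < rvec v \<bullet> ?o" using that(1) by (intro e2) blast
      then show False using that(2) by linarith
    qed
    ultimately show ?thesis using e1 V1V by (intro equalityI subsetI) (simp_all add: subset_iff)
  qed
  have nd1: "\<exists>i. (\<Sum>\<alpha>\<in>V1. real (\<alpha> $ i) * c \<alpha> * mpow y \<alpha>) \<noteq> 0" if "\<And>i. y $ i \<noteq> 0" for y
    using nd[of "t n0 - s n0" y, unfolded sel] n0(1) that Vne by blast
  have "\<exists>\<delta>>0. \<forall>y. (\<forall>i. exp (- K) \<le> \<bar>y $ i\<bar> \<and> \<bar>y $ i\<bar> \<le> exp K) \<longrightarrow>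
    \<delta> \<le> (\<Sum>i\<in>UNIV. \<bar>\<Sum>\<alpha>\<in>V1. real (\<alpha> $ i) * c \<alpha> * mpow y \<alpha>\<bar>)"
    by (rule face_sum_lower_bound) (fact nd1)
  then obtain \<delta> where \<delta>: "0 < \<delta>" "\<forall>y. (\<forall>i. exp (- K) \<le> \<bar>y $ i\<bar> \<and> \<bar>y $ i\<bar> \<le> exp K) \<longrightarrow>
    \<delta> \<le> (\<Sum>i\<in>UNIV. \<bar>\<Sum>\<alpha>\<in>V1. real (\<alpha> $ i) * c \<alpha> * mpow y \<alpha>\<bar>)"
    by (elim exE conjE)
  define a where "a n = \<bar>mpow (Y n) v0\<bar>" for n
  have a0: "0 < a n" for n using mpow_nonzero[of "Y n" v0] Y(1) by (simp add: a_def)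
  \<comment> \<open>The series is split into its dominant face part \<open>c1\<close> and the rest
    \<open>c2\<close>.\<close>
  define c1 where "c1 \<alpha> = (if \<alpha> \<in> V1 then c \<alpha> else 0)" for \<alpha>
  define c2 where "c2 \<alpha> = (if \<alpha> \<in> V1 then 0 else c \<alpha>)" for \<alpha>
  have conv1: "ps_conv R c1" "ps_conv R c2" by (rule ps_conv_mono[OF c(1)], simp add: c1_def c2_def)+
  have main: "\<delta> * exp (- (norm (rvec v0) * K)) * a n \<le> (\<Sum>i\<in>UNIV. \<bar>psum (\<lambda>\<alpha>. real (\<alpha> $ i) * c1 \<alpha>) (Y n)\<bar>)" for n
  proof -
    \<comment> \<open>\<open>Y n\<close> with the escaping part \<open>t n - s n\<close> of its
      logarithms removed and its signs kept; the bound on \<open>s n\<close> confines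
      \<open>y\<close>.\<close>
    define y where "y = (\<chi> i. sgn (Y n $ i) * exp (- (s n $ i)))"
    define \<mu> where "\<mu> = rvec v0 \<bullet> (t n - s n)"
    have "exp (- K) \<le> \<bar>y $ i\<bar> \<and> \<bar>y $ i\<bar> \<le> exp K" for i
    proof -
      have "\<bar>s n $ i\<bar> \<le> K" using component_le_norm_cart[of "s n" i] s(1)[of n] by linarith
      then have "s n $ i \<le> K" "- (s n $ i) \<le> K" by linarith+
      then show ?thesis using Y(1)[of n i] by (simp add: y_def abs_mult abs_sgn_eq)
    qed
    note yb = \<delta>(2)[rule_format, OF this]
    have Yy: "Y n $ i = y $ i * exp (- ((t n - s n) $ i))" for i
    proof -
      have "exp (- (s n $ i)) * exp (- ((t n - s n) $ i)) = exp (- (t n $ i))" by (simp flip: exp_add)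
      moreover have "exp (- (t n $ i)) = \<bar>Y n $ i\<bar>" using Y(1)[of n i] by (simp add: t_def)
      ultimately have "y $ i * exp (- ((t n - s n) $ i)) = sgn (Y n $ i) * \<bar>Y n $ i\<bar>"
        unfolding y_def vec_lambda_beta mult.assoc by simp
      then show ?thesis by (simp only: sgn_mult_abs)
    qed
    \<comment> \<open>All of \<open>V1\<close> has the same pairing \<mu> with the escaping part,
      which therefore acts as one common factor.\<close>
    have mono: "mpow (Y n) \<alpha> = exp (- \<mu>) * mpow y \<alpha>" if "\<alpha> \<in> V1" for \<alpha>
    proof -
      have "mpow (Y n) \<alpha> = (\<Prod>i\<in>UNIV. (y $ i) ^ (\<alpha> $ i) * exp (real (\<alpha> $ i) * - ((t n - s n) $ i)))"
        unfolding mpow_def Yy power_mult_distrib exp_of_nat_mult ..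
      also have "\<dots> = mpow y \<alpha> * exp (\<Sum>i\<in>UNIV. real (\<alpha> $ i) * - ((t n - s n) $ i))"
        unfolding prod.distrib mpow_def by (simp add: exp_sum)
      finally have "mpow (Y n) \<alpha> = mpow y \<alpha> * exp (\<Sum>i\<in>UNIV. real (\<alpha> $ i) * - ((t n - s n) $ i))" .
      moreover have "(\<Sum>i\<in>UNIV. real (\<alpha> $ i) * - ((t n - s n) $ i)) = - (rvec \<alpha> \<bullet> (t n - s n))"
        unfolding inner_vec_def sum_negf[symmetric] by (intro sum.cong) (simp_all add: algebra_simps)
      moreover have "rvec \<alpha> \<bullet> (t n - s n) = \<mu>" using s(2)[OF that, of n] by (simp add: \<mu>_def inner_diff_left)
      ultimately show ?thesis by simp
    qed
    have "psum (\<lambda>\<alpha>. real (\<alpha> $ i) * c1 \<alpha>) (Y n) = exp (- \<mu>) * (\<Sum>\<alpha>\<in>V1. real (\<alpha> $ i) * c \<alpha> * mpow y \<alpha>)" for i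
    proof -
      have "psum (\<lambda>\<alpha>. real (\<alpha> $ i) * c1 \<alpha>) (Y n) = (\<Sum>\<alpha>\<in>V1. real (\<alpha> $ i) * c1 \<alpha> * mpow (Y n) \<alpha>)"
        by (rule psum_finite[OF fV1]) (simp add: c1_def)
      also have "\<dots> = (\<Sum>\<alpha>\<in>V1. exp (- \<mu>) * (real (\<alpha> $ i) * c \<alpha> * mpow y \<alpha>))"
        by (rule sum.cong) (auto simp: mono c1_def)
      finally show ?thesis by (simp add: sum_distrib_left)
    qed
    then have S1: "(\<Sum>i\<in>UNIV. \<bar>psum (\<lambda>\<alpha>. real (\<alpha> $ i) * c1 \<alpha>) (Y n)\<bar>)
       = exp (- \<mu>) * (\<Sum>i\<in>UNIV. \<bar>\<Sum>\<alpha>\<in>V1. real (\<alpha> $ i) * c \<alpha> * mpow y \<alpha>\<bar>)"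
      by (subst sum_distrib_left) (simp add: abs_mult)
    have 1: "exp (- \<mu>) * \<delta> \<le> (\<Sum>i\<in>UNIV. \<bar>psum (\<lambda>\<alpha>. real (\<alpha> $ i) * c1 \<alpha>) (Y n)\<bar>)"
      unfolding S1 using yb by (intro mult_left_mono) auto
    have "exp (- (norm (rvec v0) * K)) * a n \<le> exp (- \<mu>)"
    proof -
      have "- (rvec v0 \<bullet> s n) \<le> norm (rvec v0) * norm (s n)"
        using Cauchy_Schwarz_ineq2[of "rvec v0" "s n"] by linarith
      also have "\<dots> \<le> norm (rvec v0) * K" using s(1) by (intro mult_left_mono) auto
      finally have "- (norm (rvec v0) * K) + - (rvec v0 \<bullet> t n) \<le> - \<mu>" by (simp add: \<mu>_def inner_diff_right)
      then have "exp (- (norm (rvec v0) * K) + - (rvec v0 \<bullet> t n)) \<le> exp (- \<mu>)" by simp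
      then show ?thesis unfolding a_def mY exp_add .
    qed
    then have "\<delta> * (exp (- (norm (rvec v0) * K)) * a n) \<le> \<delta> * exp (- \<mu>)" using \<delta>(1) by (intro mult_left_mono) auto
    with 1 show ?thesis by (simp add: mult_ac)
  qed
  \<comment> \<open>Exponents of the rest lie above an element of \<open>V - V1\<close>, or strictly
    above some \<open>u\<close> in \<open>V1\<close> and then above \<open>u + e_i\<close> for some
    \<open>i\<close>.\<close>
  define V' where "V' = (V - V1) \<union> (\<lambda>(v, i). v + axis i 1) ` (V1 \<times> UNIV)"
  have fV': "finite V'" unfolding V'_def using V fV1 by auto
  have dom2: "\<exists>v\<in>V'. \<forall>i. v $ i \<le> \<alpha> $ i" if "c2 \<alpha> \<noteq> 0" for \<alpha>
  proof -
    have \<alpha>: "\<alpha> \<notin> V1" "c \<alpha> \<noteq> 0" using that by (auto simp: c2_def split: if_splits)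
    obtain v where v: "v \<in> V" "\<And>i. v $ i \<le> \<alpha> $ i" using dom[OF \<alpha>(2)] by blast
    show ?thesis
    proof (cases "v \<in> V1")
      case True
      then have "v \<noteq> \<alpha>" using \<alpha> by blast
      then obtain i where "v $ i \<noteq> \<alpha> $ i" by (auto simp: vec_eq_iff)
      then have "v $ i < \<alpha> $ i" using v(2)[of i] by simp
      then have "(v + axis i 1) $ k \<le> \<alpha> $ k" for k using v(2)[of k] by (auto simp: axis_def)
      moreover have "v + axis i 1 \<in> V'" unfolding V'_def using True by auto
      ultimately show ?thesis by blast
    next
      case False
      then show ?thesis using v unfolding V'_def by blast
    qed
  qed
  define r2 where "r2 = min 1 R / 2"
  have r2: "0 < r2" "r2 < R" "r2 \<le> 1" using c(2) by (auto simp: r2_def)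
  have \<rho>r2: "\<rho> n \<le> r2" for n unfolding \<rho>_def r2_def using c(2) by (intro divide_left_mono) auto
  have "\<forall>i. \<exists>C. \<forall>x. (\<forall>i. \<bar>x $ i\<bar> \<le> r2) \<longrightarrow> \<bar>psum (\<lambda>\<alpha>. real (\<alpha> $ i) * c2 \<alpha>) x\<bar> \<le> C * monomial_weight V' x"
    by (intro allI psum_bound[OF ps_conv_mult[OF conv1(2)] r2 fV']) (use dom2 in auto)
  then obtain C where C: "\<forall>i x. (\<forall>i. \<bar>x $ i\<bar> \<le> r2) \<longrightarrow> \<bar>psum (\<lambda>\<alpha>. real (\<alpha> $ i) * c2 \<alpha>) x\<bar> \<le> C i * monomial_weight V' x"
    by (rule choice[THEN exE])
  \<comment> \<open>Dividing by \<open>a n\<close> puts a fixed positive number below a quantity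
    that will be shown to tend to 0.\<close>
  have rest: "\<delta> * exp (- (norm (rvec v0) * K)) \<le> inverse (real (Suc n)) * real (card V) + (\<Sum>i\<in>UNIV. \<bar>C i\<bar>) * (monomial_weight V' (Y n) / a n)" for n
  proof -
    have YR: "\<bar>Y n $ i\<bar> < R" "\<bar>Y n $ i\<bar> \<le> r2" for i using Y(2)[of n i] \<rho>(2)[of n] \<rho>r2[of n] by linarith+
    have "(\<lambda>\<alpha>. real (\<alpha> $ i) * c \<alpha>) = (\<lambda>\<alpha>. real (\<alpha> $ i) * c1 \<alpha> + real (\<alpha> $ i) * c2 \<alpha>)" for i
      by (rule ext) (simp add: c1_def c2_def)
    then have Di: "?D i (Y n) = psum (\<lambda>\<alpha>. real (\<alpha> $ i) * c1 \<alpha>) (Y n) + psum (\<lambda>\<alpha>. real (\<alpha> $ i) * c2 \<alpha>) (Y n)" for i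
      using psum_add[OF ps_conv_mult[OF conv1(1)] ps_conv_mult[OF conv1(2)] YR(1)] by simp
    have W0: "0 \<le> monomial_weight V' (Y n)" by (simp add: monomial_weight_def sum_nonneg)
    have "(\<Sum>i\<in>UNIV. \<bar>psum (\<lambda>\<alpha>. real (\<alpha> $ i) * c1 \<alpha>) (Y n)\<bar>) \<le> (\<Sum>i\<in>UNIV. \<bar>?D i (Y n)\<bar> + \<bar>C i\<bar> * monomial_weight V' (Y n))"
    proof (rule sum_mono)
      fix i
      have "\<bar>psum (\<lambda>\<alpha>. real (\<alpha> $ i) * c2 \<alpha>) (Y n)\<bar> \<le> C i * monomial_weight V' (Y n)" using C YR by blast
      also have "\<dots> \<le> \<bar>C i\<bar> * monomial_weight V' (Y n)" using W0 by (intro mult_right_mono) auto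
      finally show "\<bar>psum (\<lambda>\<alpha>. real (\<alpha> $ i) * c1 \<alpha>) (Y n)\<bar> \<le> \<bar>?D i (Y n)\<bar> + \<bar>C i\<bar> * monomial_weight V' (Y n)"
        unfolding Di by linarith
    qed
    also have "\<dots> = ?G (Y n) + (\<Sum>i\<in>UNIV. \<bar>C i\<bar>) * monomial_weight V' (Y n)"
      by (simp add: sum.distrib sum_distrib_right)
    finally have up: "(\<Sum>i\<in>UNIV. \<bar>psum (\<lambda>\<alpha>. real (\<alpha> $ i) * c1 \<alpha>) (Y n)\<bar>)
        \<le> ?G (Y n) + (\<Sum>i\<in>UNIV. \<bar>C i\<bar>) * monomial_weight V' (Y n)" .
    have GY: "?G (Y n) \<le> inverse (real (Suc n)) * (real (card V) * a n)"
    proof -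
      have wY: "?w (Y n) \<le> real (card V) * a n"
      proof -
        have "?w (Y n) \<le> (\<Sum>v\<in>V. a n)"
          unfolding monomial_weight_def a_def
          using top(2)[of _ "r0 (r1 n)"] r0(2)[of "r1 n"] by (intro sum_mono) (simp add: Y_def)
        then show ?thesis by simp
      qed
      have "?G (Y n) \<le> inverse (real (Suc (r0 (r1 n)))) * ?w (Y n)"
        using X(2)[of "r0 (r1 n)"] by (simp add: Y_def less_imp_le)
      also have "\<dots> \<le> inverse (real (Suc n)) * (real (card V) * a n)"
        using idx[of n] wY by (intro mult_mono) (auto simp: monomial_weight_def sum_nonneg le_imp_inverse_le)
      finally show ?thesis .
    qed
    have "\<delta> * exp (- (norm (rvec v0) * K)) * a n \<le>
        inverse (real (Suc n)) * (real (card V) * a n) + (\<Sum>i\<in>UNIV. \<bar>C i\<bar>) * monomial_weight V' (Y n)"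
      using main[of n] up GY by linarith
    also have "\<dots> = (inverse (real (Suc n)) * real (card V) + (\<Sum>i\<in>UNIV. \<bar>C i\<bar>) * (monomial_weight V' (Y n) / a n)) * a n"
      using a0[of n] by (simp add: distrib_right)
    finally show ?thesis using a0[of n] by (rule mult_right_le_imp_le)
  qed
  have lim0: "(\<lambda>n. monomial_weight V' (Y n) / a n) \<longlonglongrightarrow> 0"
  proof -
    \<comment> \<open>Outside \<open>V1\<close> this is the definition of \<open>V1\<close>; for
      \<open>u + e_i\<close> the bounded ratio is multiplied by the vanishing coordinate.\<close>
    have "(\<lambda>n. \<bar>mpow (Y n) v\<bar> / a n) \<longlonglongrightarrow> 0" if "v \<in> V'" for v
      using that unfolding V'_def
    proof
      assume "v \<in> V - V1"
      then have "(\<lambda>n. b v (r1 n)) \<longlonglongrightarrow> 0" using blim[of v] by (auto simp: V1_def)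
      then show ?thesis by (simp add: b_def a_def Y_def)
    next
      assume "v \<in> (\<lambda>(v, i). v + axis i 1) ` (V1 \<times> UNIV)"
      then obtain u i where u: "u \<in> V1" "v = u + axis i 1" by auto
      have "\<bar>mpow (Y n) v\<bar> / a n = b u (r1 n) * \<bar>Y n $ i\<bar>" for n
        by (simp add: u(2) mpow_add mpow_axis_exponent abs_mult b_def a_def Y_def)
      moreover have "(\<lambda>n. b u (r1 n) * \<bar>Y n $ i\<bar>) \<longlonglongrightarrow> lim (\<lambda>n. b u (r1 n)) * 0"
        using u(1) V1V by (intro tendsto_mult blim Y0) auto
      ultimately show ?thesis by simp
    qed
    then have "(\<lambda>n. \<Sum>v\<in>V'. \<bar>mpow (Y n) v\<bar> / a n) \<longlonglongrightarrow> (\<Sum>v\<in>V'. 0)" by (rule tendsto_sum)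
    then show ?thesis by (simp add: monomial_weight_def sum_divide_distrib)
  qed
  have "(\<lambda>n. inverse (real (Suc n)) * real (card V) + (\<Sum>i\<in>UNIV. \<bar>C i\<bar>) * (monomial_weight V' (Y n) / a n))
      \<longlonglongrightarrow> 0 * real (card V) + (\<Sum>i\<in>UNIV. \<bar>C i\<bar>) * 0"
    by (intro tendsto_add tendsto_mult tendsto_const LIMSEQ_inverse_real_of_nat lim0)
  then have "\<delta> * exp (- (norm (rvec v0) * K)) \<le> 0 * real (card V) + (\<Sum>i\<in>UNIV. \<bar>C i\<bar>) * 0"
    by (rule LIMSEQ_le_const) (use rest in blast)
  then show False using \<delta>(1) by (simp add: mult_le_0_iff)
qed


subsection \<open>Lattice sums\<close>

lemma sum_geometric_int_le:
  fixes r :: real and a :: int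
  assumes "0 \<le> r" "r < 1" "finite A"
  shows "(\<Sum>n\<in>A. r ^ nat \<bar>n - a\<bar>) \<le> 2 / (1 - r)"
proof -
  have half: "(\<Sum>n\<in>X. r ^ nat \<bar>n - a\<bar>) \<le> 1 / (1 - r)"
    if X: "finite X" "inj_on (\<lambda>n. nat \<bar>n - a\<bar>) X" for X
  proof -
    have "(\<Sum>n\<in>X. r ^ nat \<bar>n - a\<bar>) = sum ((^) r) ((\<lambda>n. nat \<bar>n - a\<bar>) ` X)"
      using X(2) by (simp add: sum.reindex)
    also have "\<dots> \<le> suminf ((^) r)"
      using assms X by (intro sum_le_suminf summable_geometric) auto
    also have "\<dots> = 1 / (1 - r)" using assms by (simp add: suminf_geometric)
    finally show ?thesis .
  qed
  have "(\<Sum>n\<in>A. r ^ nat \<bar>n - a\<bar>) = (\<Sum>n\<in>{n\<in>A. n \<ge> a}. r ^ nat \<bar>n - a\<bar>) + (\<Sum>n\<in>{n\<in>A. \<not> n \<ge> a}. r ^ nat \<bar>n - a\<bar>)"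
    using assms(3) by (subst sum.union_disjoint[symmetric]) (auto intro!: sum.cong)
  also have "\<dots> \<le> 1 / (1 - r) + 1 / (1 - r)"
    using assms(3) by (intro add_mono half) (auto simp: inj_on_def)
  finally show ?thesis by simp
qed

text \<open>Uniform in the centre \<sigma>, whose rounding costs \<open>exp 1\<close>; the rest
  comes from \<open>1 - exp (-\<eta>) \<ge> \<eta>/2\<close> on (0, 1]. The explicit
  \<open>1/\<eta>\<close> is what later turns into a factor \<open>log \<lambda>\<close>.\<close>

lemma sum_exp_abs_int_le:
  fixes \<eta> \<sigma> :: real
  assumes "0 < \<eta>" "\<eta> \<le> 1" "finite A"
  shows "(\<Sum>n\<in>A. exp (- \<eta> * \<bar>real_of_int n - \<sigma>\<bar>)) \<le> 4 * exp 1 / \<eta>"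
proof -
  let ?r = "exp (- \<eta>)"
  have "exp (- \<eta> * \<bar>real_of_int n - \<sigma>\<bar>) \<le> exp 1 * ?r ^ nat \<bar>n - \<lfloor>\<sigma>\<rfloor>\<bar>" for n
  proof -
    have "real (nat \<bar>n - \<lfloor>\<sigma>\<rfloor>\<bar>) - 1 \<le> \<bar>real_of_int n - \<sigma>\<bar>" by linarith
    then have "\<eta> * (real (nat \<bar>n - \<lfloor>\<sigma>\<rfloor>\<bar>) - 1) \<le> \<eta> * \<bar>real_of_int n - \<sigma>\<bar>"
      using assms by (intro mult_left_mono) auto
    then have "- \<eta> * \<bar>real_of_int n - \<sigma>\<bar> \<le> 1 + real (nat \<bar>n - \<lfloor>\<sigma>\<rfloor>\<bar>) * (- \<eta>)"
      using assms by (simp add: algebra_simps)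
    then have "exp (- \<eta> * \<bar>real_of_int n - \<sigma>\<bar>) \<le> exp (1 + real (nat \<bar>n - \<lfloor>\<sigma>\<rfloor>\<bar>) * (- \<eta>))" by simp
    then show ?thesis by (simp only: exp_add exp_of_nat_mult)
  qed
  then have "(\<Sum>n\<in>A. exp (- \<eta> * \<bar>real_of_int n - \<sigma>\<bar>)) \<le> (\<Sum>n\<in>A. exp 1 * ?r ^ nat \<bar>n - \<lfloor>\<sigma>\<rfloor>\<bar>)"
    by (rule sum_mono)
  also have "\<dots> \<le> exp 1 * (2 / (1 - ?r))"
    unfolding sum_distrib_left[symmetric] using assms
    by (intro mult_left_mono sum_geometric_int_le) auto
  also have "\<dots> \<le> exp 1 * (2 / (\<eta> / 2))"
  proof -
    have "(1 + \<eta>) * exp (- \<eta>) \<le> exp \<eta> * exp (- \<eta>)"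
      by (intro mult_right_mono) auto
    then have "(1 + \<eta>) * exp (- \<eta>) \<le> 1" by (simp flip: exp_add)
    then have "exp (- \<eta>) \<le> 1 / (1 + \<eta>)" using assms by (simp add: field_simps)
    also have "\<dots> \<le> 1 - \<eta> / 2"
    proof -
      have "\<eta> * \<eta> \<le> \<eta> * 1" using assms by (intro mult_left_mono) auto
      then show ?thesis using assms by (simp add: field_simps)
    qed
    finally show ?thesis using assms by (intro mult_left_mono divide_left_mono mult_pos_pos) auto
  qed
  finally show ?thesis by (simp add: mult.commute)
qed

text \<open>The lattice is grouped by the integer parts of the linear forms in \<open>B\<close>; as \<open>B\<close> spans, the groups
  have bounded cardinality.\<close>

lemma lattice_sum_le:
  fixes B :: "(real ^ 'n::finite) set"
  assumes B: "finite B" "span B = UNIV"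
  shows "\<exists>C>0. \<forall>\<eta> \<sigma> J. finite J \<longrightarrow> (\<forall>b\<in>B. 0 < \<eta> b \<and> \<eta> b \<le> 1) \<longrightarrow>
     (\<Sum>j\<in>J. \<Prod>b\<in>B. exp (- \<eta> b * \<bar>b \<bullet> rvec j - \<sigma> b\<bar>)) \<le> C * (\<Prod>b\<in>B. 1 / \<eta> b)"
proof -
  obtain \<delta> where \<delta>: "\<delta> > 0" "\<And>x. \<delta> * norm x \<le> (\<Sum>b\<in>B. \<bar>b \<bullet> x\<bar>)"
    using span_norm_lower_bound[OF B(1)] B(2) by (metis UNIV_I)
  \<comment> \<open>Within a group every form varies by at most 1, so two members are at distance at
    most \<open>card B / \<delta>\<close>.\<close>
  define R where "R = nat \<lceil>real (card B) / \<delta>\<rceil>"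
  define C0 where "C0 = (2 * R + 1) ^ CARD('n)"
  define \<kappa> where "\<kappa> j = (\<lambda>b\<in>B. \<lfloor>b \<bullet> rvec j\<rfloor>)" for j :: "nat ^ 'n"
  have fiber: "card {j\<in>J. \<kappa> j = k} \<le> C0" for k and J
  proof (cases "{j\<in>J. \<kappa> j = k} = {}")
    case False
    then obtain j0 where j0: "\<kappa> j0 = k" by blast
    have dist: "\<bar>int (j $ i) - int (j0 $ i)\<bar> \<le> int R" if j: "\<kappa> j = k" for j i
    proof -
      have "\<bar>b \<bullet> (rvec j - rvec j0)\<bar> \<le> 1" if "b \<in> B" for b
      proof -
        have "\<lfloor>b \<bullet> rvec j\<rfloor> = \<lfloor>b \<bullet> rvec j0\<rfloor>"
          using j j0 that unfolding \<kappa>_def by (metis restrict_apply')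
        then show ?thesis unfolding inner_diff_right by linarith
      qed
      then have "(\<Sum>b\<in>B. \<bar>b \<bullet> (rvec j - rvec j0)\<bar>) \<le> (\<Sum>b\<in>B. 1)" by (rule sum_mono)
      with \<delta>(2)[of "rvec j - rvec j0"] have "\<delta> * norm (rvec j - rvec j0) \<le> real (card B)" by simp
      then have "norm (rvec j - rvec j0) \<le> real (card B) / \<delta>" using \<delta>(1) by (simp add: field_simps)
      moreover have "\<bar>real (j $ i) - real (j0 $ i)\<bar> \<le> norm (rvec j - rvec j0)"
        using component_le_norm_cart[of "rvec j - rvec j0" i] by simp
      ultimately show ?thesis unfolding R_def by linarith
    qed
    then have sub: "{j\<in>J. \<kappa> j = k} \<subseteq> {j. \<forall>i. j $ i \<in> {j0 $ i - R .. j0 $ i + R}}"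
    proof safe
      fix j i assume "k = \<kappa> j"
      with dist[of j i] show "j $ i \<in> {j0 $ i - R .. j0 $ i + R}" by auto
    qed
    have "card {j\<in>J. \<kappa> j = k} \<le> card {j. \<forall>i. j $ i \<in> {j0 $ i - R .. j0 $ i + R}}"
      by (rule card_mono[OF finite_vec_bounded sub]) simp
    also have "\<dots> \<le> (\<Prod>i\<in>UNIV. card {j0 $ i - R .. j0 $ i + R})"
      by (rule card_vec_bounded[of "\<lambda>i. {j0 $ i - R .. j0 $ i + R}"]) simp
    also have "\<dots> \<le> (\<Prod>i\<in>(UNIV::'n set). 2 * R + 1)" by (intro prod_mono) auto
    finally show ?thesis by (simp add: C0_def)
  next
    case True
    show ?thesis unfolding True by simp
  qed
  show ?thesis
  proof (rule exI[of _ "real C0 * exp 1 ^ card B * (4 * exp 1) ^ card B"], intro conjI allI impI)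
    show "0 < real C0 * exp 1 ^ card B * (4 * exp 1) ^ card B" by (simp add: C0_def)
    fix \<eta> \<sigma> :: "real ^ 'n \<Rightarrow> real" and J :: "(nat ^ 'n) set"
    assume J: "finite J" and "\<forall>b\<in>B. 0 < \<eta> b \<and> \<eta> b \<le> 1"
    then have \<eta>: "0 < \<eta> b \<and> \<eta> b \<le> 1" if "b \<in> B" for b using that by blast
    define g where "g k = (\<Prod>b\<in>B. exp 1 * exp (- \<eta> b * \<bar>real_of_int (k b) - \<sigma> b\<bar>))" for k
    have g0: "0 \<le> g k" for k unfolding g_def by (intro prod_nonneg) auto
    obtain L where L: "\<And>j b. j \<in> J \<Longrightarrow> b \<in> B \<Longrightarrow> \<lfloor>b \<bullet> rvec j\<rfloor> \<in> {- int L..int L}"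
    proof -
      let ?A = "(\<lambda>(j, b). nat \<bar>\<lfloor>b \<bullet> rvec j\<rfloor>\<bar>) ` (J \<times> B)"
      have "finite ?A" using J B by auto
      then have mx: "nat \<bar>\<lfloor>b \<bullet> rvec j\<rfloor>\<bar> \<le> Max ?A" if "j \<in> J" "b \<in> B" for j b
        using that by (intro Max_ge) auto
      have "\<lfloor>b \<bullet> rvec j\<rfloor> \<in> {- int m..int m}" if "j \<in> J" "b \<in> B" "m = Max ?A" for j b m
      proof -
        have "\<bar>\<lfloor>b \<bullet> rvec j\<rfloor>\<bar> \<le> int m"
          using mx[OF that(1,2)] unfolding that(3)[symmetric] nat_le_iff .
        then show ?thesis unfolding atLeastAtMost_iff by linarith
      qed
      then show thesis using that by blast
    qed
    have "(\<Sum>j\<in>J. \<Prod>b\<in>B. exp (- \<eta> b * \<bar>b \<bullet> rvec j - \<sigma> b\<bar>)) \<le> (\<Sum>j\<in>J. g (\<kappa> j))"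
    proof (rule sum_mono)
      fix j
      show "(\<Prod>b\<in>B. exp (- \<eta> b * \<bar>b \<bullet> rvec j - \<sigma> b\<bar>)) \<le> g (\<kappa> j)"
        unfolding g_def
      proof (rule prod_mono, intro conjI)
        fix b assume b: "b \<in> B"
        have "\<bar>real_of_int (\<kappa> j b) - \<sigma> b\<bar> - 1 \<le> \<bar>b \<bullet> rvec j - \<sigma> b\<bar>"
          unfolding \<kappa>_def restrict_apply'[OF b] by linarith
        then have "\<eta> b * (\<bar>real_of_int (\<kappa> j b) - \<sigma> b\<bar> - 1) \<le> \<eta> b * \<bar>b \<bullet> rvec j - \<sigma> b\<bar>"
          using \<eta>[OF b] by (intro mult_left_mono) auto
        then have "- \<eta> b * \<bar>b \<bullet> rvec j - \<sigma> b\<bar> \<le> 1 + (- \<eta> b * \<bar>real_of_int (\<kappa> j b) - \<sigma> b\<bar>)"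
          using \<eta>[OF b] by (simp add: algebra_simps)
        then show "exp (- \<eta> b * \<bar>b \<bullet> rvec j - \<sigma> b\<bar>) \<le> exp 1 * exp (- \<eta> b * \<bar>real_of_int (\<kappa> j b) - \<sigma> b\<bar>)"
          by (simp flip: exp_add)
      qed simp
    qed
    also have "\<dots> = (\<Sum>k\<in>\<kappa> ` J. \<Sum>j\<in>{j\<in>J. \<kappa> j = k}. g (\<kappa> j))"
      by (rule sum.image_gen[OF J])
    also have "\<dots> = (\<Sum>k\<in>\<kappa> ` J. real (card {j\<in>J. \<kappa> j = k}) * g k)"
      by (intro sum.cong refl) simp
    also have "\<dots> \<le> (\<Sum>k\<in>\<kappa> ` J. real C0 * g k)"
      using fiber g0 by (intro sum_mono mult_right_mono) auto
    \<comment> \<open>Enlarging the index set to a full box lets the sum factor into one sum for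
      each form.\<close>
    also have "\<dots> \<le> (\<Sum>k\<in>PiE B (\<lambda>b. {- int L..int L}). real C0 * g k)"
    proof (rule sum_mono2)
      show "finite (PiE B (\<lambda>b. {- int L..int L}))" using B by (intro finite_PiE) auto
      show "\<kappa> ` J \<subseteq> PiE B (\<lambda>b. {- int L..int L})"
        unfolding \<kappa>_def by (intro image_subsetI restrict_PiE_iff[THEN iffD2] ballI L)
    qed (use g0 in auto)
    also have "\<dots> = real C0 * (\<Prod>b\<in>B. \<Sum>n\<in>{- int L..int L}. exp 1 * exp (- \<eta> b * \<bar>real_of_int n - \<sigma> b\<bar>))"
    proof -
      have "(\<Prod>b\<in>B. \<Sum>n\<in>{- int L..int L}. exp 1 * exp (- \<eta> b * \<bar>real_of_int n - \<sigma> b\<bar>))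
         = (\<Sum>k\<in>PiE B (\<lambda>b. {- int L..int L}). g k)"
        unfolding g_def by (rule prod_sum_PiE) (use B in auto)
      then show ?thesis by (simp only: sum_distrib_left)
    qed
    also have "\<dots> \<le> real C0 * (\<Prod>b\<in>B. exp 1 * (4 * exp 1) * (1 / \<eta> b))"
    proof (intro mult_left_mono prod_mono conjI)
      fix b assume b: "b \<in> B"
      show "(\<Sum>n\<in>{- int L..int L}. exp 1 * exp (- \<eta> b * \<bar>real_of_int n - \<sigma> b\<bar>)) \<le> exp 1 * (4 * exp 1) * (1 / \<eta> b)"
        unfolding sum_distrib_left[symmetric]
        using mult_left_mono[OF sum_exp_abs_int_le[of "\<eta> b" "{- int L..int L}" "\<sigma> b"], of "exp 1"] \<eta>[OF b]
        by (simp add: mult.assoc)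
      show "0 \<le> (\<Sum>n\<in>{- int L..int L}. exp 1 * exp (- \<eta> b * \<bar>real_of_int n - \<sigma> b\<bar>))"
        by (intro sum_nonneg) simp
    qed simp
    also have "\<dots> = real C0 * exp 1 ^ card B * (4 * exp 1) ^ card B * (\<Prod>b\<in>B. 1 / \<eta> b)"
      by (simp only: prod.distrib prod_constant mult_ac power_mult_distrib)
    finally show "(\<Sum>j\<in>J. \<Prod>b\<in>B. exp (- \<eta> b * \<bar>b \<bullet> rvec j - \<sigma> b\<bar>))
      \<le> real C0 * exp 1 ^ card B * (4 * exp 1) ^ card B * (\<Prod>b\<in>B. 1 / \<eta> b)" .
  qed
qed


text \<open>Here \<tau> measures the logarithmic distance to the critical scale. For \<tau> < 0 the
  gain from integration by parts outweighs the growth \<open>-c \<tau>\<close>, because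
  \<open>M > c\<close>. For \<tau> \<ge> 0 there is decay \<open>c \<tau>\<close>, and half of it is
  traded for decay in \<open>Y\<close>.\<close>

lemma exponent_le:
  fixes c M \<tau> Y x :: real
  assumes "0 < c" "c < M" "0 \<le> Y" "x \<le> \<tau> - Y" "0 < \<eta>" "\<eta> \<le> M - c" "\<eta> \<le> c / 2"
  shows "- c * \<tau> + M * min 0 x \<le> - \<eta> * (\<bar>\<tau>\<bar> + Y)"
proof (cases "\<tau> < 0")
  case True
  have "M * min 0 x \<le> M * (\<tau> - Y)" using assms by (intro mult_left_mono) auto
  moreover have "(M - c) * \<tau> \<le> \<eta> * \<tau>" using True assms by (intro mult_right_mono_neg) auto
  moreover have "\<eta> * Y \<le> M * Y" using assms by (intro mult_right_mono) auto
  ultimately show ?thesis using True by (simp add: algebra_simps)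
next
  case False
  have "M * min 0 x \<le> (c / 2) * (\<tau> - Y)"
  proof -
    \<comment> \<open>\<open>min 0 x \<le> q x\<close> holds for every \<open>q\<close> in [0, 1];
      this \<open>q\<close> spends exactly half of the decay.\<close>
    have "min 0 x \<le> (c / (2 * M)) * x"
    proof (cases "x \<ge> 0")
      case False
      have "c / (2 * M) \<le> 1" using assms by (simp add: field_simps)
      then show ?thesis using False mult_right_mono_neg[of "c / (2 * M)" 1 x] by simp
    qed (use assms in simp)
    then have "M * min 0 x \<le> M * ((c / (2 * M)) * x)" using assms by (intro mult_left_mono) auto
    also have "\<dots> = (c / 2) * x" using assms by simp
    also have "\<dots> \<le> (c / 2) * (\<tau> - Y)" using assms by (intro mult_left_mono) auto
    finally show ?thesis .
  qed
  moreover have "\<eta> * \<tau> \<le> (c / 2) * \<tau>" using False assms by (intro mult_right_mono) auto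
  moreover have "\<eta> * Y \<le> (c / 2) * Y" using assms by (intro mult_right_mono) auto
  ultimately show ?thesis using False by (simp add: algebra_simps)
qed

text \<open>
  Complete \<open>insert p D\<close> to a basis.  The hypotheses give decay at a fixed rate in \<open>p\<close> and \<open>D\<close>; decay at rate
  \<open>1/(1 + s)\<close> in each of the other directions comes for free, and costs a factor \<open>1 + s\<close> each.
\<close>

lemma dyadic_sum_le:
  fixes p :: "real ^ 'n::finite" and D :: "(real ^ 'n) set" and V :: "(nat ^ 'n) set"
  assumes p: "\<And>i. 0 < p $ i" and cM: "0 < c" "c < M"
    and ind: "independent (insert p D)" "p \<notin> D"
    and low0: "\<And>t. (\<And>i. 0 \<le> t $ i) \<Longrightarrow> min_weight V t \<le> p \<bullet> t"
    and low: "\<And>t u. (\<And>i. 0 \<le> t $ i) \<Longrightarrow> u \<in> D \<Longrightarrow> min_weight V t \<le> p \<bullet> t - \<bar>u \<bullet> t\<bar>"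
  shows "\<exists>C>0. \<forall>s J. s \<ge> 0 \<longrightarrow> finite J \<longrightarrow>
     (\<Sum>j\<in>J. exp (- c * ln 2 * (p \<bullet> rvec j) + M * min 0 (min_weight V (ln 2 *\<^sub>R rvec j) - s)))
       \<le> C * exp (- c * s) * (1 + s) ^ (CARD('n) - (card D + 1))"
proof -
  have fD: "finite D" using independent_imp_finite[OF ind(1)] by simp
  have "\<exists>B. insert p D \<subseteq> B \<and> independent B \<and> UNIV \<subseteq> span B"
    by (rule maximal_independent_subset_extend[of "insert p D" UNIV]) (use ind(1) in auto)
  then obtain B where B: "insert p D \<subseteq> B" "independent B" "span B = UNIV"
    by (metis top.extremum_unique)
  have fB: "finite B" using independent_imp_finite[OF B(2)] .
  have cardB: "card B = CARD('n)"
    using dim_eq_card_independent[OF B(2)] dim_span[of B] B(3) by simp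
  define Z where "Z = B - insert p D"
  have BZ: "B = insert p (D \<union> Z)" "p \<notin> D \<union> Z" "D \<inter> Z = {}" "finite Z"
    using B ind(2) fB by (auto simp: Z_def)
  have cardZ: "card Z = CARD('n) - (card D + 1)"
    using cardB B(1) fD ind(2) fB by (simp add: Z_def card_Diff_subset)
  obtain C where C: "C > 0" "\<And>\<eta> \<sigma> J. finite J \<Longrightarrow> \<forall>b\<in>B. 0 < \<eta> b \<and> \<eta> b \<le> 1 \<Longrightarrow>
     (\<Sum>j\<in>J. \<Prod>b\<in>B. exp (- \<eta> b * \<bar>b \<bullet> rvec j - \<sigma> b\<bar>)) \<le> C * (\<Prod>b\<in>B. 1 / \<eta> b)"
    using lattice_sum_le[OF fB B(3)] by auto
  define \<eta> where "\<eta> = min 1 (min (M - c) (c / 2))"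
  have \<eta>: "0 < \<eta>" "\<eta> \<le> M - c" "\<eta> \<le> c / 2" "\<eta> \<le> 1" unfolding \<eta>_def using cM by linarith+
  \<comment> \<open>The bound holds for each \<open>u\<close> separately; summing over
    \<open>D\<close> costs \<open>card D\<close>. The summand 1 covers empty
    \<open>D\<close>.\<close>
  define \<theta> where "\<theta> = 1 / (1 + real (card D))"
  have \<theta>: "0 < \<theta>" "\<theta> \<le> 1" by (auto simp: \<theta>_def)
  obtain \<mu> where \<mu>: "0 < \<mu>" "\<And>i. \<mu> \<le> p $ i"
    using p by (intro that[of "Min (range (($) p))"]) auto
  \<comment> \<open>On the nonnegative orthant the norm is at most
    \<open>p \<bullet> t / \<mu>\<close>, so \<open>p\<close> controls every form in
    \<open>Z\<close>.\<close>
  define K where "K = (\<Sum>z\<in>Z. norm z) / \<mu>"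
  have K0: "0 \<le> K" using \<mu> by (auto simp: K_def intro!: divide_nonneg_pos sum_nonneg)
  have K: "(\<Sum>z\<in>Z. \<bar>z \<bullet> t\<bar>) \<le> K * (p \<bullet> t)" if t: "\<And>i. 0 \<le> t $ i" for t
  proof -
    have "\<mu> * norm t \<le> \<mu> * (\<Sum>i\<in>UNIV. t $ i)"
      using \<mu>(1) t norm_le_l1_cart[of t] by (intro mult_left_mono) auto
    also have "\<dots> \<le> (\<Sum>i\<in>UNIV. p $ i * t $ i)"
      unfolding sum_distrib_left using \<mu>(2) t by (intro sum_mono mult_right_mono) auto
    finally have nt: "\<mu> * norm t \<le> p \<bullet> t" by (simp add: inner_vec_def)
    have "(\<Sum>z\<in>Z. \<bar>z \<bullet> t\<bar>) \<le> (\<Sum>z\<in>Z. norm z * norm t)"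
      by (intro sum_mono Cauchy_Schwarz_ineq2)
    also have "\<dots> = K * (\<mu> * norm t)" using \<mu> by (simp add: K_def flip: sum_distrib_right)
    also have "\<dots> \<le> K * (p \<bullet> t)" using nt K0 by (intro mult_left_mono) auto
    finally show ?thesis .
  qed
  define \<kappa> where "\<kappa> = \<eta> / (2 * (K + 1))"
  have \<kappa>: "0 < \<kappa>" "\<kappa> \<le> 1" "\<kappa> * K \<le> \<eta> / 2"
  proof -
    have "K / (2 * (K + 1)) \<le> 1 / 2" using K0 by (simp add: pos_divide_le_eq)
    from mult_left_mono[OF this, of \<eta>] \<eta> show "\<kappa> * K \<le> \<eta> / 2"
      unfolding \<kappa>_def by (simp only: times_divide_eq_left times_divide_eq_right mult_1_right less_imp_le)
    show "0 < \<kappa>" "\<kappa> \<le> 1" using \<eta> K0 by (simp_all add: \<kappa>_def pos_divide_le_eq)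
  qed
  define a where "a = ln (2::real)"
  have a: "0 < a" "a \<le> 1" using ln_2_less_1 by (auto simp: a_def)
  let ?C1 = "(1 / (a * (\<eta> / 2))) * (1 / (a * (\<eta> * \<theta>))) ^ card D * (1 / (a * \<kappa>)) ^ card Z"
  show ?thesis
  proof (rule exI[of _ "exp (\<eta> / 2) * C * ?C1"], intro conjI allI impI)
    show "0 < exp (\<eta> / 2) * C * ?C1" using C a \<eta> \<theta> \<kappa> by (intro mult_pos_pos zero_less_power divide_pos_pos) auto
    fix s :: real and J :: "(nat ^ 'n) set"
    assume s: "0 \<le> s" and J: "finite J"
    \<comment> \<open>The factor \<open>a = ln 2\<close> converts \<open>rvec j\<close> into
      \<open>t\<close>. The form \<open>p\<close> gets only half of the available rate; the other
      half pays for the forms in \<open>Z\<close>.\<close>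
    define e where "e b = (if b = p then a * (\<eta> / 2) else if b \<in> D then a * (\<eta> * \<theta>) else a * (\<kappa> / (1 + s)))" for b
    define \<sigma> where "\<sigma> b = (if b = p then s / a else 0)" for b
    have e: "0 < e b \<and> e b \<le> 1" for b
    proof -
      have "\<eta> / 2 \<le> 1" "\<eta> * \<theta> \<le> 1" "\<kappa> / (1 + s) \<le> 1"
        using \<eta> \<theta> \<kappa> s by (simp_all add: mult_le_one pos_divide_le_eq)
      moreover have "0 < \<eta> / 2" "0 < \<eta> * \<theta>" "0 < \<kappa> / (1 + s)" using \<eta> \<theta> \<kappa> s by simp_all
      moreover have "0 < a * y \<and> a * y \<le> 1" if "0 < y" "y \<le> 1" for y
        using that a by (simp add: mult_le_one)
      ultimately have "0 < a * (\<eta> / 2) \<and> a * (\<eta> / 2) \<le> 1" "0 < a * (\<eta> * \<theta>) \<and> a * (\<eta> * \<theta>) \<le> 1"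
          "0 < a * (\<kappa> / (1 + s)) \<and> a * (\<kappa> / (1 + s)) \<le> 1"
        by blast+
      then show ?thesis unfolding e_def by presburger
    qed
    have split: "(\<Prod>b\<in>B. f b) = f p * ((\<Prod>b\<in>D. f b) * (\<Prod>b\<in>Z. f b))" for f :: "_ \<Rightarrow> real"
      unfolding BZ(1) using BZ fD by (simp add: prod.union_disjoint)
    have splits: "(\<Sum>b\<in>B. f b) = f p + ((\<Sum>b\<in>D. f b) + (\<Sum>b\<in>Z. f b))" for f :: "_ \<Rightarrow> real"
      unfolding BZ(1) using BZ fD by (simp add: sum.union_disjoint)
    have pt: "exp (- c * ln 2 * (p \<bullet> rvec j) + M * min 0 (min_weight V (ln 2 *\<^sub>R rvec j) - s))
       \<le> exp (\<eta> / 2) * exp (- c * s) * (\<Prod>b\<in>B. exp (- e b * \<bar>b \<bullet> rvec j - \<sigma> b\<bar>))" for j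
    proof -
      define t where "t = a *\<^sub>R rvec j"
      have t: "0 \<le> t $ i" for i using a by (simp add: t_def)
      define \<tau> where "\<tau> = p \<bullet> t - s"
      define Y where "Y = \<theta> * (\<Sum>u\<in>D. \<bar>u \<bullet> t\<bar>)"
      have Y0: "0 \<le> Y" using \<theta> by (auto simp: Y_def intro!: mult_nonneg_nonneg sum_nonneg)
      have mY: "min_weight V t - s \<le> \<tau> - Y"
      proof -
        have "(\<Sum>u\<in>D. \<bar>u \<bullet> t\<bar>) \<le> (\<Sum>u\<in>D. p \<bullet> t - min_weight V t)"
          using low[OF t] by (intro sum_mono) (simp add: le_diff_eq algebra_simps)
        also have "\<dots> \<le> (1 + real (card D)) * (p \<bullet> t - min_weight V t)"
          using low0[OF t] by (simp add: algebra_simps)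
        finally have "Y \<le> p \<bullet> t - min_weight V t"
          by (simp add: Y_def \<theta>_def pos_divide_le_eq mult.commute)
        then show ?thesis by (simp add: \<tau>_def)
      qed
      have 1: "- c * \<tau> + M * min 0 (min_weight V t - s) \<le> - \<eta> * (\<bar>\<tau>\<bar> + Y)"
        by (rule exponent_le[OF cM Y0 mY \<eta>(1-3)])
      \<comment> \<open>\<open>p \<bullet> t = s + \<tau>\<close> bounds the forms in
        \<open>Z\<close> by \<open>K (s + |\<tau>|)\<close>; after division by \<open>1 + s\<close>
        this costs at most half of the decay in \<tau> and a constant.\<close>
      have 2: "\<kappa> / (1 + s) * (\<Sum>z\<in>Z. \<bar>z \<bullet> t\<bar>) \<le> \<eta> / 2 + \<eta> / 2 * \<bar>\<tau>\<bar>"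
      proof -
        have "(\<Sum>z\<in>Z. \<bar>z \<bullet> t\<bar>) \<le> K * (s + \<bar>\<tau>\<bar>)"
          by (rule order_trans[OF K[OF t] mult_left_mono[OF _ K0]]) (simp add: \<tau>_def)
        also have "\<dots> \<le> K * ((1 + s) * (1 + \<bar>\<tau>\<bar>))"
        proof (intro mult_left_mono K0)
          have "(1 + s) * (1 + \<bar>\<tau>\<bar>) = 1 + s + \<bar>\<tau>\<bar> + s * \<bar>\<tau>\<bar>" by (simp add: algebra_simps)
          then show "s + \<bar>\<tau>\<bar> \<le> (1 + s) * (1 + \<bar>\<tau>\<bar>)" using s by simp
        qed
        finally have "\<kappa> / (1 + s) * (\<Sum>z\<in>Z. \<bar>z \<bullet> t\<bar>) \<le> \<kappa> / (1 + s) * (K * ((1 + s) * (1 + \<bar>\<tau>\<bar>)))"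
          using \<kappa> s by (intro mult_left_mono) auto
        also have "\<dots> = (\<kappa> * K) * (1 + \<bar>\<tau>\<bar>)" using s by simp
        also have "\<dots> \<le> (\<eta> / 2) * (1 + \<bar>\<tau>\<bar>)" using \<kappa> by (intro mult_right_mono) auto
        finally show ?thesis by (simp only: distrib_left mult_1_right)
      qed
      have 3: "(\<Sum>b\<in>B. e b * \<bar>b \<bullet> rvec j - \<sigma> b\<bar>)
          = \<eta> / 2 * \<bar>\<tau>\<bar> + (\<eta> * Y + \<kappa> / (1 + s) * (\<Sum>z\<in>Z. \<bar>z \<bullet> t\<bar>))"
      proof -
        have "\<tau> = a * (p \<bullet> rvec j - s / a)" using a by (simp add: \<tau>_def t_def algebra_simps)
        then have ep: "e p * \<bar>p \<bullet> rvec j - \<sigma> p\<bar> = \<eta> / 2 * \<bar>\<tau>\<bar>"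
          using a by (simp add: e_def \<sigma>_def abs_mult)
        have "e u * \<bar>u \<bullet> rvec j - \<sigma> u\<bar> = \<eta> * \<theta> * \<bar>u \<bullet> t\<bar>" if "u \<in> D" for u
          using a that ind(2) by (auto simp: e_def \<sigma>_def abs_mult t_def)
        moreover have "e z * \<bar>z \<bullet> rvec j - \<sigma> z\<bar> = \<kappa> / (1 + s) * \<bar>z \<bullet> t\<bar>" if "z \<in> Z" for z
          using a that BZ by (auto simp: e_def \<sigma>_def abs_mult t_def)
        ultimately show ?thesis unfolding splits ep by (simp add: Y_def sum_distrib_left mult.assoc)
      qed
      have pj: "- c * ln 2 * (p \<bullet> rvec j) = - c * s - c * \<tau>"
        by (simp add: \<tau>_def t_def a_def algebra_simps)
      have tj: "ln 2 *\<^sub>R rvec j = t" by (simp add: t_def a_def)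
      have "- \<eta> * (\<bar>\<tau>\<bar> + Y) = - (\<eta> / 2 * \<bar>\<tau>\<bar>) - \<eta> / 2 * \<bar>\<tau>\<bar> - \<eta> * Y" by (simp add: algebra_simps)
      moreover have "(\<Sum>b\<in>B. - e b * \<bar>b \<bullet> rvec j - \<sigma> b\<bar>) = - (\<Sum>b\<in>B. e b * \<bar>b \<bullet> rvec j - \<sigma> b\<bar>)"
        by (simp add: sum_negf)
      ultimately have "- c * ln 2 * (p \<bullet> rvec j) + M * min 0 (min_weight V (ln 2 *\<^sub>R rvec j) - s)
         \<le> \<eta> / 2 + (- c * s) + (\<Sum>b\<in>B. - e b * \<bar>b \<bullet> rvec j - \<sigma> b\<bar>)"
        using 1 2 3 unfolding pj tj by linarith
      then have "exp (- c * ln 2 * (p \<bullet> rvec j) + M * min 0 (min_weight V (ln 2 *\<^sub>R rvec j) - s))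
         \<le> exp (\<eta> / 2 + (- c * s) + (\<Sum>b\<in>B. - e b * \<bar>b \<bullet> rvec j - \<sigma> b\<bar>))" by simp
      then show ?thesis by (simp only: exp_add exp_sum[OF fB])
    qed
    have prodB: "(\<Prod>b\<in>B. 1 / e b) = ?C1 * (1 + s) ^ card Z"
    proof -
      have "(\<Prod>b\<in>D. 1 / e b) = (\<Prod>b\<in>D. 1 / (a * (\<eta> * \<theta>)))"
        using ind(2) by (intro prod.cong) (auto simp: e_def)
      moreover have "(\<Prod>b\<in>Z. 1 / e b) = (\<Prod>b\<in>Z. (1 / (a * \<kappa>)) * (1 + s))"
        using BZ by (intro prod.cong) (auto simp: e_def)
      moreover have "1 / e p = 1 / (a * (\<eta> / 2))" by (simp add: e_def)
      ultimately show ?thesis unfolding split by (simp only: prod_constant power_mult_distrib mult_ac)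
    qed
    have "(\<Sum>j\<in>J. exp (- c * ln 2 * (p \<bullet> rvec j) + M * min 0 (min_weight V (ln 2 *\<^sub>R rvec j) - s)))
       \<le> exp (\<eta> / 2) * exp (- c * s) * (\<Sum>j\<in>J. (\<Prod>b\<in>B. exp (- e b * \<bar>b \<bullet> rvec j - \<sigma> b\<bar>)))"
      unfolding sum_distrib_left by (rule sum_mono) (rule pt)
    also have "\<dots> \<le> exp (\<eta> / 2) * exp (- c * s) * (C * (\<Prod>b\<in>B. 1 / e b))"
      using C(2)[OF J ballI[OF e]] by (intro mult_left_mono) auto
    finally show "(\<Sum>j\<in>J. exp (- c * ln 2 * (p \<bullet> rvec j) + M * min 0 (min_weight V (ln 2 *\<^sub>R rvec j) - s)))
       \<le> exp (\<eta> / 2) * C * ?C1 * exp (- c * s) * (1 + s) ^ (CARD('n) - (card D + 1))"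
      unfolding prodB by (simp add: cardZ mult_ac)
  qed
qed


subsection \<open>Dyadic decomposition\<close>

lemma dyadic_cover:
  fixes x :: "real ^ 'n::finite"
  assumes "\<And>i. 0 < \<bar>x $ i\<bar>" "\<And>i. \<bar>x $ i\<bar> \<le> 1"
  obtains j :: "nat ^ 'n" where "\<And>i. (1/2) ^ Suc (j $ i) < \<bar>x $ i\<bar>" "\<And>i. \<bar>x $ i\<bar> \<le> (1/2) ^ (j $ i)"
proof -
  have "\<exists>k. (1/2) ^ Suc k < y \<and> y \<le> (1/2) ^ k" if y: "0 < y" "y \<le> 1" for y :: real
  proof -
    obtain n where n: "(1/2) ^ n < y" using real_arch_pow_inv[of y "1/2"] y by auto
    define k where "k = (LEAST n. (1/2) ^ n < y)"
    have k: "(1/2) ^ k < y" unfolding k_def by (rule LeastI[of _ n]) (rule n)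
    have "k \<noteq> 0" using k y by (intro notI) simp
    then obtain m where m: "k = Suc m" by (cases k) auto
    have "\<not> (1/2) ^ m < y" using not_less_Least[of m "\<lambda>n. (1/2) ^ n < y"] m by (simp add: k_def)
    then show ?thesis using k m by (intro exI[of _ m]) auto
  qed
  then have "\<exists>k. \<forall>i. (1/2) ^ Suc (k i) < \<bar>x $ i\<bar> \<and> \<bar>x $ i\<bar> \<le> (1/2) ^ k i"
    using assms by (intro choice allI) auto
  then obtain k where "\<And>i. (1/2) ^ Suc (k i) < \<bar>x $ i\<bar> \<and> \<bar>x $ i\<bar> \<le> (1/2) ^ k i" by blast
  then show thesis by (intro that[of "\<chi> i. k i"]) auto
qed

lemma half_power_eq_exp: "(1/2::real) ^ k = exp (- (ln 2 * real k))"
proof -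
  have "(1/2::real) ^ k = exp (- ln 2) ^ k" by (simp add: exp_minus inverse_eq_divide)
  then show ?thesis by (simp add: exp_of_nat_mult[symmetric] mult.commute)
qed

lemma prod_half_power_eq_exp:
  "(\<Prod>i\<in>UNIV. ((1/2::real) ^ (j $ i)) ^ (v $ i)) = exp (- (ln 2 * (rvec v \<bullet> rvec (j :: nat ^ 'n::finite))))"
proof -
  have "(\<Prod>i\<in>UNIV. ((1/2::real) ^ (j $ i)) ^ (v $ i)) = (\<Prod>i\<in>UNIV. exp (- (ln 2 * real (j $ i * v $ i))))"
    unfolding power_mult[symmetric] by (simp only: half_power_eq_exp)
  then have "(\<Prod>i\<in>UNIV. ((1/2::real) ^ (j $ i)) ^ (v $ i)) = exp (\<Sum>i\<in>UNIV. - (ln 2 * real (j $ i * v $ i)))"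
    by (simp only: exp_sum[OF finite])
  moreover have "(\<Sum>i\<in>UNIV. - (ln 2 * real (j $ i * v $ i))) = - (ln 2 * (rvec v \<bullet> rvec j))"
    by (simp add: inner_vec_def sum_negf sum_distrib_left mult_ac)
  ultimately show ?thesis by simp
qed

lemma emeasure_dyadic_le:
  fixes j :: "nat ^ 'n::finite"
  shows "emeasure lborel {x :: real ^ 'n. \<forall>i. \<bar>x $ i\<bar> \<le> (1/2) ^ (j $ i)}
     = ennreal (2 ^ CARD('n) * exp (- (ln 2 * (rvec 1 \<bullet> rvec j))))"
proof -
  let ?b = "\<chi> i. (1/2::real) ^ (j $ i)"
  have eq: "{x :: real ^ 'n. \<forall>i. \<bar>x $ i\<bar> \<le> (1/2) ^ (j $ i)} = cbox (- ?b) ?b"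
    by (simp add: set_eq_iff mem_box_cart abs_le_iff minus_le_iff conj_commute)
  have ne: "cbox (- ?b) ?b \<noteq> {}" by (auto simp: interval_ne_empty_cart)
  have "emeasure lborel (cbox (- ?b) ?b) = ennreal (measure lborel (cbox (- ?b) ?b))"
    by (rule emeasure_eq_ennreal_measure) (metis emeasure_lborel_cbox_finite infinity_ennreal_def less_irrefl)
  moreover have "measure lborel (cbox (- ?b) ?b) = (\<Prod>i\<in>UNIV. 2 * (1/2::real) ^ (j $ i))"
    using content_cbox_cart[OF ne] by simp
  moreover have "\<dots> = 2 ^ CARD('n) * (\<Prod>i\<in>UNIV. ((1/2::real) ^ (j $ i)) ^ ((1 :: nat ^ 'n) $ i))"
    by (simp add: prod.distrib)
  ultimately show ?thesis unfolding eq prod_half_power_eq_exp by simp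
qed

text \<open>The nested full boxes \<open>A j\<close> replace the dyadic shells: their measure is
  larger by the factor \<open>2 ^ CARD('n)\<close> only. The shells miss just the coordinate
  hyperplanes, a null set.\<close>

lemma nn_integral_dyadic_le:
  fixes F :: "real ^ 'n::finite \<Rightarrow> ennreal" and S :: "(real ^ 'n) set" and G :: "nat ^ 'n \<Rightarrow> real"
  assumes S: "\<And>x i. x \<in> S \<Longrightarrow> \<bar>x $ i\<bar> \<le> 1"
    and F: "\<And>x j. x \<in> S \<Longrightarrow> (\<And>i. (1/2) ^ Suc (j $ i) < \<bar>x $ i\<bar>) \<Longrightarrow> (\<And>i. \<bar>x $ i\<bar> \<le> (1/2) ^ (j $ i))
       \<Longrightarrow> F x \<le> ennreal (G j)"
    and G0: "\<And>j. 0 \<le> G j"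
    and sum: "\<And>J. finite J \<Longrightarrow> (\<Sum>j\<in>J. G j * exp (- (ln 2 * (rvec 1 \<bullet> rvec j)))) \<le> B"
  shows "(\<integral>\<^sup>+x\<in>S. F x \<partial>lborel) \<le> ennreal (2 ^ CARD('n) * B)"
proof -
  define A where "A j = {x :: real ^ 'n. \<forall>i. \<bar>x $ i\<bar> \<le> (1/2) ^ (j $ i)}" for j :: "nat ^ 'n"
  have "closed (A j)" for j unfolding A_def
    by (intro closed_Collect_all closed_Collect_le continuous_intros)
  then have mA [measurable]: "A j \<in> sets lborel" for j using borel_closed by simp
  \<comment> \<open>Boxes are numbered by \<open>to_nat\<close>; numbers that code no box contribute
    0, so partial sums are sums over finite sets of boxes.\<close>
  define a where "a n x = (if n \<in> range (to_nat :: nat ^ 'n \<Rightarrow> nat) then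
      ennreal (G (from_nat n)) * indicator (A (from_nat n)) x else 0)" for n x
  have ma [measurable]: "a n \<in> borel_measurable lborel" for n unfolding a_def by simp
  have "AE x in lborel. \<forall>i\<in>UNIV. (x :: real ^ 'n) $ i \<noteq> 0"
  proof (rule AE_finite_allI)
    fix i :: 'n
    have "{x :: real ^ 'n. x $ i = 0} \<in> null_sets lebesgue"
      using negligible_standard_hyperplane_cart[of i] by (simp add: negligible_iff_null_sets)
    then have "{x :: real ^ 'n. x $ i = 0} \<in> null_sets lborel"
      by (subst (asm) null_sets_completion_iff) (auto intro!: borel_closed closed_Collect_eq continuous_intros)
    from AE_not_in[OF this] show "AE x in lborel. (x :: real ^ 'n) $ i \<noteq> 0" by simp
  qed simp
  then have "AE x in lborel. F x * indicator S x \<le> (\<Sum>n. a n x)"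
  proof (rule AE_mp, intro AE_I2 impI)
    fix x :: "real ^ 'n" assume x: "\<forall>i\<in>UNIV. x $ i \<noteq> 0"
    show "F x * indicator S x \<le> (\<Sum>n. a n x)"
    proof (cases "x \<in> S")
      case True
      obtain j where j: "\<And>i. (1/2) ^ Suc (j $ i) < \<bar>x $ i\<bar>" "\<And>i. \<bar>x $ i\<bar> \<le> (1/2) ^ (j $ i)"
        using dyadic_cover[of x] x S[OF True] by auto
      have "F x \<le> ennreal (G j)" by (rule F[OF True j])
      also have "\<dots> = a (to_nat j) x" using j(2) by (simp add: a_def A_def)
      also have "\<dots> \<le> (\<Sum>n. a n x)"
        using sum_le_suminf[of "\<lambda>n. a n x" "{to_nat j}"] by simp
      finally show ?thesis using True by simp
    qed simp
  qed
  then have "(\<integral>\<^sup>+x\<in>S. F x \<partial>lborel) \<le> (\<integral>\<^sup>+x. (\<Sum>n. a n x) \<partial>lborel)"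
    by (rule nn_integral_mono_AE)
  also have "\<dots> = (\<Sum>n. \<integral>\<^sup>+x. a n x \<partial>lborel)" by (rule nn_integral_suminf) simp
  also have "\<dots> \<le> ennreal (2 ^ CARD('n) * B)"
  proof (rule suminf_le_const[OF summableI])
    fix N
    have int: "(\<integral>\<^sup>+x. a (to_nat j) x \<partial>lborel) = ennreal (2 ^ CARD('n) * (G j * exp (- (ln 2 * (rvec 1 \<bullet> rvec j)))))" for j
    proof -
      have "(\<integral>\<^sup>+x. a (to_nat j) x \<partial>lborel) = ennreal (G j) * emeasure lborel (A j)"
        using nn_integral_cmult_indicator[OF mA[of j]] by (simp add: a_def)
      then show ?thesis
        unfolding A_def emeasure_dyadic_le using G0 by (simp add: ennreal_mult[symmetric] mult_ac)
    qed
    define J where "J = {j :: nat ^ 'n. to_nat j < N}"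
    have fJ: "finite J"
      unfolding J_def by (rule finite_imageD[of to_nat]) (auto intro: finite_subset[of _ "{..<N}"] inj_on_subset[OF inj_to_nat])
    have "(\<Sum>n<N. \<integral>\<^sup>+x. a n x \<partial>lborel) = (\<Sum>n\<in>to_nat ` J. \<integral>\<^sup>+x. a n x \<partial>lborel)"
    proof (rule sum.mono_neutral_right)
      show "\<forall>n\<in>{..<N} - to_nat ` J. (\<integral>\<^sup>+x. a n x \<partial>lborel) = 0"
      proof
        fix n assume "n \<in> {..<N} - to_nat ` J"
        then have "n \<notin> range (to_nat :: nat ^ 'n \<Rightarrow> nat)" by (auto simp: J_def)
        then show "(\<integral>\<^sup>+x. a n x \<partial>lborel) = 0" by (simp add: a_def)
      qed
    qed (auto simp: J_def)
    also have "\<dots> = (\<Sum>j\<in>J. \<integral>\<^sup>+x. a (to_nat j) x \<partial>lborel)"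
      by (rule sum.reindex_cong[of to_nat]) (auto intro: inj_on_subset[OF inj_to_nat])
    also have "\<dots> = ennreal (\<Sum>j\<in>J. 2 ^ CARD('n) * (G j * exp (- (ln 2 * (rvec 1 \<bullet> rvec j)))))"
      unfolding int using G0 by (simp add: sum_ennreal)
    also have "\<dots> \<le> ennreal (2 ^ CARD('n) * B)"
      unfolding sum_distrib_left[symmetric] using sum[OF fJ] by (intro ennreal_leI mult_left_mono) auto
    finally show "(\<Sum>n<N. \<integral>\<^sup>+x. a n x \<partial>lborel) \<le> ennreal (2 ^ CARD('n) * B)" .
  qed
  finally show ?thesis .
qed

text \<open>On a dyadic shell the weight is bounded below by its largest monomial. Box bound times
  volume is then the summand of \<open>dyadic_sum_le\<close> at \<open>s = ln l\<close>, because
  \<open>\<beta> + 1 = c p\<close>.\<close>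

lemma nn_integral_monomial_weight_le:
  fixes p :: "real ^ 'n::finite" and D :: "(real ^ 'n) set" and V :: "(nat ^ 'n) set"
  assumes V: "finite V" "V \<noteq> {}" and S: "\<And>x i. x \<in> S \<Longrightarrow> \<bar>x $ i\<bar> \<le> 1"
    and cM: "0 < c" "c < real M" and p: "rvec (\<beta> + 1) = c *\<^sub>R p"
    and ind: "independent (insert p D)" "p \<notin> D"
    and low0: "\<And>t. (\<And>i. 0 \<le> t $ i) \<Longrightarrow> min_weight V t \<le> p \<bullet> t"
    and low: "\<And>t u. (\<And>i. 0 \<le> t $ i) \<Longrightarrow> u \<in> D \<Longrightarrow> min_weight V t \<le> p \<bullet> t - \<bar>u \<bullet> t\<bar>"
  shows "\<exists>C>0. \<forall>l\<ge>1. (\<integral>\<^sup>+x\<in>S. ennreal (\<bar>mpow x \<beta>\<bar> * inverse (1 + l * monomial_weight V x) ^ M) \<partial>lborel)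
     \<le> ennreal (C * l powr (- c) * (1 + ln l) ^ (CARD('n) - (card D + 1)))"
proof -
  have pp: "0 < p $ i" for i
  proof -
    have "c * p $ i = rvec (\<beta> + 1) $ i" unfolding p by simp
    also have "\<dots> > 0" by simp
    finally show ?thesis using cM by (simp add: zero_less_mult_iff)
  qed
  have "\<exists>C>0. \<forall>s J. s \<ge> 0 \<longrightarrow> finite J \<longrightarrow>
     (\<Sum>j\<in>J. exp (- c * ln 2 * (p \<bullet> rvec j) + real M * min 0 (min_weight V (ln 2 *\<^sub>R rvec j) - s)))
       \<le> C * exp (- c * s) * (1 + s) ^ (CARD('n) - (card D + 1))"
  proof (rule dyadic_sum_le[OF pp cM ind])
    show "min_weight V t \<le> p \<bullet> t" if "\<And>i. 0 \<le> t $ i" for t by (rule low0) (rule that)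
    show "min_weight V t \<le> p \<bullet> t - \<bar>u \<bullet> t\<bar>" if "\<And>i. 0 \<le> t $ i" "u \<in> D" for t u
      by (rule low) (rule that)+
  qed
  then obtain C where C: "C > 0" "\<forall>s J. s \<ge> 0 \<longrightarrow> finite J \<longrightarrow>
     (\<Sum>j\<in>J. exp (- c * ln 2 * (p \<bullet> rvec j) + real M * min 0 (min_weight V (ln 2 *\<^sub>R rvec j) - s)))
       \<le> C * exp (- c * s) * (1 + s) ^ (CARD('n) - (card D + 1))"
    by (elim exE conjE)
  \<comment> \<open>The largest degree in \<open>V\<close>: at the lower ends
    \<open>(1/2) ^ Suc (j $ i)\<close> a monomial loses at most the factor
    \<open>2^-d\<close>.\<close>
  define d where "d = Max ((\<lambda>v. rvec v \<bullet> rvec 1) ` V)"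
  have d: "rvec v \<bullet> rvec 1 \<le> d" if "v \<in> V" for v
    unfolding d_def using V that by (intro Max_ge) auto
  obtain v0 where v0: "v0 \<in> V" using V by blast
  have d0: "0 \<le> d" using d[OF v0] by (rule order_trans[rotated]) (simp add: inner_vec_def sum_nonneg)
  let ?K = "exp (ln 2 * d * real M)"
  have main: "(\<integral>\<^sup>+x\<in>S. ennreal (\<bar>mpow x \<beta>\<bar> * inverse (1 + l * monomial_weight V x) ^ M) \<partial>lborel)
     \<le> ennreal (2 ^ CARD('n) * (?K * (C * exp (- c * ln l) * (1 + ln l) ^ (CARD('n) - (card D + 1)))))" if l: "l \<ge> 1" for l
  proof -
    define G where "G j = ?K * exp (- (ln 2 * (rvec \<beta> \<bullet> rvec j)) + real M * min 0 (min_weight V (ln 2 *\<^sub>R rvec j) - ln l))" for j :: "nat ^ 'n"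
    show ?thesis
    proof (rule nn_integral_dyadic_le[where G=G, OF S])
      show "0 \<le> G j" for j by (simp add: G_def)
      have Gj: "G j * exp (- (ln 2 * (rvec 1 \<bullet> rvec j))) = ?K * exp (- c * ln 2 * (p \<bullet> rvec j) + real M * min 0 (min_weight V (ln 2 *\<^sub>R rvec j) - ln l))" for j
      proof -
        have "rvec \<beta> + rvec 1 = c *\<^sub>R p" using p by (simp only: rvec_add)
        then have "c * (p \<bullet> rvec j) = rvec \<beta> \<bullet> rvec j + rvec 1 \<bullet> rvec j"
          by (metis inner_add_left inner_scaleR_left)
        then have "ln 2 * (c * (p \<bullet> rvec j)) = ln 2 * (rvec \<beta> \<bullet> rvec j) + ln 2 * (rvec 1 \<bullet> rvec j)"
          by (simp only: distrib_left)
        then have "- c * ln 2 * (p \<bullet> rvec j) = - (ln 2 * (rvec \<beta> \<bullet> rvec j)) + - (ln 2 * (rvec 1 \<bullet> rvec j))"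
          by (simp add: mult_ac)
        then show ?thesis by (simp add: G_def mult.assoc flip: exp_add)
      qed
      show "(\<Sum>j\<in>J. G j * exp (- (ln 2 * (rvec 1 \<bullet> rvec j)))) \<le> ?K * (C * exp (- c * ln l) * (1 + ln l) ^ (CARD('n) - (card D + 1)))"
        if "finite J" for J
        unfolding Gj sum_distrib_left[symmetric] using l by (intro mult_left_mono C(2)[rule_format] that) auto
      fix x :: "real ^ 'n" and j :: "nat ^ 'n"
      assume x: "x \<in> S" and j1: "\<And>i. (1/2) ^ Suc (j $ i) < \<bar>x $ i\<bar>" and j2: "\<And>i. \<bar>x $ i\<bar> \<le> (1/2) ^ (j $ i)"
      have w0: "0 \<le> monomial_weight V x" by (simp add: monomial_weight_def sum_nonneg)
      have m1: "\<bar>mpow x \<beta>\<bar> \<le> exp (- (ln 2 * (rvec \<beta> \<bullet> rvec j)))"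
        unfolding prod_half_power_eq_exp[symmetric] mpow_def abs_prod power_abs
        using j2 by (intro prod_mono) (auto intro: power_mono)
      have m2: "inverse (1 + l * monomial_weight V x) \<le> exp (ln 2 * d + min 0 (min_weight V (ln 2 *\<^sub>R rvec j) - ln l))"
      proof -
        have "min_weight V (ln 2 *\<^sub>R rvec j) \<in> (\<lambda>v. rvec v \<bullet> (ln 2 *\<^sub>R rvec j)) ` V"
          unfolding min_weight_def using V by (intro Min_in) auto
        then obtain v where v: "v \<in> V" "min_weight V (ln 2 *\<^sub>R rvec j) = rvec v \<bullet> (ln 2 *\<^sub>R rvec j)"
          by (elim imageE)
        have "exp (- (ln 2 * (rvec v \<bullet> rvec 1))) * exp (- (ln 2 * (rvec v \<bullet> rvec j)))
           = (\<Prod>i\<in>UNIV. ((1/2) ^ Suc (j $ i)) ^ (v $ i))"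
        proof -
          have "rvec (j + 1) = rvec 1 + rvec j" by (simp add: rvec_add)
          moreover have "(\<Prod>i\<in>UNIV. ((1/2::real) ^ Suc (j $ i)) ^ (v $ i)) = (\<Prod>i\<in>UNIV. ((1/2) ^ ((j + 1) $ i)) ^ (v $ i))"
            by simp
          ultimately show ?thesis
            unfolding prod_half_power_eq_exp by (simp add: inner_add_right algebra_simps flip: exp_add)
        qed
        also have "\<dots> \<le> \<bar>mpow x v\<bar>"
          unfolding mpow_def abs_prod power_abs
          using less_imp_le[OF j1] by (intro prod_mono conjI power_mono) (auto simp del: power_Suc)
        also have "\<dots> \<le> monomial_weight V x"
          unfolding monomial_weight_def using v V by (intro member_le_sum) auto
        finally have "exp (- (ln 2 * (rvec v \<bullet> rvec 1))) * exp (- (ln 2 * (rvec v \<bullet> rvec j))) \<le> monomial_weight V x" .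
        moreover have "exp (- (ln 2 * d)) \<le> exp (- (ln 2 * (rvec v \<bullet> rvec 1)))"
          using d[OF v(1)] by simp
        ultimately have wl: "exp (- (ln 2 * d)) * exp (- (ln 2 * (rvec v \<bullet> rvec j))) \<le> monomial_weight V x"
          by (meson exp_ge_zero mult_right_mono order_trans)
        \<comment> \<open>Up to \<open>2^-d\<close> this is the maximum of 1 and
          \<open>l exp (-m)\<close> with \<open>m\<close> the minimal weight; the two cases use the
          two summands of \<open>1 + l w\<close>.\<close>
        let ?e = "exp (- (ln 2 * d) + max 0 (ln l - min_weight V (ln 2 *\<^sub>R rvec j)))"
        have "?e \<le> 1 + l * monomial_weight V x"
        proof (cases "ln l - min_weight V (ln 2 *\<^sub>R rvec j) \<le> 0")
          case True
          then have "?e = exp (- (ln 2 * d))" by simp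
          also have "\<dots> \<le> 1" using d0 by simp
          finally show ?thesis using w0 l by (simp add: add_increasing2)
        next
          case False
          then have "?e = l * (exp (- (ln 2 * d)) * exp (- (ln 2 * (rvec v \<bullet> rvec j))))"
            using l by (simp add: v(2) exp_add exp_diff exp_minus field_simps)
          also have "\<dots> \<le> l * monomial_weight V x" using wl l by (intro mult_left_mono) auto
          finally show ?thesis by simp
        qed
        then have "inverse (1 + l * monomial_weight V x) \<le> inverse ?e" by (intro le_imp_inverse_le) auto
        also have "\<dots> = exp (ln 2 * d + min 0 (min_weight V (ln 2 *\<^sub>R rvec j) - ln l))"
          unfolding exp_minus[symmetric] by (simp add: min_def max_def)
        finally show ?thesis .
      qed
      have "\<bar>mpow x \<beta>\<bar> * inverse (1 + l * monomial_weight V x) ^ M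
          \<le> exp (- (ln 2 * (rvec \<beta> \<bullet> rvec j))) * exp (ln 2 * d + min 0 (min_weight V (ln 2 *\<^sub>R rvec j) - ln l)) ^ M"
        using m1 m2 w0 l by (intro mult_mono power_mono) auto
      also have "\<dots> = G j"
        unfolding G_def exp_of_nat_mult[symmetric] exp_add[symmetric] by (simp add: algebra_simps)
      finally show "ennreal (\<bar>mpow x \<beta>\<bar> * inverse (1 + l * monomial_weight V x) ^ M) \<le> ennreal (G j)"
        by (rule ennreal_leI)
    qed
  qed
  show ?thesis
  proof (rule exI[of _ "2 ^ CARD('n) * ?K * C"], intro conjI allI impI)
    show "0 < 2 ^ CARD('n) * ?K * C" using C by simp
    fix l :: real assume l: "1 \<le> l"
    have "exp (- c * ln l) = l powr (- c)" using l by (simp add: powr_def)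
    with main[OF l] show "(\<integral>\<^sup>+x\<in>S. ennreal (\<bar>mpow x \<beta>\<bar> * inverse (1 + l * monomial_weight V x) ^ M) \<partial>lborel)
       \<le> ennreal (2 ^ CARD('n) * ?K * C * l powr (- c) * (1 + ln l) ^ (CARD('n) - (card D + 1)))"
      by (simp add: mult.assoc)
  qed
qed


subsection \<open>Taylor remainders of \<open>C\<^sup>k\<close> functions\<close>

lemma frechet_derivative_eq_sum_pd:
  fixes f :: "real ^ 'n::finite \<Rightarrow> real"
  assumes "f differentiable (at x)"
  shows "frechet_derivative f (at x) h = (\<Sum>i\<in>UNIV. h $ i * pd i f x)"
proof -
  have lin: "linear (frechet_derivative f (at x))" by (rule linear_frechet_derivative[OF assms])
  have "frechet_derivative f (at x) h = frechet_derivative f (at x) (\<Sum>i\<in>UNIV. h $ i *\<^sub>R axis i 1)"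
    using basis_expansion[of h] by (simp add: scalar_mult_eq_scaleR)
  also have "\<dots> = (\<Sum>i\<in>UNIV. h $ i * pd i f x)"
    unfolding linear_sum[OF lin] linear_cmul[OF lin] pd_def by simp
  finally show ?thesis .
qed

text \<open>Mean value inequality on the ball of radius \<open>norm x\<close>, where the gradient
  bound is largest at the boundary.\<close>

lemma gradient_power_bound_imp_bound:
  fixes f :: "real ^ 'n::finite \<Rightarrow> real"
  assumes d: "\<And>y. norm y < \<rho> \<Longrightarrow> f differentiable (at y)"
    and B: "\<And>y i. norm y < \<rho> \<Longrightarrow> \<bar>pd i f y\<bar> \<le> C i * norm y ^ j"
    and f0: "f 0 = 0" and x: "norm x < \<rho>"
  shows "\<bar>f x\<bar> \<le> (\<Sum>i\<in>UNIV. C i) * norm x ^ Suc j"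
proof (cases "x = 0")
  case False
  have C0: "0 \<le> C i" for i
  proof -
    have "0 \<le> C i * norm x ^ j" using B[OF x, of i] abs_ge_zero order_trans by blast
    moreover have "0 < norm x ^ j" using False by simp
    ultimately show ?thesis by (metis mult_neg_pos not_less)
  qed
  let ?K = "(\<Sum>i\<in>UNIV. C i) * norm x ^ j"
  have "norm (f x - f 0) \<le> ?K * norm (x - 0)"
  proof (rule differentiable_bound[where S = "cball (0 :: real ^ 'n) (norm x)" and f' = "\<lambda>y. frechet_derivative f (at y)"])
    fix y :: "real ^ 'n" assume "y \<in> cball 0 (norm x)"
    then have y: "norm y \<le> norm x" "norm y < \<rho>" using x by auto
    show "(f has_derivative frechet_derivative f (at y)) (at y within cball 0 (norm x))"
      using d[OF y(2)] frechet_derivative_works has_derivative_at_withinI by blast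
    show "onorm (frechet_derivative f (at y)) \<le> ?K"
    proof (rule onorm_le)
      fix h :: "real ^ 'n"
      have "\<bar>\<Sum>i\<in>UNIV. h $ i * pd i f y\<bar> \<le> (\<Sum>i\<in>UNIV. \<bar>h $ i * pd i f y\<bar>)" by (rule sum_abs)
      also have "\<dots> \<le> (\<Sum>i\<in>UNIV. norm h * (C i * norm x ^ j))"
      proof (rule sum_mono)
        fix i
        have "\<bar>pd i f y\<bar> \<le> C i * norm x ^ j"
          using B[OF y(2), of i] mult_left_mono[OF power_mono[OF y(1), of j] C0[of i]] by simp
        then show "\<bar>h $ i * pd i f y\<bar> \<le> norm h * (C i * norm x ^ j)"
          unfolding abs_mult by (intro mult_mono component_le_norm_cart) auto
      qed
      also have "\<dots> = ?K * norm h" by (simp add: sum_distrib_left sum_distrib_right mult_ac)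
      finally show "norm (frechet_derivative f (at y) h) \<le> ?K * norm h"
        unfolding frechet_derivative_eq_sum_pd[OF d[OF y(2)]] real_norm_def .
    qed
  qed auto
  then show ?thesis using f0 by (simp add: mult_ac)
qed (use f0 in simp)

lemma Ck_on_subset: "Ck_on m f S \<Longrightarrow> T \<subseteq> S \<Longrightarrow> Ck_on m f T"
  by (induction m arbitrary: f) (auto intro: continuous_on_subset)

lemma Ck_on_SucD: "Ck_on (Suc m) f S \<Longrightarrow> Ck_on m f S"
proof (induction m arbitrary: f)
  case 0
  then show ?case
    by (simp add: continuous_at_imp_continuous_on differentiable_imp_continuous_within)
qed auto

lemma Ck_on_antimono: "m \<le> n \<Longrightarrow> Ck_on n f S \<Longrightarrow> Ck_on m f S"
  by (induction n rule: dec_induct) (auto dest: Ck_on_SucD simp del: Ck_on.simps)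

lemma Ck_on_continuous: "Ck_on m f S \<Longrightarrow> continuous_on S f"
  using Ck_on_antimono[of 0 m f S] by simp

lemma Ck_on_cong:
  assumes "open S" "Ck_on m f S" "\<And>x. x \<in> S \<Longrightarrow> f x = g x"
  shows "Ck_on m g S"
  using assms(2,3)
proof (induction m arbitrary: f g)
  case 0
  then show ?case by (auto cong: continuous_on_cong)
next
  case (Suc m)
  have "Ck_on m (partial_deriv i g) S" for i
  proof (rule Suc.IH[of "partial_deriv i f"])
    show "partial_deriv i f x = partial_deriv i g x" if "x \<in> S" for x
      unfolding partial_deriv_eq_pd by (rule pd_cong_open[OF assms(1) that]) (rule Suc.prems(2))
  qed (use Suc.prems in auto)
  moreover have "g differentiable at x" if "x \<in> S" for x
    using Suc.prems that differentiable_cong_open[OF assms(1) that, of f g] by auto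
  ultimately show ?case by simp
qed

lemma pd_diff:
  assumes "f differentiable (at x)" "g differentiable (at x)"
  shows "pd i (\<lambda>x. f x - g x) x = pd i f x - pd i g x"
proof -
  obtain f' g' where d: "(f has_derivative f') (at x)" "(g has_derivative g') (at x)"
    using assms unfolding differentiable_def by blast
  show ?thesis unfolding pd_eqI[OF d(1)] pd_eqI[OF d(2)] pd_eqI[OF has_derivative_diff[OF d]] ..
qed

lemma eul_diff:
  assumes "f differentiable (at x)" "g differentiable (at x)"
  shows "eul i (\<lambda>x. f x - g x) x = eul i f x - eul i g x"
  unfolding eul_def pd_diff[OF assms] by (simp add: scaleR_diff_right)

lemma partial_deriv_cong_open:
  assumes "open S" "x \<in> S" "\<And>y. y \<in> S \<Longrightarrow> f y = g y"
  shows "partial_deriv i f x = partial_deriv i g x"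
  unfolding partial_deriv_eq_pd by (rule pd_cong_open[OF assms])

lemma partial_deriv_diff:
  assumes "f differentiable (at x)" "g differentiable (at x)"
  shows "partial_deriv i (\<lambda>x. f x - g x) x = partial_deriv i f x - partial_deriv i g x"
  unfolding partial_deriv_eq_pd by (rule pd_diff[OF assms])

lemma Ck_on_diff:
  assumes "open S" "Ck_on m f S" "Ck_on m g S"
  shows "Ck_on m (\<lambda>x. f x - g x) S"
  using assms(2,3)
proof (induction m arbitrary: f g)
  case 0
  then show ?case by (auto intro: continuous_on_diff)
next
  case (Suc m)
  have "Ck_on m (partial_deriv i (\<lambda>x. f x - g x)) S" for i
  proof (rule Ck_on_cong[OF assms(1)])
    show "Ck_on m (\<lambda>x. partial_deriv i f x - partial_deriv i g x) S"
      using Suc.prems by (intro Suc.IH) auto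
    show "partial_deriv i f x - partial_deriv i g x = partial_deriv i (\<lambda>x. f x - g x) x" if "x \<in> S" for x
      unfolding partial_deriv_eq_pd using Suc.prems that by (subst pd_diff) auto
  qed
  then show ?case using Suc.prems by (auto intro: differentiable_diff)
qed

lemma Ck_on_foldr: "Ck_on (length L + m) f S \<Longrightarrow> Ck_on m (foldr partial_deriv L f) S"
proof (induction L arbitrary: m)
  case (Cons i L)
  have "Ck_on (Suc m) (foldr partial_deriv L f) S" using Cons.prems by (intro Cons.IH) simp
  then show ?case by simp
qed simp

lemma foldr_partial_deriv_diff:
  assumes S: "open S" and "Ck_on (length L) f S" "Ck_on (length L) g S" "x \<in> S"
  shows "foldr partial_deriv L (\<lambda>x. f x - g x) x = foldr partial_deriv L f x - foldr partial_deriv L g x"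
  using assms(2-)
proof (induction L arbitrary: x)
  case (Cons i L)
  have f: "Ck_on 1 (foldr partial_deriv L f) S" "Ck_on 1 (foldr partial_deriv L g) S"
    using Cons.prems by (auto intro!: Ck_on_foldr simp del: Ck_on.simps)
  have L: "Ck_on (length L) f S" "Ck_on (length L) g S"
    using Cons.prems(1,2) by (auto intro: Ck_on_SucD simp del: Ck_on.simps)
  have "partial_deriv i (foldr partial_deriv L (\<lambda>x. f x - g x)) x
      = partial_deriv i (\<lambda>x. foldr partial_deriv L f x - foldr partial_deriv L g x) x"
    by (rule partial_deriv_cong_open[OF S Cons.prems(3)]) (rule Cons.IH[OF L])
  then show ?case using f Cons.prems(3) by (simp add: partial_deriv_diff)
qed simp

section \<open>Symmetry of mixed partial derivatives\<close>

lemma has_derivative_along: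
  fixes f :: "real ^ 'n::finite \<Rightarrow> real"
  assumes "f differentiable (at (y + s *\<^sub>R axis i 1))"
  shows "((\<lambda>s. f (y + s *\<^sub>R axis i 1)) has_real_derivative pd i f (y + s *\<^sub>R axis i 1)) (at s)"
proof -
  let ?z = "y + s *\<^sub>R axis i 1"
  have d: "(f has_derivative frechet_derivative f (at ?z)) (at ?z)"
    using assms frechet_derivative_works by blast
  have "((\<lambda>s. y + s *\<^sub>R axis i 1) has_derivative (\<lambda>h. h *\<^sub>R axis i 1)) (at s)"
    by (auto intro!: derivative_eq_intros)
  from has_derivative_compose[OF this d]
  have "((\<lambda>s. f (y + s *\<^sub>R axis i 1)) has_derivative (\<lambda>h. frechet_derivative f (at ?z) (h *\<^sub>R axis i 1))) (at s)" .
  moreover have "frechet_derivative f (at ?z) (h *\<^sub>R axis i 1) = pd i f ?z * h" for h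
    using linear_cmul[OF linear_frechet_derivative[OF assms], of h "axis i 1"] by (simp add: pd_def mult.commute)
  ultimately show ?thesis by (simp add: has_field_derivative_def)
qed

text \<open>The mean value theorem twice: in direction \<open>i\<close> for the difference of two
  translates of \<open>f\<close>, then in direction \<open>j\<close> for \<open>pd i f\<close>. The
  condition \<open>2 h < e\<close> keeps the square inside the ball.\<close>

lemma double_difference:
  fixes f :: "real ^ 'n::finite \<Rightarrow> real"
  assumes f: "Ck_on 2 f (ball x e)" and h: "0 < h" "2 * h < e"
  shows "\<exists>\<xi> \<eta>. 0 < \<xi> \<and> \<xi> < h \<and> 0 < \<eta> \<and> \<eta> < h \<and>
    f (x + h *\<^sub>R axis i 1 + h *\<^sub>R axis j 1) - f (x + h *\<^sub>R axis i 1) - (f (x + h *\<^sub>R axis j 1) - f x)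
      = h * (h * pd j (pd i f) (x + \<xi> *\<^sub>R axis i 1 + \<eta> *\<^sub>R axis j 1))"
proof -
  let ?a = "axis i 1 :: real ^ 'n" and ?b = "axis j 1 :: real ^ 'n"
  have inb: "x + s *\<^sub>R ?a + t *\<^sub>R ?b \<in> ball x e" if "0 \<le> s" "s \<le> h" "0 \<le> t" "t \<le> h" for s t
  proof -
    have "norm (s *\<^sub>R ?a + t *\<^sub>R ?b) \<le> norm (s *\<^sub>R ?a) + norm (t *\<^sub>R ?b)" by (rule norm_triangle_ineq)
    also have "\<dots> \<le> 2 * h" using that by simp
    finally have "norm (s *\<^sub>R ?a + t *\<^sub>R ?b) < e" using h by linarith
    moreover have "dist x (x + s *\<^sub>R ?a + t *\<^sub>R ?b) = norm (s *\<^sub>R ?a + t *\<^sub>R ?b)"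
      by (simp add: dist_norm norm_minus_commute algebra_simps)
    ultimately show ?thesis by simp
  qed
  have df: "f differentiable (at y)" "pd i f differentiable (at y)" if "y \<in> ball x e" for y
    using f that by (auto simp: numeral_2_eq_2 partial_deriv_eq_pd)
  define g where "g s = f ((x + h *\<^sub>R ?b) + s *\<^sub>R ?a) - f (x + s *\<^sub>R ?a)" for s
  have gd: "(g has_real_derivative pd i f ((x + h *\<^sub>R ?b) + s *\<^sub>R ?a) - pd i f (x + s *\<^sub>R ?a)) (at s)"
    if "0 \<le> s" "s \<le> h" for s
    unfolding g_def
    using inb[of s h] inb[of s 0] that h by (intro DERIV_diff has_derivative_along df) (simp_all add: add_ac)
  have "\<exists>\<xi>>0. \<xi> < h \<and> g h - g 0 = (h - 0) * (pd i f ((x + h *\<^sub>R ?b) + \<xi> *\<^sub>R ?a) - pd i f (x + \<xi> *\<^sub>R ?a))"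
    by (rule MVT2[OF h(1)]) (rule gd)
  then obtain \<xi> where \<xi>: "0 < \<xi>" "\<xi> < h" "g h - g 0 = (h - 0) * (pd i f ((x + h *\<^sub>R ?b) + \<xi> *\<^sub>R ?a) - pd i f (x + \<xi> *\<^sub>R ?a))"
    by (elim exE conjE)
  have kd: "((\<lambda>t. pd i f ((x + \<xi> *\<^sub>R ?a) + t *\<^sub>R ?b)) has_real_derivative pd j (pd i f) ((x + \<xi> *\<^sub>R ?a) + t *\<^sub>R ?b)) (at t)"
    if "0 \<le> t" "t \<le> h" for t
    using inb[of \<xi> t] that \<xi> by (intro has_derivative_along df) simp
  have "\<exists>\<eta>>0. \<eta> < h \<and> pd i f ((x + \<xi> *\<^sub>R ?a) + h *\<^sub>R ?b) - pd i f ((x + \<xi> *\<^sub>R ?a) + 0 *\<^sub>R ?b)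
      = (h - 0) * pd j (pd i f) ((x + \<xi> *\<^sub>R ?a) + \<eta> *\<^sub>R ?b)"
    by (rule MVT2[OF h(1)]) (rule kd)
  then obtain \<eta> where \<eta>: "0 < \<eta>" "\<eta> < h" "pd i f ((x + \<xi> *\<^sub>R ?a) + h *\<^sub>R ?b) - pd i f ((x + \<xi> *\<^sub>R ?a) + 0 *\<^sub>R ?b)
      = (h - 0) * pd j (pd i f) ((x + \<xi> *\<^sub>R ?a) + \<eta> *\<^sub>R ?b)"
    by (elim exE conjE)
  show ?thesis
  proof (intro exI conjI)
    have "g h - g 0 = h * (h * pd j (pd i f) (x + \<xi> *\<^sub>R ?a + \<eta> *\<^sub>R ?b))"
      using \<xi>(3) \<eta>(3) by (simp add: add_ac)
    then show "f (x + h *\<^sub>R ?a + h *\<^sub>R ?b) - f (x + h *\<^sub>R ?a) - (f (x + h *\<^sub>R ?b) - f x)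
      = h * (h * pd j (pd i f) (x + \<xi> *\<^sub>R ?a + \<eta> *\<^sub>R ?b))"
      by (simp add: g_def add_ac)
  qed (fact \<xi>(1,2) \<eta>(1,2))+
qed

text \<open>The second difference is symmetric in \<open>i\<close> and \<open>j\<close>; divided by
  \<open>h^2\<close> it tends to either mixed derivative by continuity.\<close>

lemma mixed_partials_commute:
  fixes f :: "real ^ 'n::finite \<Rightarrow> real"
  assumes S: "open S" "x \<in> S" and f: "Ck_on 2 f S"
  shows "pd i (pd j f) x = pd j (pd i f) x"
proof -
  obtain e where e: "e > 0" "ball x e \<subseteq> S" using S unfolding open_contains_ball by blast
  have fb: "Ck_on 2 f (ball x e)" by (rule Ck_on_subset[OF f e(2)])
  define h where "h n = e / 2 / real (n + 2)" for n
  have h: "0 < h n" "2 * h n < e" for n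
  proof -
    have "e / real (n + 2) < e / 1" using e by (intro divide_strict_left_mono) auto
    moreover have "2 * h n = (2 * (e / 2)) / real (n + 2)" unfolding h_def by (simp only: times_divide_eq_right)
    ultimately show "2 * h n < e" by simp
    show "0 < h n" using e by (simp add: h_def)
  qed
  have h0: "h \<longlonglongrightarrow> 0"
  proof -
    have "(\<lambda>n. (e / 2) * inverse (real (Suc (Suc n)))) \<longlonglongrightarrow> (e / 2) * 0"
      by (rule tendsto_mult[OF tendsto_const LIMSEQ_Suc[OF LIMSEQ_inverse_real_of_nat]])
    moreover have "h = (\<lambda>n. (e / 2) * inverse (real (Suc (Suc n))))"
      by (rule ext) (simp add: h_def inverse_eq_divide)
    ultimately show ?thesis by simp
  qed
  define A where "A i j n = f (x + h n *\<^sub>R axis i 1 + h n *\<^sub>R axis j 1) - f (x + h n *\<^sub>R axis i 1)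
      - (f (x + h n *\<^sub>R axis j 1) - f x)" for i j :: 'n and n
  have lim: "(\<lambda>n. A i j n / (h n * h n)) \<longlonglongrightarrow> pd j (pd i f) x" for i j
  proof -
    have "\<exists>p. A i j n = h n * (h n * pd j (pd i f) p) \<and> dist p x \<le> 2 * h n" for n
    proof -
      from double_difference[OF fb h, of n i j]
      obtain \<xi> \<eta> where \<xi>: "0 < \<xi>" "\<xi> < h n" "0 < \<eta>" "\<eta> < h n"
        "A i j n = h n * (h n * pd j (pd i f) (x + \<xi> *\<^sub>R axis i 1 + \<eta> *\<^sub>R axis j 1))"
        unfolding A_def by (elim exE conjE)
      have "norm (\<xi> *\<^sub>R axis i 1 + \<eta> *\<^sub>R axis j 1 :: real ^ 'n) \<le> norm (\<xi> *\<^sub>R axis i 1 :: real ^ 'n) + norm (\<eta> *\<^sub>R axis j 1 :: real ^ 'n)"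
        by (rule norm_triangle_ineq)
      also have "\<dots> \<le> 2 * h n" using \<xi> by simp
      finally show ?thesis using \<xi>(5)
        by (intro exI[of _ "x + \<xi> *\<^sub>R axis i 1 + \<eta> *\<^sub>R axis j 1"]) (simp add: dist_norm add.assoc)
    qed
    then have "\<forall>n. \<exists>p. A i j n = h n * (h n * pd j (pd i f) p) \<and> dist p x \<le> 2 * h n" by (rule allI)
    then obtain p where "\<forall>n. A i j n = h n * (h n * pd j (pd i f) (p n)) \<and> dist (p n) x \<le> 2 * h n"
      by (rule choice[THEN exE])
    then have p: "A i j n = h n * (h n * pd j (pd i f) (p n))" "dist (p n) x \<le> 2 * h n" for n by blast+
    have "(\<lambda>n. dist (p n) x) \<longlonglongrightarrow> 0"
    proof (rule tendsto_sandwich[OF _ _ tendsto_const])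
      have "(\<lambda>n. 2 * h n) \<longlonglongrightarrow> 2 * 0" by (intro tendsto_mult tendsto_const h0)
      then show "(\<lambda>n. 2 * h n) \<longlonglongrightarrow> 0" by simp
    qed (use p(2) in auto)
    then have "p \<longlonglongrightarrow> x" by (rule tendsto_dist_iff[THEN iffD2])
    moreover have "isCont (pd j (pd i f)) x"
    proof -
      have "continuous_on S (pd j (pd i f))" using f by (simp add: numeral_2_eq_2 partial_deriv_eq_pd)
      then show ?thesis using S by (simp add: continuous_on_eq_continuous_at)
    qed
    ultimately have "(\<lambda>n. pd j (pd i f) (p n)) \<longlonglongrightarrow> pd j (pd i f) x" by (rule isCont_tendsto_compose[rotated])
    moreover have "A i j n / (h n * h n) = pd j (pd i f) (p n)" for n using h(1)[of n] by (simp add: p(1))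
    ultimately show ?thesis by simp
  qed
  have "A i j n = A j i n" for n by (simp add: A_def add_ac)
  then show ?thesis using LIMSEQ_unique[OF lim[of i j]] lim[of j i] by simp
qed

text \<open>Moves \<open>i\<close> to the front by adjacent swaps. The entries below a swap leave
  exactly two derivatives of \<open>f\<close>, enough for the two that are interchanged.\<close>

lemma foldr_partial_deriv_remove1:
  fixes f :: "real ^ 'n::finite \<Rightarrow> real"
  assumes S: "open S"
  shows "i \<in> set L \<Longrightarrow> Ck_on (length L) f S \<Longrightarrow> x \<in> S \<Longrightarrow>
    foldr partial_deriv L f x = partial_deriv i (foldr partial_deriv (remove1 i L) f) x"
proof (induction L arbitrary: x)
  case (Cons j L)
  show ?case
  proof (cases "j = i")
    case False
    then have i: "i \<in> set L" using Cons.prems by simp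
    let ?h = "foldr partial_deriv (remove1 i L) f"
    have "length (remove1 i L) + 2 = Suc (length L)" using length_pos_if_in_set[OF i] i by (simp add: length_remove1)
    then have h: "Ck_on 2 ?h S" using Cons.prems(2) by (intro Ck_on_foldr) simp
    have fL: "Ck_on (length L) f S" using Cons.prems(2) by (auto intro: Ck_on_SucD simp del: Ck_on.simps)
    have "partial_deriv j (foldr partial_deriv L f) x = partial_deriv j (partial_deriv i ?h) x"
      by (rule partial_deriv_cong_open[OF S Cons.prems(3)]) (rule Cons.IH[OF i fL])
    also have "\<dots> = partial_deriv i (partial_deriv j ?h) x"
      using mixed_partials_commute[OF S Cons.prems(3) h, of j i] by (simp add: partial_deriv_eq_pd)
    finally show ?thesis using False by simp
  qed simp
qed simp

lemma foldr_partial_deriv_perm: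
  fixes f :: "real ^ 'n::finite \<Rightarrow> real"
  assumes S: "open S"
  shows "mset L = mset L' \<Longrightarrow> Ck_on (length L) f S \<Longrightarrow> x \<in> S \<Longrightarrow>
    foldr partial_deriv L f x = foldr partial_deriv L' f x"
proof (induction L arbitrary: L' x)
  case (Cons i L)
  have len: "length L' = Suc (length L)" using mset_eq_length[OF Cons.prems(1)] by simp
  have i: "i \<in> set L'" using Cons.prems(1) by (metis list.set_intros(1) set_mset_mset)
  have "mset L = mset (remove1 i L')" using Cons.prems(1) by (metis add_mset_remove_trivial mset.simps(2) mset_remove1)
  have IH: "foldr partial_deriv L f y = foldr partial_deriv (remove1 i L') f y" if "y \<in> S" for y
  proof (rule Cons.IH[OF \<open>mset L = mset (remove1 i L')\<close> _ that])
    show "Ck_on (length L) f S" using Cons.prems(2) by (auto intro: Ck_on_SucD simp del: Ck_on.simps)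
  qed
  have "foldr partial_deriv (i # L) f x = partial_deriv i (foldr partial_deriv (remove1 i L') f) x"
    unfolding foldr_Cons o_def
    by (rule partial_deriv_cong_open[OF S Cons.prems(3)]) (rule IH)
  also have "\<dots> = foldr partial_deriv L' f x"
    using foldr_partial_deriv_remove1[OF S i _ Cons.prems(3), of f] Cons.prems(2) len by simp
  finally show ?case .
qed simp

text \<open>Any two lists with the same counts are permutations of each other, so the choice in
  \<open>multi_deriv\<close> is immaterial.\<close>

lemma multi_deriv_eq_foldr:
  fixes f :: "real ^ 'n::finite \<Rightarrow> real"
  assumes "open S" "Ck_on (length L) f S" "x \<in> S" "\<And>i. count_list L i = \<alpha> $ i"
  shows "multi_deriv \<alpha> f x = foldr partial_deriv L f x"
proof -
  let ?M = "SOME is. \<forall>i. count_list is i = \<alpha> $ i"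
  have "\<forall>i. count_list ?M i = \<alpha> $ i" by (rule someI_ex) (use assms(4) in blast)
  then have "mset L = mset ?M" using assms(4) by (simp add: multiset_eq_iff count_mset)
  from foldr_partial_deriv_perm[OF assms(1) this assms(2,3)] show ?thesis by (simp add: multi_deriv_def)
qed

section \<open>Taylor polynomials and flat remainders\<close>

text \<open>Polynomials whose exponents \<open>g \<alpha>\<close> are separate from the index
  \<alpha>. Differentiation then changes only \<open>a\<close> and \<open>g\<close>, although
  truncated subtraction may make several indices share an exponent.\<close>

definition pmono :: "'a set \<Rightarrow> ('a \<Rightarrow> real) \<Rightarrow> ('a \<Rightarrow> nat ^ 'n::finite) \<Rightarrow> real ^ 'n \<Rightarrow> real" where
  "pmono A a g x = (\<Sum>\<alpha>\<in>A. a \<alpha> * mpow x (g \<alpha>))"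

lemma dmono_eq: "dmono i \<alpha> x = real (\<alpha> $ i) * mpow x (\<alpha> - axis i 1)"
proof -
  have "mpow x (\<alpha> - axis i 1) = (x $ i) ^ (\<alpha> $ i - 1) * (\<Prod>j\<in>UNIV - {i}. (x $ j) ^ ((\<alpha> - axis i 1) $ j))"
    unfolding mpow_def by (subst prod.remove[of UNIV i]) (auto simp: axis_def)
  also have "(\<Prod>j\<in>UNIV - {i}. (x $ j) ^ ((\<alpha> - axis i 1) $ j)) = (\<Prod>j\<in>UNIV - {i}. (x $ j) ^ (\<alpha> $ j))"
    by (rule prod.cong) (auto simp: axis_def)
  finally show ?thesis by (simp add: dmono_def)
qed

lemma pmono_has_derivative:
  "(pmono A a g has_derivative (\<lambda>h. \<Sum>\<alpha>\<in>A. a \<alpha> * (\<Sum>i\<in>UNIV. h $ i * dmono i (g \<alpha>) x))) (at x)"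
  unfolding pmono_def by (intro has_derivative_sum has_derivative_mult_right has_derivative_mpow)

lemma pd_pmono: "pd i (pmono A a g) = pmono A (\<lambda>\<alpha>. a \<alpha> * real (g \<alpha> $ i)) (\<lambda>\<alpha>. g \<alpha> - axis i 1)"
proof
  fix x
  have "(\<Sum>k\<in>UNIV. axis i 1 $ k * dmono k (g \<alpha>) x) = dmono i (g \<alpha>) x" for \<alpha>
    by (simp add: axis_def if_distrib[of "\<lambda>a. a * _"] sum.delta' cong: if_cong)
  then show "pd i (pmono A a g) x = pmono A (\<lambda>\<alpha>. a \<alpha> * real (g \<alpha> $ i)) (\<lambda>\<alpha>. g \<alpha> - axis i 1) x"
    unfolding pd_eqI[OF pmono_has_derivative] by (simp add: pmono_def dmono_eq mult.assoc)
qed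

lemma Ck_on_pmono: "Ck_on m (pmono A a g) S"
proof (induction m arbitrary: a g)
  case 0
  show ?case unfolding Ck_on.simps pmono_def by (intro continuous_intros)
next
  case (Suc m)
  then show ?case using differentiableI[OF pmono_has_derivative] by (auto simp: partial_deriv_eq_pd pd_pmono)
qed

text \<open>Induction from the end of the list, where the derivative that is applied first stands;
  it turns a \<open>pmono\<close> into a \<open>pmono\<close>, to which the hypothesis for general
  \<open>a\<close> and \<open>g\<close> applies.\<close>

lemma foldr_pmono_at_0:
  "foldr partial_deriv L (pmono A a g) 0 =
    (\<Sum>\<alpha>\<in>A. if \<forall>i. count_list L i = g \<alpha> $ i then a \<alpha> * (\<Prod>i\<in>UNIV. fact (g \<alpha> $ i)) else 0)"
proof (induction L arbitrary: a g rule: rev_induct)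
  case Nil
  have "mpow 0 (g \<alpha>) = (if \<forall>i. 0 = g \<alpha> $ i then 1 else 0)" for \<alpha>
  proof (cases "\<forall>i. 0 = g \<alpha> $ i")
    case False
    then obtain i where "g \<alpha> $ i \<noteq> 0" by auto
    then show ?thesis unfolding mpow_def by (subst prod_zero) auto
  qed (simp add: mpow_def)
  then show ?case by (auto simp: pmono_def intro!: sum.cong)
next
  case (snoc k L)
  have "foldr partial_deriv (L @ [k]) (pmono A a g) 0
     = foldr partial_deriv L (pmono A (\<lambda>\<alpha>. a \<alpha> * real (g \<alpha> $ k)) (\<lambda>\<alpha>. g \<alpha> - axis k 1)) 0"
    by (simp add: partial_deriv_eq_pd pd_pmono)
  also have "\<dots> = (\<Sum>\<alpha>\<in>A. if \<forall>i. count_list L i = (g \<alpha> - axis k 1) $ i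
      then a \<alpha> * real (g \<alpha> $ k) * (\<Prod>i\<in>UNIV. fact ((g \<alpha> - axis k 1) $ i)) else 0)" by (rule snoc)
  also have "\<dots> = (\<Sum>\<alpha>\<in>A. if \<forall>i. count_list (L @ [k]) i = g \<alpha> $ i then a \<alpha> * (\<Prod>i\<in>UNIV. fact (g \<alpha> $ i)) else 0)"
  proof (rule sum.cong[OF refl])
    fix \<alpha>
    show "(if \<forall>i. count_list L i = (g \<alpha> - axis k 1) $ i
      then a \<alpha> * real (g \<alpha> $ k) * (\<Prod>i\<in>UNIV. fact ((g \<alpha> - axis k 1) $ i)) else 0)
      = (if \<forall>i. count_list (L @ [k]) i = g \<alpha> $ i then a \<alpha> * (\<Prod>i\<in>UNIV. fact (g \<alpha> $ i)) else 0)"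
    proof (cases "g \<alpha> $ k")
      \<comment> \<open>Truncated subtraction leaves the exponent 0 unchanged here, but the new
        coefficient has the factor 0, and on the other side the count of \<open>k\<close> is
        positive.\<close>
      case 0
      then have n: "\<not> (\<forall>i. count_list (L @ [k]) i = g \<alpha> $ i)" by (auto intro!: exI[of _ k])
      show ?thesis unfolding if_not_P[OF n] 0 by simp
    next
      case (Suc m)
      have e1: "(\<forall>i. count_list L i = (g \<alpha> - axis k 1) $ i) \<longleftrightarrow> (\<forall>i. count_list (L @ [k]) i = g \<alpha> $ i)"
      proof (intro all_cong1)
        show "(count_list L i = (g \<alpha> - axis k 1) $ i) \<longleftrightarrow> (count_list (L @ [k]) i = g \<alpha> $ i)" for i
          using Suc by (cases "i = k") (auto simp: axis_def)
      qed
      have "(\<Prod>i\<in>UNIV. fact (g \<alpha> $ i)) = fact (g \<alpha> $ k) * (\<Prod>i\<in>UNIV - {k}. fact (g \<alpha> $ i) :: real)"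
        by (rule prod.remove) auto
      moreover have "(\<Prod>i\<in>UNIV. fact ((g \<alpha> - axis k 1) $ i)) = fact m * (\<Prod>i\<in>UNIV - {k}. fact ((g \<alpha> - axis k 1) $ i) :: real)"
        using Suc by (subst prod.remove[of UNIV k]) (auto simp: axis_def)
      moreover have "(\<Prod>i\<in>UNIV - {k}. fact ((g \<alpha> - axis k 1) $ i) :: real) = (\<Prod>i\<in>UNIV - {k}. fact (g \<alpha> $ i))"
        by (rule prod.cong) (auto simp: axis_def)
      ultimately have "real (g \<alpha> $ k) * (\<Prod>i\<in>UNIV. fact ((g \<alpha> - axis k 1) $ i)) = (\<Prod>i\<in>UNIV. fact (g \<alpha> $ i))"
        using Suc by simp
      then show ?thesis unfolding e1 by (simp add: mult.assoc)
    qed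
  qed
  finally show ?case .
qed

lemma finite_vsize_le: "finite {\<alpha> :: nat ^ 'n::finite. vsize \<alpha> \<le> k}"
proof (rule finite_subset)
  have "\<alpha> $ i \<le> vsize \<alpha>" for \<alpha> :: "nat ^ 'n" and i unfolding vsize_def by (rule member_le_sum) auto
  then show "{\<alpha> :: nat ^ 'n. vsize \<alpha> \<le> k} \<subseteq> {\<alpha>. \<forall>i. \<alpha> $ i \<in> {..k}}" using order_trans by fastforce
  show "finite {\<alpha> :: nat ^ 'n. \<forall>i. \<alpha> $ i \<in> {..k}}" by (rule finite_vec_bounded) simp
qed

lemma taylor_polynomial_eq_pmono:
  "taylor_polynomial k f = pmono {\<alpha>. vsize \<alpha> \<le> k} (\<lambda>\<alpha>. multi_deriv \<alpha> f 0 / (\<Prod>i\<in>UNIV. fact (\<alpha> $ i))) (\<lambda>\<alpha>. \<alpha>)"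
  by (rule ext) (simp add: taylor_polynomial_def pmono_def vsize_def)

text \<open>At the origin only the Taylor term with exactly the multiplicities of \<open>L\<close>
  survives, and its factorials cancel.\<close>

lemma foldr_taylor_remainder_at_0:
  fixes f :: "real ^ 'n::finite \<Rightarrow> real"
  assumes S: "open S" "0 \<in> S" and f: "Ck_on k f S" and L: "length L \<le> k"
  shows "foldr partial_deriv L (\<lambda>x. f x - taylor_polynomial k f x) 0 = 0"
proof -
  define \<alpha> where "\<alpha> = (\<chi> i. count_list L i)"
  have fL: "Ck_on (length L) f S" by (rule Ck_on_antimono[OF L f])
  have "vsize \<alpha> = length L"
  proof -
    have "size (mset L) = (\<Sum>i\<in>set_mset (mset L). count (mset L) i)" by (rule size_multiset_overloaded_eq)
    also have "\<dots> = (\<Sum>i\<in>UNIV. count (mset L) i)" by (rule sum.mono_neutral_left) (auto simp: count_eq_zero_iff)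
    finally show ?thesis by (simp add: vsize_def \<alpha>_def count_mset)
  qed
  then have \<alpha>k: "\<alpha> \<in> {\<alpha>. vsize \<alpha> \<le> k}" using L by simp
  have "foldr partial_deriv L (taylor_polynomial k f) 0
     = (\<Sum>\<gamma>\<in>{\<gamma>. vsize \<gamma> \<le> k}. if \<gamma> = \<alpha> then multi_deriv \<gamma> f 0 else 0)"
    unfolding taylor_polynomial_eq_pmono foldr_pmono_at_0
  proof (rule sum.cong[OF refl])
    fix \<gamma> :: "nat ^ 'n"
    have "(\<forall>i. count_list L i = \<gamma> $ i) \<longleftrightarrow> \<gamma> = \<alpha>" by (auto simp: \<alpha>_def vec_eq_iff)
    then show "(if \<forall>i. count_list L i = \<gamma> $ i then multi_deriv \<gamma> f 0 / (\<Prod>i\<in>UNIV. fact (\<gamma> $ i)) * (\<Prod>i\<in>UNIV. fact (\<gamma> $ i)) else 0)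
      = (if \<gamma> = \<alpha> then multi_deriv \<gamma> f 0 else 0)" by simp
  qed
  also have "\<dots> = multi_deriv \<alpha> f 0" unfolding sum.delta[OF finite_vsize_le] using \<alpha>k by simp
  also have "\<dots> = foldr partial_deriv L f 0" by (rule multi_deriv_eq_foldr[OF S(1) fL S(2)]) (simp add: \<alpha>_def)
  finally have "foldr partial_deriv L (taylor_polynomial k f) 0 = foldr partial_deriv L f 0" .
  moreover have "Ck_on (length L) (taylor_polynomial k f) S" unfolding taylor_polynomial_eq_pmono by (rule Ck_on_pmono)
  ultimately show ?thesis using foldr_partial_deriv_diff[OF S(1) fL _ S(2)] by simp
qed

text \<open>Peano's form of the remainder, by induction through the gradient. The arbitrary \<eta>
  matters: the remainder must be beaten by a constant given in advance. Each of the partial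
  derivatives gets an equal share of \<eta>.\<close>

lemma flat_little_o:
  fixes f :: "real ^ 'n::finite \<Rightarrow> real"
  assumes S: "open S" "0 \<in> S"
  shows "Ck_on j f S \<Longrightarrow> (\<And>L. length L \<le> j \<Longrightarrow> foldr partial_deriv L f 0 = 0) \<Longrightarrow> 0 < \<eta> \<Longrightarrow>
    \<exists>\<delta>>0. \<forall>x. norm x < \<delta> \<longrightarrow> \<bar>f x\<bar> \<le> \<eta> * norm x ^ j"
proof (induction j arbitrary: f \<eta>)
  case 0
  have "isCont f 0" using 0(1) S by (simp add: continuous_on_eq_continuous_at)
  moreover have "f 0 = 0" using 0(2)[of "[]"] by simp
  ultimately obtain \<delta> where "\<delta> > 0" "\<forall>x. dist x 0 < \<delta> \<longrightarrow> dist (f x) 0 < \<eta>"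
    using 0(3) unfolding continuous_at_eps_delta by metis
  then show ?case by (intro exI[of _ \<delta>]) (auto intro: less_imp_le)
next
  case (Suc j)
  let ?h = "\<eta> / real CARD('n)"
  have h: "0 < ?h" using Suc.prems(3) by simp
  have "\<forall>i. \<exists>\<delta>>0. \<forall>x. norm x < \<delta> \<longrightarrow> \<bar>pd i f x\<bar> \<le> ?h * norm x ^ j"
  proof
    fix i
    show "\<exists>\<delta>>0. \<forall>x. norm x < \<delta> \<longrightarrow> \<bar>pd i f x\<bar> \<le> ?h * norm x ^ j"
    proof (rule Suc.IH[OF _ _ h])
      show "Ck_on j (pd i f) S" using Suc.prems(1) by (simp add: partial_deriv_eq_pd)
      show "foldr partial_deriv L (pd i f) 0 = 0" if "length L \<le> j" for L
        using Suc.prems(2)[of "L @ [i]"] that by (simp flip: partial_deriv_eq_pd)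
    qed
  qed
  then obtain \<delta> where \<delta>: "\<forall>i. 0 < \<delta> i \<and> (\<forall>x. norm x < \<delta> i \<longrightarrow> \<bar>pd i f x\<bar> \<le> ?h * norm x ^ j)"
    by (rule choice[THEN exE])
  obtain e where e: "e > 0" "ball 0 e \<subseteq> S" using S unfolding open_contains_ball by blast
  define \<rho> where "\<rho> = min e (Min (range \<delta>))"
  have \<rho>: "0 < \<rho>" "\<rho> \<le> e" "\<rho> \<le> \<delta> i" for i
  proof -
    show "0 < \<rho>" unfolding \<rho>_def using e \<delta> by simp
    have "Min (range \<delta>) \<le> \<delta> i" by (rule Min_le) auto
    moreover have "\<rho> \<le> Min (range \<delta>)" by (simp add: \<rho>_def)
    ultimately show "\<rho> \<le> \<delta> i" by (rule order_trans[rotated])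
    show "\<rho> \<le> e" by (simp add: \<rho>_def)
  qed
  have "\<bar>f x\<bar> \<le> \<eta> * norm x ^ Suc j" if x: "norm x < \<rho>" for x
  proof -
    have "\<bar>f x\<bar> \<le> (\<Sum>i\<in>(UNIV :: 'n set). ?h) * norm x ^ Suc j"
    proof (rule gradient_power_bound_imp_bound[OF _ _ _ x])
      show "f differentiable (at y)" if "norm y < \<rho>" for y
      proof -
        have "y \<in> S" using that \<rho>(2) e by auto
        then show ?thesis using Suc.prems(1) by simp
      qed
      show "\<bar>pd i f y\<bar> \<le> ?h * norm y ^ j" if "norm y < \<rho>" for y i
      proof -
        have "norm y < \<delta> i" using that \<rho>(3)[of i] by linarith
        then show ?thesis using \<delta> by blast
      qed
      show "f 0 = 0" using Suc.prems(2)[of "[]"] by simp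
    qed
    then show ?thesis by simp
  qed
  then show ?case using \<rho>(1) by blast
qed

text \<open>A coordinate is an eigenfunction of every Euler field, with eigenvalue 1 or 0.\<close>

lemma symb_coordinate:
  assumes S: "open S" and w: "\<And>x. x \<in> S \<Longrightarrow> \<bar>x $ i\<bar> \<le> w x"
  shows "symb m S (\<lambda>p :: 'p. w) (\<lambda>p x. complex_of_real (x $ i))"
proof -
  have d: "((\<lambda>x. x $ i) has_derivative (\<lambda>x. x $ i)) (at x)" for x :: "real ^ 'a"
    by (rule bounded_linear_imp_has_derivative[OF bounded_linear_vec_nth])
  have D: "(\<lambda>x. complex_of_real (x $ i)) differentiable (at x)" for x :: "real ^ 'a"
    by (rule differentiable_complex_of_real) (use d in \<open>auto simp: differentiable_def\<close>)
  have e: "eul k (\<lambda>x. complex_of_real (x $ i)) x = (if k = i then complex_of_real (x $ i) else 0)" for k x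
  proof -
    have "(\<lambda>x. x $ i) differentiable (at x)" using d by (auto simp: differentiable_def)
    from eul_of_real[OF this, of k] show ?thesis by (simp add: eul_def pd_eqI[OF d] axis_def)
  qed
  have bd: "\<forall>x\<in>S. norm (complex_of_real (x $ i)) \<le> 1 * w x" using w by simp
  show ?thesis
  proof (induction m)
    case 0
    have "continuous_on S (\<lambda>x. complex_of_real (x $ i))" by (intro continuous_intros)
    then show ?case using bd unfolding symb.simps by blast
  next
    case (Suc m)
    have "symb m S (\<lambda>p :: 'p. w) (\<lambda>p. eul k (\<lambda>x. complex_of_real (x $ i)))" for k
    proof (rule symb_cong[OF S])
      show "symb m S (\<lambda>p :: 'p. w) (\<lambda>p x. if k = i then complex_of_real (x $ i) else 0)"
        using Suc symb_zero by (cases "k = i") auto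
    qed (simp add: e)
    then show ?case using D bd unfolding symb.simps by blast
  qed
qed

text \<open>A derivative lowers the order of vanishing by one and the factor \<open>x_i\<close> of
  the Euler field restores it. The case \<open>j = 0\<close> serves for the amplitude,
  \<open>j = k\<close> for the Taylor remainder.\<close>

lemma symb_Ck_on_flat:
  fixes f :: "real ^ 'n::finite \<Rightarrow> real"
  assumes V: "open V" "cball 0 \<rho> \<subseteq> V" and S: "S = ball 0 \<rho>"
  shows "Ck_on m f V \<Longrightarrow> j \<le> m \<Longrightarrow> (\<And>L. length L < j \<Longrightarrow> foldr partial_deriv L f 0 = 0) \<Longrightarrow>
    symb m S (\<lambda>p :: 'p. \<lambda>x. norm x ^ j) (\<lambda>p x. complex_of_real (f x))"
proof (induction m arbitrary: f j)
  case (0 f j)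
  have cf: "continuous_on V f" using 0(1) by simp
  have "bounded (f ` cball 0 \<rho>)"
    by (intro compact_imp_bounded compact_continuous_image continuous_on_subset[OF cf V(2)]) simp
  then obtain B where B: "\<forall>x\<in>cball 0 \<rho>. \<bar>f x\<bar> \<le> B" by (auto simp: bounded_iff)
  have "continuous_on S (\<lambda>x. complex_of_real (f x))"
    by (intro continuous_on_of_real continuous_on_subset[OF cf]) (use V(2) S in auto)
  moreover have "\<forall>x\<in>S. norm (complex_of_real (f x)) \<le> B * norm x ^ j" using B 0(2) S by simp
  ultimately show ?case unfolding symb.simps by blast
next
  case (Suc m f j)
  have oS: "open S" by (simp add: S)
  have SV: "S \<subseteq> V" using V(2) S by auto
  have df: "f differentiable (at x)" if "x \<in> S" for x using Suc.prems(1) that SV by auto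
  have cf: "Ck_on m (pd i f) V" for i using Suc.prems(1) by (simp add: partial_deriv_eq_pd)
  \<comment> \<open>Truncated at \<open>j = 0\<close>: then there is no order to restore, and
    \<open>x_i\<close> is merely bounded by \<rho>.\<close>
  define j' where "j' = j - 1"
  have dsymb: "symb m S (\<lambda>p :: 'p. \<lambda>x. norm x ^ j') (\<lambda>p x. complex_of_real (pd i f x))" for i
  proof (rule Suc.IH[OF cf])
    show "j' \<le> m" using Suc.prems(2) by (simp add: j'_def)
    show "foldr partial_deriv L (pd i f) 0 = 0" if "length L < j'" for L
      using Suc.prems(3)[of "L @ [i]"] that by (simp add: j'_def flip: partial_deriv_eq_pd)
  qed
  have "\<exists>C. \<forall>x\<in>S. norm (complex_of_real (f x)) \<le> C * norm x ^ j"
  proof (cases j)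
    case 0
    have cf: "continuous_on V f" by (rule Ck_on_continuous[OF Suc.prems(1)])
    have "bounded (f ` cball 0 \<rho>)"
      by (intro compact_imp_bounded compact_continuous_image continuous_on_subset[OF cf V(2)]) simp
    then obtain B where B: "\<forall>x\<in>cball 0 \<rho>. \<bar>f x\<bar> \<le> B" by (auto simp: bounded_iff)
    then show ?thesis using 0 S by (intro exI[of _ B]) simp
  next
    case (Suc l)
    have "\<forall>i. \<exists>C. \<forall>x\<in>S. \<bar>pd i f x\<bar> \<le> C * norm x ^ l"
      using symb_bound[OF dsymb] Suc by (simp add: j'_def)
    then obtain C where C: "\<forall>i. \<forall>x\<in>S. \<bar>pd i f x\<bar> \<le> C i * norm x ^ l" by (rule choice[THEN exE])
    have "\<bar>f x\<bar> \<le> (\<Sum>i\<in>UNIV. C i) * norm x ^ Suc l" if "x \<in> S" for x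
    proof (rule gradient_power_bound_imp_bound[where \<rho>=\<rho>])
      show "f 0 = 0" using Suc.prems(3)[of "[]"] Suc by simp
    qed (use df C that S in auto)
    then show ?thesis using Suc by (intro exI[of _ "\<Sum>i\<in>UNIV. C i"]) simp
  qed
  moreover have "symb m S (\<lambda>p :: 'p. \<lambda>x. norm x ^ j) (\<lambda>p. eul i (\<lambda>x. complex_of_real (f x)))" for i
  proof (rule symb_cong[OF oS])
    have c: "symb m S (\<lambda>p :: 'p. \<lambda>x. norm x ^ (j - j')) (\<lambda>p x. complex_of_real (x $ i))"
    proof (cases j)
      case 0
      have "symb m S (\<lambda>p :: 'p. \<lambda>x. norm x) (\<lambda>p x. complex_of_real (x $ i))"
        by (rule symb_coordinate[OF oS]) (rule component_le_norm_cart)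
      then show ?thesis
        by (rule symb_mono_weight[where C=\<rho>]) (use 0 S in auto)
    next
      case (Suc l)
      have "symb m S (\<lambda>p :: 'p. \<lambda>x. norm x) (\<lambda>p x. complex_of_real (x $ i))"
        by (rule symb_coordinate[OF oS]) (rule component_le_norm_cart)
      then show ?thesis using Suc by (simp add: j'_def)
    qed
    have "symb m S (\<lambda>p :: 'p. \<lambda>x. norm x ^ (j - j') * norm x ^ j') (\<lambda>p x. complex_of_real (x $ i) * complex_of_real (pd i f x))"
      by (rule symb_mult[OF oS c dsymb]) auto
    then show "symb m S (\<lambda>p :: 'p. \<lambda>x. norm x ^ j) (\<lambda>p x. complex_of_real (x $ i) * complex_of_real (pd i f x))"
      by (simp add: j'_def flip: power_add)
    show "complex_of_real (x $ i) * complex_of_real (pd i f x) = eul i (\<lambda>x. complex_of_real (f x)) x" if "x \<in> S" for x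
      unfolding eul_of_real[OF df[OF that]] by (simp add: eul_def)
  qed
  moreover have "(\<lambda>x. complex_of_real (f x)) differentiable (at x)" if "x \<in> S" for x
    by (rule differentiable_complex_of_real[OF df[OF that]])
  ultimately show ?case unfolding symb.simps by blast
qed

section \<open>Coefficients on the coordinate axes\<close>

lemma mpow_axis: "mpow (axis j t) \<alpha> = (if \<alpha> = axis j (\<alpha> $ j) then t ^ (\<alpha> $ j) else 0)"
proof (cases "\<alpha> = axis j (\<alpha> $ j)")
  case True
  then obtain m where m: "\<alpha> = axis j m" by blast
  show ?thesis unfolding m mpow_axis_exponent by simp
next
  case False
  then obtain i where "\<alpha> $ i \<noteq> axis j (\<alpha> $ j) $ i" by (auto simp: vec_eq_iff)
  then have "i \<noteq> j" "\<alpha> $ i \<noteq> 0" by (auto simp: axis_def split: if_splits)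
  then have "mpow (axis j t) \<alpha> = 0" unfolding mpow_def by (intro prod_zero) (auto simp: axis_def intro!: bexI[of _ i])
  then show ?thesis using False by simp
qed

text \<open>Compare the lowest nonvanishing term on the axis with the bound for the remaining ones.\<close>

lemma psum_axis_eq_0:
  fixes d :: "nat ^ 'n::finite \<Rightarrow> real"
  assumes d: "ps_conv R d" "0 < R" and z: "\<And>t. 0 < t \<Longrightarrow> t < R \<Longrightarrow> psum d (axis j t) = 0"
  shows "d (axis j a) = 0"
proof (induction a rule: less_induct)
  case (less a)
  note IH = less.IH
  \<comment> \<open>On the axis the series consists of the term of degree \<open>a\<close> and the
    higher ones: lower terms vanish by induction, and terms off the axis contribute 0.\<close>
  define d1 where "d1 \<alpha> = (if \<alpha> = axis j a then d \<alpha> else 0)" for \<alpha>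
  define d2 where "d2 \<alpha> = (if \<alpha> = axis j (\<alpha> $ j) \<and> a < \<alpha> $ j then d \<alpha> else 0)" for \<alpha>
  have c: "ps_conv R d1" "ps_conv R d2" by (rule ps_conv_mono[OF d(1)], simp add: d1_def d2_def)+
  define r where "r = min 1 R / 2"
  have r: "0 < r" "r < R" "r \<le> 1" using d(2) by (auto simp: r_def)
  have "\<exists>C. \<forall>x. (\<forall>i. \<bar>x $ i\<bar> \<le> r) \<longrightarrow> \<bar>psum d2 x\<bar> \<le> C * monomial_weight {axis j (Suc a)} x"
  proof (rule psum_bound[OF c(2) r])
    fix \<alpha> assume "d2 \<alpha> \<noteq> 0"
    then have "a < \<alpha> $ j" by (auto simp: d2_def split: if_splits)
    then show "\<exists>v\<in>{axis j (Suc a)}. \<forall>i. v $ i \<le> \<alpha> $ i" by (auto simp: axis_def)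
  qed simp
  then obtain C where C: "\<forall>x. (\<forall>i. \<bar>x $ i\<bar> \<le> r) \<longrightarrow> \<bar>psum d2 x\<bar> \<le> C * monomial_weight {axis j (Suc a)} x" by (elim exE)
  have le: "\<bar>d (axis j a)\<bar> \<le> C * t" if t: "0 < t" "t \<le> r" for t
  proof -
    have tR: "\<bar>axis j t $ i\<bar> < R" "\<bar>axis j t $ i\<bar> \<le> r" for i using t r by (auto simp: axis_def)
    have "psum d (axis j t) = psum (\<lambda>\<alpha>. d1 \<alpha> + d2 \<alpha>) (axis j t)"
      unfolding psum_def
    proof (rule infsum_cong)
      fix \<alpha> :: "nat ^ 'n"
      show "d \<alpha> * mpow (axis j t) \<alpha> = (d1 \<alpha> + d2 \<alpha>) * mpow (axis j t) \<alpha>"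
      proof (cases "\<alpha> = axis j (\<alpha> $ j)")
        case True
        have "d \<alpha> = d1 \<alpha> + d2 \<alpha>"
        proof (cases "\<alpha> $ j" a rule: linorder_cases)
          case less
          then have "d \<alpha> = 0" using IH True by metis
          moreover have "\<alpha> \<noteq> axis j a" using less by auto
          ultimately show ?thesis using less by (simp add: d1_def d2_def)
        next
          case equal
          then show ?thesis using True by (simp add: d1_def d2_def)
        next
          case greater
          then have "\<alpha> \<noteq> axis j a" by auto
          then show ?thesis using True greater by (simp add: d1_def d2_def)
        qed
        then show ?thesis by simp
      qed (simp add: mpow_axis)
    qed
    also have "\<dots> = psum d1 (axis j t) + psum d2 (axis j t)" by (rule psum_add[OF c tR(1)])
    finally have "psum d1 (axis j t) = - psum d2 (axis j t)" using z[of t] t r by simp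
    moreover have "psum d1 (axis j t) = d (axis j a) * t ^ a"
      by (subst psum_finite[of "{axis j a}"]) (auto simp: d1_def mpow_axis)
    ultimately have "d (axis j a) * t ^ a = - psum d2 (axis j t)" by simp
    then have "\<bar>d (axis j a) * t ^ a\<bar> = \<bar>psum d2 (axis j t)\<bar>" by simp
    then have "\<bar>d (axis j a)\<bar> * t ^ a = \<bar>psum d2 (axis j t)\<bar>" using t by (simp add: abs_mult)
    also have "\<dots> \<le> C * (t * t ^ a)" using C[rule_format, OF tR(2)] t by (simp add: monomial_weight_def mpow_axis)
    finally have "\<bar>d (axis j a)\<bar> * t ^ a \<le> (C * t) * t ^ a" by (simp add: mult.assoc)
    then show ?thesis using t by (simp add: mult_le_cancel_right)
  qed
  show ?case
  proof (rule ccontr)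
    assume "d (axis j a) \<noteq> 0"
    then have p: "0 < \<bar>d (axis j a)\<bar>" by simp
    have C0: "0 < C" using less_le_trans[OF p le[OF r(1) order_refl]] r(1) by (simp add: zero_less_mult_iff)
    \<comment> \<open>So small that the bound \<open>C t\<close> is at most half of the coefficient
      it should dominate.\<close>
    define t where "t = min r (\<bar>d (axis j a)\<bar> / (2 * C))"
    have t: "0 < t" "t \<le> r" using r p C0 by (auto simp: t_def)
    have "C * t \<le> C * (\<bar>d (axis j a)\<bar> / (2 * C))" using C0 by (intro mult_left_mono) (auto simp: t_def)
    also have "\<dots> < \<bar>d (axis j a)\<bar>" using C0 p by simp
    finally show False using le[OF t] by simp
  qed
qed


subsection \<open>Nondegenerate phases\<close>

text \<open>A monotone subsequence that decreases is eventually constant, by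
  well-foundedness.\<close>

lemma nat_seq_nondecreasing_subseq:
  fixes g :: "nat \<Rightarrow> nat"
  shows "\<exists>r :: nat \<Rightarrow> nat. strict_mono r \<and> mono (\<lambda>n. g (r n))"
proof -
  obtain f :: "nat \<Rightarrow> nat" where f: "strict_mono f" "monoseq (\<lambda>n. g (f n))"
    using seq_monosub[of g] by blast
  show ?thesis
  proof (cases "\<forall>m. \<forall>n\<ge>m. g (f m) \<le> g (f n)")
    case True
    then show ?thesis using f(1) by (intro exI[of _ f]) (auto simp: mono_def)
  next
    case False
    then have dec: "\<forall>m. \<forall>n\<ge>m. g (f n) \<le> g (f m)" using f(2) unfolding monoseq_def by blast
    define k where "k = (ARG_MIN (\<lambda>n. g (f n)) n. True)"
    have k: "g (f k) \<le> g (f n)" for n unfolding k_def by (rule arg_min_nat_le) simp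
    have c: "g (f (n + k)) = g (f k)" for n using dec k[of "n + k"] by (intro antisym) auto
    show ?thesis
    proof (intro exI[of _ "\<lambda>n. f (n + k)"] conjI)
      show "strict_mono (\<lambda>n. f (n + k))" using f(1) by (simp add: strict_mono_def)
      show "mono (\<lambda>n. g (f (n + k)))" unfolding c by (simp add: mono_def)
    qed
  qed
qed

lemma vec_seq_nondecreasing_subseq:
  fixes f :: "nat \<Rightarrow> nat ^ 'n::finite"
  shows "\<exists>r :: nat \<Rightarrow> nat. strict_mono r \<and> (\<forall>i. mono (\<lambda>n. f (r n) $ i))"
proof -
  have "finite I \<Longrightarrow> \<exists>r :: nat \<Rightarrow> nat. strict_mono r \<and> (\<forall>i\<in>I. mono (\<lambda>n. f (r n) $ i))" for I :: "'n set"
  proof (induction I rule: finite_induct)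
    case empty
    show ?case by (intro exI[of _ id]) (auto simp: strict_mono_def)
  next
    case (insert i I)
    then obtain r :: "nat \<Rightarrow> nat" where r: "strict_mono r" "\<forall>i\<in>I. mono (\<lambda>n. f (r n) $ i)" by blast
    obtain s :: "nat \<Rightarrow> nat" where s: "strict_mono s" "mono (\<lambda>n. f (r (s n)) $ i)"
      using nat_seq_nondecreasing_subseq[of "\<lambda>n. f (r n) $ i"] by blast
    have "mono (\<lambda>n. f (r (s n)) $ k)" if "k \<in> I" for k
      using r(2) that strict_mono_mono[OF s(1)] by (auto simp: mono_def)
    moreover have "strict_mono (\<lambda>n. r (s n))" using strict_mono_o[OF r(1) s(1)] by (simp add: o_def)
    ultimately show ?case using s(2) by (intro exI[of _ "\<lambda>n. r (s n)"]) auto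
  qed
  from this[of UNIV] show ?thesis by simp
qed

text \<open>Infinitely many minimal elements would contain a sequence nondecreasing in every
  coordinate, hence two distinct comparable ones. Thus an infinite support still has a finitely
  generated Newton polyhedron.\<close>

lemma dickson:
  fixes S :: "(nat ^ 'n::finite) set"
  shows "\<exists>V\<subseteq>S. finite V \<and> (\<forall>\<alpha>\<in>S. \<exists>v\<in>V. \<forall>i. v $ i \<le> \<alpha> $ i)"
proof -
  define V where "V = {v\<in>S. \<forall>u\<in>S. (\<forall>i. u $ i \<le> v $ i) \<longrightarrow> u = v}"
  have "finite V"
  proof (rule ccontr)
    assume "infinite V"
    then obtain f :: "nat \<Rightarrow> nat ^ 'n" where f: "inj f" "range f \<subseteq> V"
      using infinite_countable_subset by blast
    obtain r :: "nat \<Rightarrow> nat" where r: "strict_mono r" "\<forall>i. mono (\<lambda>n. f (r n) $ i)"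
      using vec_seq_nondecreasing_subseq[of f] by blast
    have "f (r 0) = f (r 1)" using f(2) r(2) unfolding V_def mono_def by blast
    then have "r 0 = r 1" using f(1) by (simp add: inj_eq)
    then show False using strict_monoD[OF r(1), of 0 1] by simp
  qed
  moreover have "\<exists>v\<in>V. \<forall>i. v $ i \<le> \<alpha> $ i" if "\<alpha> \<in> S" for \<alpha>
    using that
  proof (induction "vsize \<alpha>" arbitrary: \<alpha> rule: less_induct)
    case (less \<alpha>)
    show ?case
    proof (cases "\<alpha> \<in> V")
      case False
      then obtain u where u: "u \<in> S" "\<forall>i. u $ i \<le> \<alpha> $ i" "u \<noteq> \<alpha>" using less.prems unfolding V_def by blast
      then obtain i where "u $ i \<noteq> \<alpha> $ i" by (auto simp: vec_eq_iff)
      then have "u $ i < \<alpha> $ i" using u(2) by (simp add: order_less_le)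
      then have "vsize u < vsize \<alpha>" unfolding vsize_def using u(2) by (intro sum_strict_mono_ex1) auto
      then obtain v where v: "v \<in> V" "\<forall>i. v $ i \<le> u $ i" using less.hyps u(1) by blast
      have "\<forall>i. v $ i \<le> \<alpha> $ i" using v(2) u(2) by (meson order_trans)
      then show ?thesis using v(1) by blast
    qed auto
  qed
  ultimately show ?thesis by (intro exI[of _ V]) (auto simp: V_def)
qed

lemma eul_pmono: "eul i (pmono A a g) x = (\<Sum>\<alpha>\<in>A. a \<alpha> * (real (g \<alpha> $ i) * mpow x (g \<alpha>)))"
  unfolding eul_def pd_pmono pmono_def real_scaleR_def sum_distrib_left
proof (rule sum.cong[OF refl])
  fix \<alpha>
  have "real (g \<alpha> $ i) * mpow x (g \<alpha>) = x $ i * (real (g \<alpha> $ i) * mpow x (g \<alpha> - axis i 1))"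
    unfolding times_dmono[symmetric] dmono_eq ..
  then show "x $ i * (a \<alpha> * real (g \<alpha> $ i) * mpow x (g \<alpha> - axis i 1)) = a \<alpha> * (real (g \<alpha> $ i) * mpow x (g \<alpha>))"
    by (simp only: mult_ac)
qed

text \<open>Monomials are eigenfunctions of the Euler fields; the factor \<open>k\<close> is there
  so that the induction can absorb the eigenvalues.\<close>

lemma symb_mpow:
  assumes S: "open S"
  shows "symb m S (\<lambda>p :: 'p. \<lambda>x. \<bar>mpow x \<beta>\<bar>) (\<lambda>p x. complex_of_real (k * mpow x \<beta>))"
proof (induction m arbitrary: k)
  case 0
  have "continuous_on S (\<lambda>x. complex_of_real (k * mpow x \<beta>))" by (intro continuous_intros)
  then show ?case by (auto simp: norm_mult intro!: exI[of _ "\<bar>k\<bar>"])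
next
  case (Suc m)
  have d: "((\<lambda>x. k * mpow x \<beta>) has_derivative (\<lambda>h. k * (\<Sum>i\<in>UNIV. h $ i * dmono i \<beta> x))) (at x)" for x
    by (intro has_derivative_mult_right has_derivative_mpow)
  have df: "(\<lambda>x. k * mpow x \<beta>) differentiable (at x)" for x by (rule differentiableI[OF d])
  have "symb m S (\<lambda>p :: 'p. \<lambda>x. \<bar>mpow x \<beta>\<bar>) (\<lambda>p. eul i (\<lambda>x. complex_of_real (k * mpow x \<beta>)))" for i
  proof (rule symb_cong[OF S Suc.IH[of "k * real (\<beta> $ i)"]])
    fix p :: 'p and x
    have "eul i (\<lambda>x. k * mpow x \<beta>) x = k * real (\<beta> $ i) * mpow x \<beta>"
      using eul_mult[of "\<lambda>x. k" x "\<lambda>x. mpow x \<beta>" i, OF differentiable_const differentiableI[OF has_derivative_mpow]]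
      by (simp add: eul_mpow mult.assoc)
    then show "complex_of_real (k * real (\<beta> $ i) * mpow x \<beta>) = eul i (\<lambda>x. complex_of_real (k * mpow x \<beta>)) x"
      unfolding eul_of_real[OF df] by simp
  qed
  moreover have "\<forall>x\<in>S. norm (complex_of_real (k * mpow x \<beta>)) \<le> \<bar>k\<bar> * \<bar>mpow x \<beta>\<bar>"
    unfolding norm_of_real abs_mult by simp
  ultimately show ?case using differentiable_complex_of_real[OF df] unfolding symb.simps by blast
qed

section \<open>From symbol bounds to the oscillatory estimate\<close>

text \<open>\<open>M\<close> integrations by parts with the monomial as the weight of the amplitude,
  followed by the dyadic estimate of the resulting positive integral.\<close>

lemma osc_estimate_core:
  fixes V :: "(nat ^ 'n::finite) set" and \<phi> \<psi> :: "real ^ 'n \<Rightarrow> real"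
  assumes V: "finite V" "V \<noteq> {}" "0 \<notin> V"
    and S: "open S" "\<And>x i. x \<in> S \<Longrightarrow> \<bar>x $ i\<bar> \<le> 1"
    and \<Phi>: "symb (Suc M) S (\<lambda>l :: real. monomial_weight V) (\<lambda>l x. complex_of_real (\<phi> x))"
    and c: "c > 0" "\<And>x. x \<in> S \<Longrightarrow> c * (monomial_weight V x)\<^sup>2 \<le> (\<Sum>i\<in>UNIV. (eul i \<phi> x)\<^sup>2)"
    and \<psi>: "symb M S (\<lambda>l :: real. \<lambda>x. 1) (\<lambda>l x. complex_of_real (\<psi> x))"
    and K: "compact K" "K \<subseteq> S" "\<And>x. x \<notin> K \<Longrightarrow> \<psi> x = 0"
    and M: "newton_floor (newton_hull V) (\<beta> + 1) < real M"
  shows "osc_estimate (newton_hull V) \<phi> \<psi> \<beta>"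
proof -
  let ?w = "monomial_weight V"
  let ?c = "newton_floor (newton_hull V) (\<beta> + 1)"
  let ?r = "newton_log_index (newton_hull V) \<beta> - 1"
  have w0: "0 \<le> ?w x" for x by (simp add: monomial_weight_def sum_nonneg)
  have f: "symb M S (\<lambda>l :: real. \<lambda>x. \<bar>mpow x \<beta>\<bar>) (\<lambda>l x. complex_of_real (mpow x \<beta> * \<psi> x))"
    using symb_mult[OF S(1) symb_mpow[OF S(1), of M \<beta> 1] \<psi>] by simp
  have "\<exists>C\<ge>0. \<forall>l. ennreal (cmod (LINT x|lborel. exp (\<i> * complex_of_real (l * \<phi> x)) * complex_of_real (mpow x \<beta> * \<psi> x)))
     \<le> (\<integral>\<^sup>+x\<in>S. ennreal (C * (\<bar>mpow x \<beta>\<bar> * inverse (1 + \<bar>l\<bar> * ?w x) ^ M)) \<partial>lborel)"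
    by (rule ibp_iterate[OF S(1) K(1,2) w0 c \<Phi> _ f]) (simp_all add: K(3))
  then obtain C1 where C1: "C1 \<ge> 0" "\<forall>l. ennreal (cmod (osc_integral \<phi> \<psi> \<beta> l))
     \<le> (\<integral>\<^sup>+x\<in>S. ennreal (C1 * (\<bar>mpow x \<beta>\<bar> * inverse (1 + \<bar>l\<bar> * ?w x) ^ M)) \<partial>lborel)"
    unfolding osc_integral_def by (elim exE conjE)
  have c0: "0 < ?c" by (rule newton_floor_geometry(1)[OF V])
  from newton_floor_geometry(2)[OF V, of \<beta>]
  obtain p D where p: "rvec (\<beta> + 1) = ?c *\<^sub>R p" and D: "independent (insert p D)" "p \<notin> D"
    and low0: "\<forall>t. (\<forall>i. 0 \<le> t $ i) \<longrightarrow> min_weight V t \<le> p \<bullet> t"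
    and low: "\<forall>t. \<forall>u\<in>D. (\<forall>i. 0 \<le> t $ i) \<longrightarrow> min_weight V t \<le> p \<bullet> t - \<bar>u \<bullet> t\<bar>"
    and idx: "CARD('n) - (card D + 1) = ?r"
    by (elim exE conjE)
  have "\<exists>C>0. \<forall>l\<ge>1. (\<integral>\<^sup>+x\<in>S. ennreal (\<bar>mpow x \<beta>\<bar> * inverse (1 + l * ?w x) ^ M) \<partial>lborel)
     \<le> ennreal (C * l powr (- ?c) * (1 + ln l) ^ (CARD('n) - (card D + 1)))"
    by (rule nn_integral_monomial_weight_le[OF V(1,2) S(2) c0 M p D]) (use low0 low in auto)
  then obtain C2 where C2: "C2 > 0" "\<forall>l\<ge>1. (\<integral>\<^sup>+x\<in>S. ennreal (\<bar>mpow x \<beta>\<bar> * inverse (1 + l * ?w x) ^ M) \<partial>lborel)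
     \<le> ennreal (C2 * l powr (- ?c) * (1 + ln l) ^ ?r)"
    unfolding idx by (elim exE conjE)
  have meas: "(\<lambda>x. ennreal (\<bar>mpow x \<beta>\<bar> * inverse (1 + l * ?w x) ^ M) * indicator S x) \<in> borel_measurable lborel"
    if "l > 0" for l
  proof -
    have "continuous_on UNIV (\<lambda>x. \<bar>mpow x \<beta>\<bar> * inverse (1 + l * ?w x) ^ M)"
      using w0 that unfolding monomial_weight_def
      by (intro continuous_intros ballI) (metis add_pos_nonneg less_irrefl less_imp_le mult_nonneg_nonneg zero_less_one)
    then have "(\<lambda>x. \<bar>mpow x \<beta>\<bar> * inverse (1 + l * ?w x) ^ M) \<in> borel_measurable borel"
      by (rule borel_measurable_continuous_onI)
    moreover have "S \<in> sets borel" using S(1) by simp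
    ultimately show ?thesis by measurable
  qed
  show ?thesis
    unfolding osc_estimate_def
  proof (intro exI[of _ "(C1 + 1) * C2 * 3 ^ ?r"] conjI allI impI)
    show "0 < (C1 + 1) * C2 * 3 ^ ?r" using C1(1) C2(1) by simp
    fix l :: real assume l: "2 < l"
    have "ln 2 \<le> ln l" using l by simp
    \<comment> \<open>For \<open>l > 2\<close> the logarithm exceeds 2/3, so \<open>1 + ln l\<close>
      is absorbed into \<open>3 ln l\<close>.\<close>
    then have lnl: "1 + ln l \<le> 3 * ln l" "0 \<le> ln l" using ln2_ge_two_thirds by linarith+
    let ?B = "C2 * l powr (- ?c) * (1 + ln l) ^ ?r"
    have B0: "0 \<le> ?B" using C2(1) lnl by simp
    have "ennreal (cmod (osc_integral \<phi> \<psi> \<beta> l))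
     \<le> (\<integral>\<^sup>+x. ennreal C1 * (ennreal (\<bar>mpow x \<beta>\<bar> * inverse (1 + l * ?w x) ^ M) * indicator S x) \<partial>lborel)"
    proof -
      have "ennreal (C1 * (\<bar>mpow x \<beta>\<bar> * inverse (1 + \<bar>l\<bar> * ?w x) ^ M)) * indicator S x
        = ennreal C1 * (ennreal (\<bar>mpow x \<beta>\<bar> * inverse (1 + l * ?w x) ^ M) * indicator S x)" for x
        using l w0[of x] C1(1) by (simp add: ennreal_mult mult.assoc)
      then show ?thesis using C1(2)[rule_format, of l] by simp
    qed
    also have "\<dots> = ennreal C1 * (\<integral>\<^sup>+x\<in>S. ennreal (\<bar>mpow x \<beta>\<bar> * inverse (1 + l * ?w x) ^ M) \<partial>lborel)"
      using l by (intro nn_integral_cmult meas) simp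
    also have "\<dots> \<le> ennreal C1 * ennreal ?B"
      using C2(2) l by (intro mult_left_mono) auto
    also have "\<dots> = ennreal (C1 * ?B)" using C1(1) B0 by (simp add: ennreal_mult)
    finally have "cmod (osc_integral \<phi> \<psi> \<beta> l) \<le> C1 * ?B" using C1(1) B0 by (simp add: ennreal_le_iff)
    also have "\<dots> \<le> (C1 + 1) * (C2 * l powr (- ?c) * (3 * ln l) ^ ?r)"
      using C1(1) C2(1) lnl by (intro mult_mono power_mono) auto
    finally show "cmod (osc_integral \<phi> \<psi> \<beta> l) \<le> (C1 + 1) * C2 * 3 ^ ?r * l powr (- ?c) * ln l ^ ?r"
      by (simp add: power_mult_distrib mult_ac)
  qed
qed

text \<open>A vanishing power series has empty polyhedron and default exponent 0, so the trivial
  bound by the integral of the absolute value suffices; dividing by a power of \<open>ln 2\<close>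
  accounts for the logarithm.\<close>

lemma osc_estimate_empty: "osc_estimate {} \<phi> \<psi> \<beta>"
proof -
  have fl: "newton_floor {} (\<beta> + 1) = 0" by (simp add: newton_floor_def facet_normals_def)
  let ?r = "newton_log_index {} \<beta> - 1"
  define B where "B = (LINT x|lborel. \<bar>mpow x \<beta> * \<psi> x\<bar>)"
  have B: "cmod (osc_integral \<phi> \<psi> \<beta> l) \<le> B" for l
  proof -
    have "cmod (osc_integral \<phi> \<psi> \<beta> l) \<le>
      (LINT x|lborel. cmod (exp (\<i> * complex_of_real (l * \<phi> x)) * complex_of_real (mpow x \<beta> * \<psi> x)))"
      unfolding osc_integral_def by (rule integral_norm_bound)
    also have "\<dots> = B" unfolding B_def norm_mult norm_exp_eq_Re by (simp add: abs_mult norm_mult)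
    finally show ?thesis .
  qed
  have B0: "0 \<le> B" unfolding B_def by simp
  have l2: "0 < ln (2 :: real)" by simp
  show ?thesis unfolding osc_estimate_def fl
  proof (intro exI[of _ "(B + 1) / ln 2 ^ ?r"] conjI allI impI)
    show "0 < (B + 1) / ln 2 ^ ?r" using B0 l2 by simp
    fix l :: real assume l: "2 < l"
    have "ln 2 ^ ?r \<le> ln l ^ ?r" using l by (intro power_mono) auto
    then have "1 \<le> ln l ^ ?r / ln 2 ^ ?r" using l2 by (simp add: pos_le_divide_eq)
    then have "(B + 1) * 1 \<le> (B + 1) * (ln l ^ ?r / ln 2 ^ ?r)" using B0 by (intro mult_left_mono) auto
    then have "B \<le> (B + 1) / ln 2 ^ ?r * ln l ^ ?r" by simp
    then show "cmod (osc_integral \<phi> \<psi> \<beta> l) \<le> (B + 1) / ln 2 ^ ?r * l powr - 0 * ln l ^ ?r"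
      using B[of l] l by simp
  qed
qed

section \<open>Symbol bounds for nondegenerate phases\<close>

text \<open>A positive covector attains its minimum over the polyhedron on a compact face, and the
  supported exponents on that face are precisely the minimisers in \<open>V\<close>. So the face
  polynomial of the definition is the sum over the selected part of \<open>V\<close>.\<close>

lemma analytic_nondegenerate_face_sum:
  fixes P :: "real ^ 'n::finite \<Rightarrow> real"
  assumes P: "analytic_nondegenerate P" and V: "finite V" "V \<noteq> {}" "V \<subseteq> ps_supp P"
    and dom: "\<forall>\<alpha>\<in>ps_supp P. \<exists>v\<in>V. \<forall>i. v $ i \<le> \<alpha> $ i"
    and \<omega>: "\<And>i. 0 < \<omega> $ i" and y: "\<And>i. y $ i \<noteq> 0"
  shows "\<exists>i. (\<Sum>\<alpha>\<in>{v\<in>V. rvec v \<bullet> \<omega> = min_weight V \<omega>}. real (\<alpha> $ i) * ps_coeff P \<alpha> * mpow y \<alpha>) \<noteq> 0"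
proof -
  let ?c = "ps_coeff P" and ?m = "min_weight V \<omega>"
  let ?V1 = "{v\<in>V. rvec v \<bullet> \<omega> = ?m}"
  have N: "newton_polyhedron P = newton_hull V"
    unfolding newton_polyhedron_eq_hull by (rule newton_hull_dominated[OF V(3)]) (use dom in blast)
  define F where "F = newton_hull V \<inter> {x. \<omega> \<bullet> x = ?m}"
  have ge: "?m \<le> \<omega> \<bullet> x" if "x \<in> newton_hull V" for x
    using newton_hull_inner_ge[OF V(1) that, of \<omega>] \<omega> by (simp add: inner_commute less_imp_le)
  have Fface: "F face_of newton_hull V"
    unfolding F_def by (rule face_of_Int_supporting_hyperplane_ge[OF convex_newton_hull ge])
  have "?m \<in> (\<lambda>v. rvec v \<bullet> \<omega>) ` V" unfolding min_weight_def using V by (intro Min_in) auto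
  then obtain v0 where v0: "v0 \<in> V" "rvec v0 \<bullet> \<omega> = ?m" by auto
  have V1F: "rvec v \<in> F" if "v \<in> ?V1" for v
    using that rvec_in_newton_hull by (auto simp: F_def inner_commute)
  then have Fne: "F \<noteq> {}" using v0 by blast
  have nonneg: "0 \<le> x $ i" if "x \<in> newton_hull V" for x i
  proof -
    have "min_weight V (axis i 1) \<le> x \<bullet> axis i 1"
      by (rule newton_hull_inner_ge[OF V(1) that]) (simp add: axis_def)
    moreover have "0 \<le> min_weight V (axis i 1)"
      unfolding min_weight_def using V by (subst Min_ge_iff) (auto simp: inner_axis)
    ultimately show ?thesis by (simp add: inner_axis)
  qed
  \<comment> \<open>On \<open>F\<close> the nonnegative terms \<open>\<omega>_i x_i\<close> add up
    to the constant \<open>?m\<close>, which bounds each coordinate.\<close>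
  have Fb: "x $ i \<le> ?m / \<omega> $ i" if "x \<in> F" for x i
  proof -
    have x: "x \<in> newton_hull V" "\<omega> \<bullet> x = ?m" using that by (auto simp: F_def)
    have "\<omega> $ i * x $ i \<le> (\<Sum>i\<in>UNIV. \<omega> $ i * x $ i)"
      using \<omega> nonneg[OF x(1)] by (intro member_le_sum) (auto simp: less_imp_le)
    also have "\<dots> = ?m" using x(2) by (simp add: inner_vec_def)
    finally show ?thesis using \<omega>[of i] by (simp add: pos_le_divide_eq mult.commute)
  qed
  have "F \<subseteq> cbox 0 (\<chi> i. ?m / \<omega> $ i)"
    using Fb nonneg by (auto simp: mem_box_cart F_def)
  then have "bounded F" using bounded_cbox bounded_subset by blast
  moreover have "closed F"
    unfolding F_def by (intro closed_Int closed_newton_hull V closed_hyperplane)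
  ultimately have "compact F" by (simp add: compact_eq_bounded_closed)
  moreover have "(\<Prod>i\<in>UNIV. y $ i) \<noteq> 0" using y by simp
  ultimately have "infnorm (y * gradient (face_part P F) y) \<noteq> 0"
    using P Fface Fne unfolding analytic_nondegenerate_def N by blast
  then have "y * gradient (face_part P F) y \<noteq> 0" by (simp add: infnorm_eq_0)
  then obtain i where i: "y $ i * partial_deriv i (face_part P F) y \<noteq> 0"
    by (auto simp: vec_eq_iff gradient_def)
  let ?A = "{\<alpha>. rvec \<alpha> \<in> F}"
  have fA: "finite ?A"
  proof (rule finite_subset)
    define b where "b i = nat \<lceil>?m / \<omega> $ i\<rceil>" for i
    show "?A \<subseteq> {\<alpha>. \<forall>i. \<alpha> $ i \<in> {..b i}}"
    proof (intro subsetI CollectI allI)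
      fix \<alpha> i assume "\<alpha> \<in> ?A"
      then have "real (\<alpha> $ i) \<le> ?m / \<omega> $ i" using Fb[of "rvec \<alpha>" i] by simp
      then show "\<alpha> $ i \<in> {..b i}" unfolding b_def atMost_iff by linarith
    qed
    show "finite {\<alpha>. \<forall>i. \<alpha> $ i \<in> {..b i}}" by (rule finite_vec_bounded) simp
  qed
  have fp: "face_part P F = pmono ?A ?c (\<lambda>\<alpha>. \<alpha>)" by (rule ext) (simp add: face_part_def pmono_def)
  have "y $ i * partial_deriv i (face_part P F) y = eul i (pmono ?A ?c (\<lambda>\<alpha>. \<alpha>)) y"
    by (simp add: fp eul_def partial_deriv_eq_pd)
  also have "\<dots> = (\<Sum>\<alpha>\<in>?A. ?c \<alpha> * (real (\<alpha> $ i) * mpow y \<alpha>))" by (rule eul_pmono)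
  also have "\<dots> = (\<Sum>\<alpha>\<in>?V1. ?c \<alpha> * (real (\<alpha> $ i) * mpow y \<alpha>))"
  proof (rule sum.mono_neutral_right[OF fA])
    show "?V1 \<subseteq> ?A" using V1F by blast
    show "\<forall>\<alpha>\<in>?A - ?V1. ?c \<alpha> * (real (\<alpha> $ i) * mpow y \<alpha>) = 0"
    proof
      fix \<alpha> assume \<alpha>: "\<alpha> \<in> ?A - ?V1"
      have "?c \<alpha> = 0"
      proof (rule ccontr)
        assume "?c \<alpha> \<noteq> 0"
        then have "\<alpha> \<in> ps_supp P" by (simp add: ps_supp_def)
        then obtain v where v: "v \<in> V" "\<forall>i. v $ i \<le> \<alpha> $ i" using dom by blast
        have "?m \<le> rvec v \<bullet> \<omega>" using ge[OF rvec_in_newton_hull[OF v(1)]] by (simp add: inner_commute)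
        moreover have a: "rvec \<alpha> \<bullet> \<omega> = ?m" using \<alpha> by (simp add: F_def inner_commute)
        \<comment> \<open>An exponent strictly above \<open>v\<close> has a strictly larger pairing
          with the positive covector and would not lie on \<open>F\<close>.\<close>
        moreover have "\<alpha> = v"
        proof (rule ccontr)
          assume "\<alpha> \<noteq> v"
          then obtain j where "\<alpha> $ j \<noteq> v $ j" by (auto simp: vec_eq_iff)
          then have j: "v $ j < \<alpha> $ j" using v(2) by (simp add: order_less_le)
          have "rvec v \<bullet> \<omega> < rvec \<alpha> \<bullet> \<omega>"
            unfolding inner_vec_def inner_real_def rvec_nth
          proof (rule sum_strict_mono_ex1)
            show "\<forall>i\<in>UNIV. real (v $ i) * \<omega> $ i \<le> real (\<alpha> $ i) * \<omega> $ i"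
              using v(2) \<omega> by (auto intro!: mult_right_mono less_imp_le)
            show "\<exists>i\<in>UNIV. real (v $ i) * \<omega> $ i < real (\<alpha> $ i) * \<omega> $ i"
              using j \<omega>[of j] by (intro bexI[of _ j]) auto
          qed simp
          then show False using \<open>?m \<le> rvec v \<bullet> \<omega>\<close> a by simp
        qed
        ultimately have "\<alpha> \<in> ?V1" using v(1) by simp
        then show False using \<alpha> by blast
      qed
      then show "?c \<alpha> * (real (\<alpha> $ i) * mpow y \<alpha>) = 0" by simp
    qed
  qed
  finally show ?thesis using i by (intro exI[of _ i]) (simp add: mult_ac)
qed

lemma analytic_nondegenerate_data:
  fixes P :: "real ^ 'n::finite \<Rightarrow> real"
  assumes P: "analytic_nondegenerate P" and P0: "P 0 = 0"
  shows "\<exists>V R r \<delta>. finite V \<and> V \<subseteq> ps_supp P \<and> 0 \<notin> V \<and> newton_polyhedron P = newton_hull V \<and>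
    0 < r \<and> r < R \<and> r \<le> 1 \<and> 0 < \<delta> \<and> ps_conv R (ps_coeff P) \<and>
    (\<forall>x. (\<forall>i. \<bar>x $ i\<bar> < R) \<longrightarrow> P x = psum (ps_coeff P) x) \<and>
    (\<forall>\<alpha>. ps_coeff P \<alpha> \<noteq> 0 \<longrightarrow> (\<exists>v\<in>V. \<forall>i. v $ i \<le> \<alpha> $ i)) \<and>
    (\<forall>x. (\<forall>i. \<bar>x $ i\<bar> < r) \<longrightarrow> \<delta> * monomial_weight V x \<le> (\<Sum>i\<in>UNIV. \<bar>eul i P x\<bar>))"
proof -
  let ?c = "ps_coeff P"
  have "\<exists>c. has_power_series P c" using P by (simp add: analytic_nondegenerate_def analytic_at_0_def)
  then have ps: "has_power_series P ?c" unfolding ps_coeff_def by (rule someI_ex)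
  have "\<exists>R>0. ps_conv R ?c \<and> (\<forall>x. (\<forall>i. \<bar>x $ i\<bar> < R) \<longrightarrow> P x = psum ?c x)"
    by (rule has_power_series_psum[OF ps]) blast
  then obtain R where R: "0 < R" "ps_conv R ?c" "\<forall>x. (\<forall>i. \<bar>x $ i\<bar> < R) \<longrightarrow> P x = psum ?c x"
    by (elim exE conjE)
  obtain V where V: "V \<subseteq> ps_supp P" "finite V" "\<forall>\<alpha>\<in>ps_supp P. \<exists>v\<in>V. \<forall>i. v $ i \<le> \<alpha> $ i"
    using dickson[of "ps_supp P"] by (elim exE conjE)
  have dom: "\<exists>v\<in>V. \<forall>i. v $ i \<le> \<alpha> $ i" if "?c \<alpha> \<noteq> 0" for \<alpha> using V(3) that by (simp add: ps_supp_def)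
  \<comment> \<open>The value at the origin is the constant coefficient; its vanishing keeps 0 out
    of \<open>V\<close>.\<close>
  have "?c 0 = 0"
  proof -
    have m0: "mpow 0 \<alpha> = (if \<alpha> = 0 then 1 else 0)" for \<alpha> :: "nat ^ 'n"
      by (auto simp: mpow_def vec_eq_iff power_0_left)
    have "psum ?c 0 = (\<Sum>\<alpha>\<in>{0}. ?c \<alpha> * mpow 0 \<alpha>)"
    proof -
      have "psum ?c 0 = infsum (\<lambda>\<alpha>. ?c \<alpha> * mpow 0 \<alpha>) {0}"
        unfolding psum_def by (rule infsum_cong_neutral) (auto simp: m0)
      then show ?thesis by simp
    qed
    then show ?thesis using R(1,3) P0 by (simp add: m0)
  qed
  then have "0 \<notin> V" using V(1) by (auto simp: ps_supp_def)
  have nd: "\<exists>i. (\<Sum>\<alpha>\<in>{v\<in>V. rvec v \<bullet> \<omega> = min_weight V \<omega>}. real (\<alpha> $ i) * ?c \<alpha> * mpow y \<alpha>) \<noteq> 0"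
    if "\<And>i. 0 < \<omega> $ i" "\<And>i. y $ i \<noteq> 0" "V \<noteq> {}" for \<omega> y
    by (rule analytic_nondegenerate_face_sum[OF P V(2) that(3) V(1,3) that(1,2)])
  have "\<exists>r>0. \<exists>\<delta>>0. r < R \<and> (\<forall>x. (\<forall>i. \<bar>x $ i\<bar> < r) \<longrightarrow>
      \<delta> * monomial_weight V x \<le> (\<Sum>i\<in>UNIV. \<bar>psum (\<lambda>\<alpha>. real (\<alpha> $ i) * ?c \<alpha>) x\<bar>))"
    by (rule psum_gradient_lower_bound[OF R(2,1) V(2)]) (fact dom, fact nd)
  then obtain r \<delta> where r: "0 < r" "0 < \<delta>" "r < R" "\<forall>x. (\<forall>i. \<bar>x $ i\<bar> < r) \<longrightarrow>
      \<delta> * monomial_weight V x \<le> (\<Sum>i\<in>UNIV. \<bar>psum (\<lambda>\<alpha>. real (\<alpha> $ i) * ?c \<alpha>) x\<bar>)"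
    by (elim exE conjE)
  have eulP: "eul i P x = psum (\<lambda>\<alpha>. real (\<alpha> $ i) * ?c \<alpha>) x" if x: "\<And>i. \<bar>x $ i\<bar> < R" for x i
  proof -
    have "{y :: real ^ 'n. \<forall>i. \<bar>y $ i\<bar> < R} = box (\<chi> i. - R) (\<chi> i. R)"
      by (auto simp: mem_box_cart abs_less_iff minus_less_iff)
    then have "open {y :: real ^ 'n. \<forall>i. \<bar>y $ i\<bar> < R}" using open_box by simp
    then have "eul i P x = eul i (psum ?c) x" by (rule eul_cong_open) (use x R(3) in auto)
    then show ?thesis using psum_has_derivative(2)[OF R(2) x] by simp
  qed
  have N: "newton_polyhedron P = newton_hull V"
    unfolding newton_polyhedron_eq_hull by (rule newton_hull_dominated[OF V(1)]) (use V(3) in blast)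
  show ?thesis
  proof (rule exI[of _ V], rule exI[of _ R], rule exI[of _ "min r 1"], rule exI[of _ \<delta>], intro conjI)
    show "\<forall>x. (\<forall>i. \<bar>x $ i\<bar> < min r 1) \<longrightarrow> \<delta> * monomial_weight V x \<le> (\<Sum>i\<in>UNIV. \<bar>eul i P x\<bar>)"
    proof (intro allI impI)
      fix x :: "real ^ 'n" assume x: "\<forall>i. \<bar>x $ i\<bar> < min r 1"
      have "\<bar>x $ i\<bar> < R" for i using x[rule_format, of i] r(3) by linarith
      from eulP[OF this] show "\<delta> * monomial_weight V x \<le> (\<Sum>i\<in>UNIV. \<bar>eul i P x\<bar>)"
        using r(4) x by simp
    qed
  qed (use r R V dom N \<open>0 \<notin> V\<close> in auto)
qed

lemma symb_analytic:
  fixes P :: "real ^ 'n::finite \<Rightarrow> real"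
  assumes V: "finite V" and r: "0 < r" "r < R" "r \<le> 1" and c: "ps_conv R c"
    and P: "\<forall>x. (\<forall>i. \<bar>x $ i\<bar> < R) \<longrightarrow> P x = psum c x"
    and dom: "\<forall>\<alpha>. c \<alpha> \<noteq> 0 \<longrightarrow> (\<exists>v\<in>V. \<forall>i. v $ i \<le> \<alpha> $ i)"
    and S: "open S" "\<And>x i. x \<in> S \<Longrightarrow> \<bar>x $ i\<bar> \<le> r"
  shows "symb m S (\<lambda>p :: 'p. monomial_weight V) (\<lambda>p x. complex_of_real (P x))"
proof (rule symb_cong[OF S(1)])
  show "symb m S (\<lambda>p :: 'p. monomial_weight V) (\<lambda>p x. complex_of_real (psum c x))"
    by (rule symb_psum[OF c r V _ S]) (use dom in blast)
  fix p :: 'p and x assume "x \<in> S"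
  then have "\<bar>x $ i\<bar> < R" for i using S(2)[of x i] r by linarith
  then show "complex_of_real (psum c x) = complex_of_real (P x)" using P by simp
qed

text \<open>Cauchy-Schwarz, to pass to the sum of squares that occurs in
  \<open>ibp_density\<close>.\<close>

lemma squared_lower_bound:
  fixes f :: "'n::finite \<Rightarrow> real"
  assumes "0 \<le> \<delta> * w" "\<delta> * w \<le> (\<Sum>i\<in>UNIV. \<bar>f i\<bar>)"
  shows "\<delta>\<^sup>2 / real CARD('n) * w\<^sup>2 \<le> (\<Sum>i\<in>UNIV. (f i)\<^sup>2)"
proof -
  have "(\<delta> * w)\<^sup>2 \<le> (\<Sum>i\<in>UNIV. \<bar>f i\<bar>)\<^sup>2" by (rule power_mono[OF assms(2,1)])
  also have "\<dots> \<le> (\<Sum>i\<in>UNIV. \<bar>f i\<bar>\<^sup>2) * real CARD('n)"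
    using sum_squared_le_sum_of_squares[of "\<lambda>i. \<bar>f i\<bar>" "UNIV :: 'n set"] by simp
  finally show ?thesis by (simp add: pos_divide_le_eq power_mult_distrib)
qed

lemma ps_conv_finite_support:
  assumes "finite A" "\<And>\<alpha>. \<alpha> \<notin> A \<Longrightarrow> c \<alpha> = 0"
  shows "ps_conv R c"
  unfolding ps_conv_def
proof (intro allI impI finite_nonzero_values_imp_summable_on)
  fix r :: real
  show "finite {\<alpha>\<in>UNIV. \<bar>c \<alpha>\<bar> * r ^ vsize \<alpha> \<noteq> 0}"
    by (rule finite_subset[OF _ assms(1)]) (use assms(2) in force)
qed

lemma ps_conv_diff:
  assumes "ps_conv R c" "ps_conv R d"
  shows "ps_conv R (\<lambda>\<alpha>. c \<alpha> - d \<alpha>)"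
  unfolding ps_conv_def
proof (intro allI impI)
  fix r assume r: "0 < r" "r < R"
  have "(\<lambda>\<alpha>. \<bar>c \<alpha>\<bar> * r ^ vsize \<alpha> + \<bar>d \<alpha>\<bar> * r ^ vsize \<alpha>) summable_on UNIV"
    using assms r by (intro summable_on_add) (auto simp: ps_conv_def)
  then show "(\<lambda>\<alpha>. \<bar>c \<alpha> - d \<alpha>\<bar> * r ^ vsize \<alpha>) summable_on UNIV"
  proof (rule summable_on_comparison_test)
    show "\<bar>c \<alpha> - d \<alpha>\<bar> * r ^ vsize \<alpha> \<le> \<bar>c \<alpha>\<bar> * r ^ vsize \<alpha> + \<bar>d \<alpha>\<bar> * r ^ vsize \<alpha>" for \<alpha>
      unfolding distrib_right[symmetric] using r by (intro mult_right_mono abs_triangle_ineq4) auto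
  qed (use r in auto)
qed

text \<open>Convenience puts a pure power of each coordinate into \<open>V\<close>, of degree at
  most \<open>k\<close> since \<open>P\<close> has no higher terms. The power of the largest
  coordinate then bounds \<open>norm x ^ k\<close>.\<close>

lemma convenient_norm_power_le:
  fixes f :: "real ^ 'n::finite \<Rightarrow> real" and k :: nat
  defines "P \<equiv> taylor_polynomial k f"
  assumes conv: "convenient P" and V: "finite V" "V \<subseteq> ps_supp P" and N: "newton_polyhedron P = newton_hull V"
    and R: "0 < R" "ps_conv R (ps_coeff P)" "\<forall>x. (\<forall>i. \<bar>x $ i\<bar> < R) \<longrightarrow> P x = psum (ps_coeff P) x"
    and x: "\<And>i. \<bar>x $ i\<bar> \<le> 1"
  shows "norm x ^ k \<le> real CARD('n) ^ k * monomial_weight V x"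
proof -
  have ax: "\<exists>b\<le>k. axis j b \<in> V" for j
  proof -
    obtain t where t: "axis j t \<in> newton_hull V" using conv unfolding convenient_def N by blast
    have Vne: "V \<noteq> {}" using t by (auto simp: newton_hull_def)
    \<comment> \<open>This covector vanishes on axis \<open>j\<close> and so at a point of the
      polyhedron; hence it vanishes at some exponent of \<open>V\<close>, which must lie on the
      axis.\<close>
    define e :: "real ^ 'n" where "e = (\<chi> i. if i = j then 0 else 1)"
    have "min_weight V e \<le> axis j t \<bullet> e" by (rule newton_hull_inner_ge[OF V(1) t]) (simp add: e_def)
    also have "\<dots> = 0" by (simp add: inner_axis' e_def)
    finally have le0: "min_weight V e \<le> 0" .
    have "min_weight V e \<in> (\<lambda>v. rvec v \<bullet> e) ` V" unfolding min_weight_def using V(1) Vne by (intro Min_in) auto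
    then obtain v where v: "v \<in> V" "rvec v \<bullet> e \<le> 0" using le0 by auto
    have "v $ i = 0" if "i \<noteq> j" for i
    proof -
      have "real (v $ i) * e $ i \<le> (\<Sum>i\<in>UNIV. real (v $ i) * e $ i)" by (rule member_le_sum) (auto simp: e_def)
      then show ?thesis using v(2) that by (simp add: e_def inner_vec_def)
    qed
    then have va: "v = axis j (v $ j)" by (simp add: vec_eq_iff axis_def)
    let ?a = "\<lambda>\<alpha>. multi_deriv \<alpha> f 0 / (\<Prod>i\<in>UNIV. fact (\<alpha> $ i))"
    define q where "q \<alpha> = (if vsize \<alpha> \<le> k then ?a \<alpha> else 0)" for \<alpha> :: "nat ^ 'n"
    \<comment> \<open>\<open>ps_coeff\<close> is a chosen expansion of \<open>P\<close>; it is
      compared with the visible Taylor coefficients \<open>q\<close> on the axis, where both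
      represent \<open>P\<close>.\<close>
    define d where "d \<alpha> = ps_coeff P \<alpha> - q \<alpha>" for \<alpha>
    have qc: "ps_conv R q" by (rule ps_conv_finite_support[OF finite_vsize_le[of k]]) (simp add: q_def)
    have dc: "ps_conv R d" unfolding d_def by (rule ps_conv_diff[OF R(2) qc])
    have qP: "psum q y = P y" for y
    proof -
      have "psum q y = (\<Sum>\<alpha>\<in>{\<alpha>. vsize \<alpha> \<le> k}. q \<alpha> * mpow y \<alpha>)"
        by (rule psum_finite[OF finite_vsize_le]) (simp add: q_def)
      then show ?thesis unfolding P_def taylor_polynomial_eq_pmono pmono_def by (simp add: q_def)
    qed
    have "d (axis j (v $ j)) = 0"
    proof (rule psum_axis_eq_0[OF dc R(1)])
      fix t assume t: "0 < t" "t < R"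
      have tR: "\<bar>axis j t $ i\<bar> < R" for i using t R(1) by (simp add: axis_def)
      have "psum (\<lambda>\<alpha>. d \<alpha> + q \<alpha>) (axis j t) = psum d (axis j t) + psum q (axis j t)"
        by (rule psum_add[OF dc qc tR])
      moreover have "(\<lambda>\<alpha>. d \<alpha> + q \<alpha>) = ps_coeff P" by (simp add: d_def)
      ultimately show "psum d (axis j t) = 0" using R(3) tR qP by simp
    qed
    then have "q v = ps_coeff P v" unfolding va[symmetric] by (simp add: d_def)
    moreover have "ps_coeff P v \<noteq> 0" using v(1) V(2) by (auto simp: ps_supp_def)
    ultimately have "vsize v \<le> k" by (auto simp: q_def split: if_splits)
    moreover have "v $ j \<le> vsize v" unfolding vsize_def by (rule member_le_sum) auto
    ultimately show ?thesis using v(1) va by (metis order_trans)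
  qed
  obtain j where j: "\<And>i. \<bar>x $ i\<bar> \<le> \<bar>x $ j\<bar>"
  proof -
    have "Max (range (\<lambda>i. \<bar>x $ i\<bar>)) \<in> range (\<lambda>i. \<bar>x $ i\<bar>)" by (intro Max_in) auto
    then obtain j where "Max (range (\<lambda>i. \<bar>x $ i\<bar>)) = \<bar>x $ j\<bar>" by blast
    moreover have "\<bar>x $ i\<bar> \<le> Max (range (\<lambda>i. \<bar>x $ i\<bar>))" for i by (intro Max_ge) auto
    ultimately show thesis by (intro that[of j]) simp
  qed
  obtain b where b: "b \<le> k" "axis j b \<in> V" using ax by blast
  have "norm x \<le> (\<Sum>i\<in>UNIV. \<bar>x $ i\<bar>)" by (rule norm_le_l1_cart)
  also have "\<dots> \<le> (\<Sum>i\<in>(UNIV :: 'n set). \<bar>x $ j\<bar>)" by (rule sum_mono) (rule j)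
  finally have "norm x \<le> real CARD('n) * \<bar>x $ j\<bar>" by simp
  then have "norm x ^ k \<le> (real CARD('n) * \<bar>x $ j\<bar>) ^ k" by (intro power_mono) auto
  also have "\<dots> = real CARD('n) ^ k * \<bar>x $ j\<bar> ^ k" by (rule power_mult_distrib)
  also have "\<dots> \<le> real CARD('n) ^ k * monomial_weight V x"
  proof (rule mult_left_mono)
    have "\<bar>x $ j\<bar> ^ k \<le> \<bar>x $ j\<bar> ^ b" using b(1) x by (intro power_decreasing) auto
    also have "\<dots> = \<bar>mpow x (axis j b)\<bar>" by (simp add: mpow_axis_exponent power_abs)
    also have "\<dots> \<le> monomial_weight V x"
      unfolding monomial_weight_def using b(2) V(1) by (intro member_le_sum) auto
    finally show "\<bar>x $ j\<bar> ^ k \<le> monomial_weight V x" .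
  qed simp
  finally show ?thesis .
qed

text \<open>All that the integral estimate uses of the phase. The radius is separate from the order
  \<open>m\<close>, since one ball has to serve all orders in the smooth case.\<close>

definition good_phase :: "(real ^ 'n::finite \<Rightarrow> real) \<Rightarrow> (nat ^ 'n) set \<Rightarrow> real \<Rightarrow> nat \<Rightarrow> bool" where
  "good_phase \<phi> V \<rho> m \<longleftrightarrow> symb m (ball 0 \<rho>) (\<lambda>l :: real. monomial_weight V) (\<lambda>l x. complex_of_real (\<phi> x)) \<and>
     (\<exists>c>0. \<forall>x\<in>ball 0 \<rho>. c * (monomial_weight V x)\<^sup>2 \<le> (\<Sum>i\<in>UNIV. (eul i \<phi> x)\<^sup>2))"

lemma good_phase_analytic:
  fixes \<phi> :: "real ^ 'n::finite \<Rightarrow> real"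
  assumes "analytic_nondegenerate \<phi>" "\<phi> 0 = 0"
  shows "\<exists>V \<rho>. finite V \<and> 0 \<notin> V \<and> newton_polyhedron \<phi> = newton_hull V \<and> 0 < \<rho> \<and> \<rho> \<le> 1 \<and> (\<forall>m. good_phase \<phi> V \<rho> m)"
proof -
  from analytic_nondegenerate_data[OF assms]
  obtain V R r \<delta> where V: "finite V" "0 \<notin> V" "newton_polyhedron \<phi> = newton_hull V"
    and r: "0 < r" "r < R" "r \<le> 1" and \<delta>: "0 < \<delta>" and c: "ps_conv R (ps_coeff \<phi>)"
    and P: "\<forall>x. (\<forall>i. \<bar>x $ i\<bar> < R) \<longrightarrow> \<phi> x = psum (ps_coeff \<phi>) x"
    and dom: "\<forall>\<alpha>. ps_coeff \<phi> \<alpha> \<noteq> 0 \<longrightarrow> (\<exists>v\<in>V. \<forall>i. v $ i \<le> \<alpha> $ i)"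
    and low: "\<forall>x. (\<forall>i. \<bar>x $ i\<bar> < r) \<longrightarrow> \<delta> * monomial_weight V x \<le> (\<Sum>i\<in>UNIV. \<bar>eul i \<phi> x\<bar>)"
    by (elim exE conjE)
  have xr: "\<bar>x $ i\<bar> < r" if "x \<in> ball 0 r" for x :: "real ^ 'n" and i
    using that component_le_norm_cart[of x i] by simp
  have "good_phase \<phi> V r m" for m
    unfolding good_phase_def
  proof (intro conjI exI[of _ "\<delta>\<^sup>2 / real CARD('n)"] ballI)
    show "symb m (ball 0 r) (\<lambda>l :: real. monomial_weight V) (\<lambda>l x. complex_of_real (\<phi> x))"
      by (rule symb_analytic[OF V(1) r c P dom]) (rule open_ball, erule xr[THEN less_imp_le])
    fix x :: "real ^ 'n" assume x: "x \<in> ball 0 r"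
    show "\<delta>\<^sup>2 / real CARD('n) * (monomial_weight V x)\<^sup>2 \<le> (\<Sum>i\<in>UNIV. (eul i \<phi> x)\<^sup>2)"
      using \<delta> low xr[OF x] by (intro squared_lower_bound) (auto simp: monomial_weight_def intro!: mult_nonneg_nonneg sum_nonneg)
  qed (use \<delta> in simp)
  then show ?thesis using V r by blast
qed

text \<open>The Taylor polynomial satisfies the bounds, and the remainder is a perturbation: its
  Euler derivatives are \<open>O(norm x ^ k)\<close>, hence bounded by the weight, and the first
  ones are small compared with it on a small ball.\<close>

lemma good_phase_Ck:
  fixes \<phi> :: "real ^ 'n::finite \<Rightarrow> real" and k :: nat
  defines "P \<equiv> taylor_polynomial k \<phi>"
  assumes k: "1 \<le> k" and V0: "open V0" "0 \<in> V0" "Ck_on k \<phi> V0"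
    and conv: "convenient P" and nd: "analytic_nondegenerate P" and \<phi>0: "\<phi> 0 = 0"
  shows "\<exists>V \<rho>. finite V \<and> 0 \<notin> V \<and> newton_polyhedron P = newton_hull V \<and> 0 < \<rho> \<and> \<rho> \<le> 1 \<and>
    (\<forall>m\<ge>k. Ck_on m \<phi> V0 \<longrightarrow> good_phase \<phi> V \<rho> m)"
proof -
  define Q where "Q = (\<lambda>x. \<phi> x - P x)"
  have CP: "Ck_on m P S" for m S unfolding P_def taylor_polynomial_eq_pmono by (rule Ck_on_pmono)
  have CQ: "Ck_on m Q V0" if "Ck_on m \<phi> V0" for m unfolding Q_def by (rule Ck_on_diff[OF V0(1) that CP])
  have Q0: "foldr partial_deriv L Q 0 = 0" if "length L \<le> k" for L
    unfolding Q_def P_def by (rule foldr_taylor_remainder_at_0[OF V0 that])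
  have "Q 0 = 0" using Q0[of "[]"] by simp
  then have P0: "P 0 = 0" using \<phi>0 by (simp add: Q_def)
  from analytic_nondegenerate_data[OF nd P0]
  obtain V R r \<delta> where V: "finite V" "V \<subseteq> ps_supp P" "0 \<notin> V" "newton_polyhedron P = newton_hull V"
    and r: "0 < r" "r < R" "r \<le> 1" and \<delta>: "0 < \<delta>" and c: "ps_conv R (ps_coeff P)"
    and P: "\<forall>x. (\<forall>i. \<bar>x $ i\<bar> < R) \<longrightarrow> P x = psum (ps_coeff P) x"
    and dom: "\<forall>\<alpha>. ps_coeff P \<alpha> \<noteq> 0 \<longrightarrow> (\<exists>v\<in>V. \<forall>i. v $ i \<le> \<alpha> $ i)"
    and low: "\<forall>x. (\<forall>i. \<bar>x $ i\<bar> < r) \<longrightarrow> \<delta> * monomial_weight V x \<le> (\<Sum>i\<in>UNIV. \<bar>eul i P x\<bar>)"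
    by (elim exE conjE)
  let ?w = "monomial_weight V"
  define C where "C = real CARD('n) ^ k"
  have C0: "0 < C" by (simp add: C_def)
  have R0: "0 < R" using r by simp
  have nk: "norm x ^ k \<le> C * ?w x" if "\<And>i. \<bar>x $ i\<bar> \<le> 1" for x
    unfolding C_def
    by (rule convenient_norm_power_le[OF conv[unfolded P_def] V(1) V(2,4)[unfolded P_def] R0 c[unfolded P_def] P[unfolded P_def] that])
  \<comment> \<open>Chosen so that the remainder uses up at most half of the lower bound \<delta>,
    over all coordinates together.\<close>
  define \<eta> where "\<eta> = \<delta> / (2 * real CARD('n) * C)"
  have \<eta>: "0 < \<eta>" using \<delta> C0 by (simp add: \<eta>_def)
  have "\<forall>i. \<exists>e>0. \<forall>x. norm x < e \<longrightarrow> \<bar>partial_deriv i Q x\<bar> \<le> \<eta> * norm x ^ (k - 1)"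
  proof
    fix i
    show "\<exists>e>0. \<forall>x. norm x < e \<longrightarrow> \<bar>partial_deriv i Q x\<bar> \<le> \<eta> * norm x ^ (k - 1)"
    proof (rule flat_little_o[OF V0(1,2) _ _ \<eta>])
      have "Ck_on (Suc (k - 1)) Q V0" using CQ[OF V0(3)] k by simp
      then show "Ck_on (k - 1) (partial_deriv i Q) V0" by simp
      show "foldr partial_deriv L (partial_deriv i Q) 0 = 0" if "length L \<le> k - 1" for L
        using Q0[of "L @ [i]"] that k by simp
    qed
  qed
  then obtain e where e: "\<forall>i. 0 < e i \<and> (\<forall>x. norm x < e i \<longrightarrow> \<bar>partial_deriv i Q x\<bar> \<le> \<eta> * norm x ^ (k - 1))"
    by (rule choice[THEN exE])
  obtain e0 where e0: "e0 > 0" "cball 0 e0 \<subseteq> V0" using V0(1,2) unfolding open_contains_cball by blast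
  \<comment> \<open>Fixed by \<open>k\<close> and by the first derivatives of the remainder, before
    \<open>m\<close> enters.\<close>
  define \<rho> where "\<rho> = min (min e0 r) (Min (range e))"
  have "0 < Min (range e)" using e by simp
  then have \<rho>: "0 < \<rho>" "\<rho> \<le> e0" "\<rho> \<le> r" "\<rho> \<le> Min (range e)" using e0 r by (auto simp: \<rho>_def)
  have \<rho>e: "\<rho> \<le> e i" for i by (rule order_trans[OF \<rho>(4)]) (rule Min_le, auto)
  have xr: "\<bar>x $ i\<bar> < r" if "x \<in> ball 0 \<rho>" for x :: "real ^ 'n" and i
    using that component_le_norm_cart[of x i] \<rho>(3) by simp
  have \<rho>V0: "cball 0 \<rho> \<subseteq> V0" using e0(2) \<rho>(2) by (meson order_trans subset_cball)
  have low': "(\<delta> / 2) * ?w x \<le> (\<Sum>i\<in>UNIV. \<bar>eul i \<phi> x\<bar>)" if x: "x \<in> ball 0 \<rho>" for x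
  proof -
    have xV0: "x \<in> V0" using x \<rho>V0 by auto
    have x1: "\<bar>x $ i\<bar> \<le> 1" for i using xr[OF x, of i] r(3) by linarith
    have "Ck_on (Suc 0) \<phi> V0" using Ck_on_antimono[OF _ V0(3), of "Suc 0"] k by simp
    then have d: "\<phi> differentiable (at x)" using xV0 by simp
    have "Ck_on (Suc 0) P V0" by (rule CP)
    then have dP: "P differentiable (at x)" using xV0 by simp
    have Qi: "\<bar>eul i Q x\<bar> \<le> \<eta> * (C * ?w x)" for i
    proof -
      have "norm x < e i" using x \<rho>e[of i] by simp
      then have "\<bar>partial_deriv i Q x\<bar> \<le> \<eta> * norm x ^ (k - 1)" using e by blast
      then have "\<bar>x $ i\<bar> * \<bar>partial_deriv i Q x\<bar> \<le> norm x * (\<eta> * norm x ^ (k - 1))"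
        by (intro mult_mono component_le_norm_cart) auto
      also have "\<dots> = \<eta> * norm x ^ Suc (k - 1)" by simp
      also have "\<dots> \<le> \<eta> * (C * ?w x)" using nk[OF x1] \<eta> k by (intro mult_left_mono) auto
      finally show ?thesis by (simp add: eul_def abs_mult partial_deriv_eq_pd)
    qed
    have "\<delta> * ?w x \<le> (\<Sum>i\<in>UNIV. \<bar>eul i P x\<bar>)" using low xr[OF x] by blast
    also have "\<dots> \<le> (\<Sum>i\<in>UNIV. \<bar>eul i \<phi> x\<bar> + \<eta> * (C * ?w x))"
    proof (rule sum_mono)
      fix i
      have "eul i Q x = eul i \<phi> x - eul i P x" unfolding Q_def by (rule eul_diff[OF d dP])
      then show "\<bar>eul i P x\<bar> \<le> \<bar>eul i \<phi> x\<bar> + \<eta> * (C * ?w x)" using Qi[of i] by linarith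
    qed
    also have "\<dots> = (\<Sum>i\<in>UNIV. \<bar>eul i \<phi> x\<bar>) + (\<delta> / 2) * ?w x"
      using C0 by (simp add: sum.distrib \<eta>_def)
    finally show ?thesis by (simp add: algebra_simps)
  qed
  have "good_phase \<phi> V \<rho> m" if m: "k \<le> m" "Ck_on m \<phi> V0" for m
    unfolding good_phase_def
  proof (intro conjI exI[of _ "(\<delta> / 2)\<^sup>2 / real CARD('n)"] ballI)
    have sP: "symb m (ball 0 \<rho>) (\<lambda>l :: real. ?w) (\<lambda>l x. complex_of_real (P x))"
      by (rule symb_analytic[OF V(1) r c P dom]) (rule open_ball, erule xr[THEN less_imp_le])
    have "symb m (ball 0 \<rho>) (\<lambda>l :: real. \<lambda>x. norm x ^ k) (\<lambda>l x. complex_of_real (Q x))"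
      by (rule symb_Ck_on_flat[OF V0(1) \<rho>V0 refl CQ[OF m(2)] m(1)]) (simp add: Q0)
    then have "symb m (ball 0 \<rho>) (\<lambda>l :: real. ?w) (\<lambda>l x. complex_of_real (Q x))"
    proof (rule symb_mono_weight[where C=C])
      show "norm x ^ k \<le> C * ?w x" if "x \<in> ball 0 \<rho>" for x :: "real ^ 'n"
        using xr[OF that] r(3) by (intro nk) (auto intro: less_imp_le order_trans)
    qed simp
    from symb_add[OF open_ball sP this]
    show "symb m (ball 0 \<rho>) (\<lambda>l :: real. ?w) (\<lambda>l x. complex_of_real (\<phi> x))"
      by (rule symb_cong[OF open_ball]) (simp add: Q_def)
    fix x :: "real ^ 'n" assume x: "x \<in> ball 0 \<rho>"
    show "(\<delta> / 2)\<^sup>2 / real CARD('n) * (?w x)\<^sup>2 \<le> (\<Sum>i\<in>UNIV. (eul i \<phi> x)\<^sup>2)"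
      using \<delta> low'[OF x] by (intro squared_lower_bound) (auto simp: monomial_weight_def intro!: mult_nonneg_nonneg sum_nonneg)
  qed (use \<delta> in simp)
  then show ?thesis using V \<rho> r by (intro exI[of _ V] exI[of _ \<rho>]) auto
qed

text \<open>The phase carries one more derivative than the amplitude, because the field of the
  integration by parts contains a derivative of \<phi>.\<close>

lemma osc_estimate_good_phase:
  fixes \<phi> \<psi> :: "real ^ 'n::finite \<Rightarrow> real"
  assumes V: "finite V" "0 \<notin> V" and \<rho>: "\<rho> \<le> 1" and g: "good_phase \<phi> V \<rho> (Suc M)" and \<psi>: "Ck_on M \<psi> UNIV"
    and K: "compact (closure {x. \<psi> x \<noteq> 0})" "closure {x. \<psi> x \<noteq> 0} \<subseteq> ball 0 \<rho>"
    and M: "newton_floor (newton_hull V) (\<beta> + 1) < real M"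
  shows "osc_estimate (newton_hull V) \<phi> \<psi> \<beta>"
proof (cases "V = {}")
  case True
  then show ?thesis using osc_estimate_empty by (simp add: newton_hull_def)
next
  case False
  obtain c where c: "c > 0" "\<And>x. x \<in> ball 0 \<rho> \<Longrightarrow> c * (monomial_weight V x)\<^sup>2 \<le> (\<Sum>i\<in>UNIV. (eul i \<phi> x)\<^sup>2)"
    using g unfolding good_phase_def by blast
  have \<Phi>: "symb (Suc M) (ball 0 \<rho>) (\<lambda>l :: real. monomial_weight V) (\<lambda>l x. complex_of_real (\<phi> x))"
    using g unfolding good_phase_def by blast
  \<comment> \<open>Flatness of order 0 is no condition: the amplitude is a symbol of weight
    1.\<close>
  have "symb M (ball 0 \<rho>) (\<lambda>l :: real. \<lambda>x. norm x ^ 0) (\<lambda>l x. complex_of_real (\<psi> x))"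
  proof (rule symb_Ck_on_flat[OF open_UNIV subset_UNIV refl \<psi>])
    fix L :: "'n list" assume "length L < 0"
    then show "foldr partial_deriv L \<psi> 0 = 0" by simp
  qed simp
  then have \<psi>s: "symb M (ball 0 \<rho>) (\<lambda>l :: real. \<lambda>x. 1) (\<lambda>l x. complex_of_real (\<psi> x))" by simp
  show ?thesis
  proof (rule osc_estimate_core[where V=V and S="ball 0 \<rho>" and c=c and K="closure {x. \<psi> x \<noteq> 0}" and M=M])
    show "finite V" "V \<noteq> {}" "0 \<notin> V" by (fact V(1) False V(2))+
    show "open (ball (0 :: real ^ 'n) \<rho>)" by (rule open_ball)
    show "\<bar>x $ i\<bar> \<le> 1" if "x \<in> ball 0 \<rho>" for x :: "real ^ 'n" and i
      using that component_le_norm_cart[of x i] \<rho> by simp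
    show "symb (Suc M) (ball 0 \<rho>) (\<lambda>l :: real. monomial_weight V) (\<lambda>l x. complex_of_real (\<phi> x))" by (rule \<Phi>)
    show "0 < c" by (rule c(1))
    show "c * (monomial_weight V x)\<^sup>2 \<le> (\<Sum>i\<in>UNIV. (eul i \<phi> x)\<^sup>2)" if "x \<in> ball 0 \<rho>" for x
      by (rule c(2)[OF that])
    show "symb M (ball 0 \<rho>) (\<lambda>l :: real. \<lambda>x. 1) (\<lambda>l x. complex_of_real (\<psi> x))" by (rule \<psi>s)
    show "compact (closure {x. \<psi> x \<noteq> 0})" "closure {x. \<psi> x \<noteq> 0} \<subseteq> ball 0 \<rho>" by (fact K)+
    show "\<psi> x = 0" if "x \<notin> closure {x. \<psi> x \<noteq> 0}" for x
      using that closure_subset[of "{x. \<psi> x \<noteq> 0}"] by (simp add: subset_iff) metis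
    show "newton_floor (newton_hull V) (\<beta> + 1) < real M" by (rule M)
  qed
qed

section \<open>Choice of the neighbourhood and of the number of integrations by parts\<close>

theorem theorem2p3:
  fixes k :: nat and \<phi> :: "real ^ 'n::finite \<Rightarrow> real" and N :: "(real ^ 'n) set"
  assumes "k \<ge> 1"
    and "\<phi> 0 = 0" and "gradient \<phi> 0 = 0"
    and "analytic_nondegenerate \<phi> \<and> N = newton_polyhedron \<phi> \<or>
         k_nondegenerate k \<phi> \<and> N = newton_polyhedron (taylor_polynomial k \<phi>)"
  shows "\<exists>U. open U \<and> 0 \<in> U \<and>
    (\<forall>\<psi> :: real ^ 'n \<Rightarrow> real.
       Ck_on k \<psi> UNIV \<and> compact (closure {x. \<psi> x \<noteq> 0}) \<and> closure {x. \<psi> x \<noteq> 0} \<subseteq> U \<longrightarrow>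
         (\<forall>\<beta> :: nat ^ 'n. newton_floor N (\<beta> + 1) < real k - 1 \<longrightarrow> osc_estimate N \<phi> \<psi> \<beta>) \<and>
         (smooth_near_0 \<phi> \<and> (\<forall>m. Ck_on m \<psi> UNIV) \<longrightarrow>
            (\<forall>\<beta> :: nat ^ 'n. osc_estimate N \<phi> \<psi> \<beta>)))"
proof -
  have "\<exists>V \<rho>. finite V \<and> 0 \<notin> V \<and> N = newton_hull V \<and> 0 < \<rho> \<and> \<rho> \<le> 1 \<and> good_phase \<phi> V \<rho> k \<and>
    (smooth_near_0 \<phi> \<longrightarrow> (\<forall>m\<ge>k. good_phase \<phi> V \<rho> m))"
    using assms(4)
  proof
    assume "analytic_nondegenerate \<phi> \<and> N = newton_polyhedron \<phi>"
    then show ?thesis using good_phase_analytic[of \<phi>] assms(2) by metis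
  next
    assume kn: "k_nondegenerate k \<phi> \<and> N = newton_polyhedron (taylor_polynomial k \<phi>)"
    \<comment> \<open>One neighbourhood for both conclusions: if \<phi> is smooth near 0, the one on
      which all derivatives exist is taken from the start.\<close>
    have "\<exists>V0. open V0 \<and> 0 \<in> V0 \<and> Ck_on k \<phi> V0 \<and> (smooth_near_0 \<phi> \<longrightarrow> (\<forall>m. Ck_on m \<phi> V0))"
      using kn unfolding k_nondegenerate_def Ck_near_0_def smooth_near_0_def by blast
    then obtain V0 where V0: "open V0" "0 \<in> V0" "Ck_on k \<phi> V0" "smooth_near_0 \<phi> \<longrightarrow> (\<forall>m. Ck_on m \<phi> V0)"
      by (elim exE conjE)
    have "convenient (taylor_polynomial k \<phi>)" "analytic_nondegenerate (taylor_polynomial k \<phi>)"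
      using kn by (auto simp: k_nondegenerate_def)
    from good_phase_Ck[OF assms(1) V0(1-3) this assms(2)]
    obtain V \<rho> where V: "finite V" "0 \<notin> V" "newton_polyhedron (taylor_polynomial k \<phi>) = newton_hull V"
        "0 < \<rho>" "\<rho> \<le> 1" and g: "\<forall>m\<ge>k. Ck_on m \<phi> V0 \<longrightarrow> good_phase \<phi> V \<rho> m"
      by (elim exE conjE)
    show ?thesis using V V0(3,4) g kn by (intro exI[of _ V] exI[of _ \<rho>]) auto
  qed
  then obtain V \<rho> where V: "finite V" "0 \<notin> V" and N: "N = newton_hull V" and \<rho>: "0 < \<rho>" "\<rho> \<le> 1"
    and g: "good_phase \<phi> V \<rho> k" "smooth_near_0 \<phi> \<longrightarrow> (\<forall>m\<ge>k. good_phase \<phi> V \<rho> m)"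
    by (elim exE conjE)
  show ?thesis
  proof (intro exI[of _ "ball 0 \<rho>"] conjI allI impI)
    show "(0 :: real ^ 'n) \<in> ball 0 \<rho>" using \<rho> by simp
    fix \<psi> :: "real ^ 'n \<Rightarrow> real" and \<beta> :: "nat ^ 'n"
    assume \<psi>: "Ck_on k \<psi> UNIV \<and> compact (closure {x. \<psi> x \<noteq> 0}) \<and> closure {x. \<psi> x \<noteq> 0} \<subseteq> ball 0 \<rho>"
    show "osc_estimate N \<phi> \<psi> \<beta>" if "newton_floor N (\<beta> + 1) < real k - 1"
      unfolding N
    proof (rule osc_estimate_good_phase[OF V \<rho>(2)])
      \<comment> \<open>With \<open>k - 1\<close> integrations by parts the phase is differentiated
        \<open>k\<close> times, and the hypothesis on \<open>newton_floor\<close> says that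
        \<open>k - 1\<close> steps suffice.\<close>
      show "good_phase \<phi> V \<rho> (Suc (k - 1))" using g(1) assms(1) by simp
      show "Ck_on (k - 1) \<psi> UNIV" using \<psi> by (intro Ck_on_antimono[of "k - 1" k]) auto
      show "newton_floor (newton_hull V) (\<beta> + 1) < real (k - 1)" using that assms(1) N by (simp add: of_nat_diff)
    qed (use \<psi> in auto)
    show "osc_estimate N \<phi> \<psi> \<beta>" if sm: "smooth_near_0 \<phi> \<and> (\<forall>m. Ck_on m \<psi> UNIV)"
      unfolding N
    proof (rule osc_estimate_good_phase[OF V \<rho>(2)])
      \<comment> \<open>Large enough to exceed the exponent, and at least \<open>k\<close> so that
        the phase bound of order \<open>M + 1\<close> is among those provided.\<close>
      define M where "M = max k (nat \<lceil>newton_floor (newton_hull V) (\<beta> + 1)\<rceil> + 1)"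
      show "good_phase \<phi> V \<rho> (Suc M)" using g(2) sm by (simp add: M_def)
      show "Ck_on M \<psi> UNIV" using sm by blast
      have "newton_floor (newton_hull V) (\<beta> + 1) < real (nat \<lceil>newton_floor (newton_hull V) (\<beta> + 1)\<rceil> + 1)" by linarith
      also have "\<dots> \<le> real M" by (simp add: M_def)
      finally show "newton_floor (newton_hull V) (\<beta> + 1) < real M" .
    qed (use \<psi> in auto)
  qed simp
qed

end
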